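(* Let $\mathcal{H}_1,\mathcal{H}_2$ be two separable complex Hilbert spaces with countable orthogonal bases $\mathbf{e}_{i,1}$, $i\in\mathbb{N}$, and $\mathbf{e}_{i,2}$, $i\in\mathbb{N}$, respectively. Set $\mathcal{H}=\mathcal{H}_1\otimes\mathcal{H}_2$ and let $\mathcal{X}\subset\mathcal{H}$ be a finite dimensional subspace. Let $\rho_i\in\mathrm{S}_+(\mathcal{H}_i)$, $i\in\{1,2\}$, be given trace class operators with $\mathrm{Tr}\,\rho_1=\mathrm{Tr}\,\rho_2=1$. For $n\in\mathbb{N}$ and $i\in\{1,2\}$ let $P_{n,i}\in\mathrm{S}_+(\mathcal{H}_i)$ be the orthogonal projection onto $\mathcal{H}_{i,n}=\operatorname{span}(\mathbf{e}_{1,i},\dots,\mathbf{e}_{n,i})$, and set $\mathcal{X}_n=(P_{n,1}\otimes P_{n,2})\mathcal{X}$ and $\rho_{i,n}=P_{n,i}\rho_iP_{n,i}$. Consider the semidefinite programming problem $$\mu_n(\rho_1,\rho_2,\mathcal{X})=\max\left\{\mathrm{Tr}(XP_{\mathcal{X}_n}):\ \mathrm{Tr}_2X\preceq\rho_{1,n},\ \mathrm{Tr}_1X\preceq\rho_{2,n},\ X\in(P_{n,1}\otimes P_{n,2})\,\mathrm{S}_+(\mathcal{H})\,(P_{n,1}\otimes P_{n,2})\right\}.$$ Then the following statements are equivalent: (1) There exists $\rho\in\mathrm{S}_{+,1}(\mathcal{H}_1\otimes\mathcal{H}_2)$ with $\mathrm{Tr}_1(\rho)=\rho_2$, $\mathrm{Tr}_2(\rho)=\rho_1$,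 and $\operatorname{supp}(\rho)\subset\mathcal{X}$. (2) $\lim_{n\to\infty}\mu_n(\rho_1,\rho_2,\mathcal{X})=1$.
   Context: For a separable complex Hilbert space $\mathcal{H}$: $\mathrm{T}(\mathcal{H})$ is the Banach space of trace class operators with trace norm; $\mathrm{S}_+(\mathcal{H})$ is the cone of bounded selfadjoint positive semidefinite operators; $\mathrm{S}_{+,1}(\mathcal{H})$ is the set of positive semidefinite trace class operators of trace $1$; $A\preceq B$ means that $B-A$ is positive semidefinite. The support $\operatorname{supp}\rho$ is the closure of the range of $\rho$. $P_{\mathcal{Y}}$ denotes the orthogonal projection of $\mathcal{H}$ onto a closed subspace $\mathcal{Y}$. Inner products are linear in the first argument, and $\mathbf{x}\mathbf{y}^\vee$ denotes the operator $\mathbf{z}\mapsto\langle\mathbf{z},\mathbf{y}\rangle\mathbf{x}$. The partial traces $\mathrm{Tr}_1:\mathrm{T}(\mathcal{H}_1\otimes\mathcal{H}_2)\to\mathrm{T}(\mathcal{H}_2)$ and $\mathrm{Tr}_2:\mathrm{T}(\mathcal{H}_1\otimes\mathcal{H}_2)\to\mathrm{T}(\mathcal{H}_1)$ are the unique bounded linear maps with $\mathrm{Tr}_1((\mathbf{x}\otimes\mathbf{y})(\mathbf{u}\otimes\mathbf{v})^\vee)=\langle\mathbf{x},\mathbf{u}\rangle\,\mathbf{y}\mathbf{v}^\vee$ and $\mathrm{Tr}_2((\mathbf{x}\otimes\mathbf{y})(\mathbf{u}\otimes\mathbf{v})^\vee)=\langle\mathbf{y},\mathbf{v}\rangle\,\mathbf{x}\mathbf{u}^\vee$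 (so $\mathrm{Tr}_i$ traces out the $i$-th factor). *)

theory Defs
  imports "HOL-Analysis.Analysis"
begin

section \<open>Complex Hilbert spaces\<close>

class complex_vector = real_vector +
  fixes scaleC :: "complex \<Rightarrow> 'a \<Rightarrow> 'a" (infixr \<open>*\<^sub>C\<close> 75)
  assumes scaleC_add_right: "c *\<^sub>C (x + y) = c *\<^sub>C x + c *\<^sub>C y"
    and scaleC_add_left: "(c + d) *\<^sub>C x = c *\<^sub>C x + d *\<^sub>C x"
    and scaleC_scaleC: "c *\<^sub>C d *\<^sub>C x = (c * d) *\<^sub>C x"
    and scaleC_of_real: "complex_of_real r *\<^sub>C x = r *\<^sub>R x"

global_interpretation complex_vector: vector_space "scaleC :: complex \<Rightarrow> 'a \<Rightarrow> 'a :: complex_vector"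
  defines cspan = complex_vector.span
    and csubspace = complex_vector.subspace
proof unfold_locales
  fix x :: 'a
  show "1 *\<^sub>C x = x"
    using scaleC_of_real[of 1 x] by simp
qed (simp_all add: scaleC_add_right scaleC_add_left scaleC_scaleC)

text \<open>The inner product is linear in the first argument. Since its real part is the real inner
  product of the underlying space, it is positive definite and induces the norm.\<close>

class complex_inner = complex_vector + real_inner +
  fixes cinner :: "'a \<Rightarrow> 'a \<Rightarrow> complex"
  assumes cinner_commute: "cinner x y = cnj (cinner y x)"
    and cinner_add_left: "cinner (x + y) z = cinner x z + cinner y z"
    and cinner_scaleC_left: "cinner (c *\<^sub>C x) y = c * cinner x y"
    and Re_cinner: "Re (cinner x y) = inner x y"

class chilbert_space = complex_inner + banach

instantiation complex :: chilbert_space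
begin

definition scaleC_complex :: "complex \<Rightarrow> complex \<Rightarrow> complex"
  where "scaleC_complex c x = c * x"

definition cinner_complex :: "complex \<Rightarrow> complex \<Rightarrow> complex"
  where "cinner_complex x y = x * cnj y"

instance
  by standard
    (simp_all add: scaleC_complex_def cinner_complex_def inner_complex_def algebra_simps scaleR_conv_of_real)

end

definition is_onb :: "'a::complex_inner set \<Rightarrow> bool"
  where "is_onb B \<longleftrightarrow>
    (\<forall>x\<in>B. norm x = 1) \<and> (\<forall>x\<in>B. \<forall>y\<in>B. x \<noteq> y \<longrightarrow> cinner x y = 0) \<and> closure (cspan B) = UNIV"

text \<open>A countable orthogonal basis. In an infinite dimensional space all the \<open>e i\<close> are nonzero;
  an orthogonal basis of a space of finite dimension \<open>d\<close> is \<open>e 0, \<dots>, e (d - 1)\<close>, padded with zeros.\<close>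

definition countable_orthogonal_basis :: "(nat \<Rightarrow> 'a::complex_inner) \<Rightarrow> bool"
  where "countable_orthogonal_basis e \<longleftrightarrow>
    (\<forall>i j. i \<noteq> j \<longrightarrow> cinner (e i) (e j) = 0) \<and>
    (\<forall>i j. i \<le> j \<and> e j \<noteq> 0 \<longrightarrow> e i \<noteq> 0) \<and>
    closure (cspan (range e)) = UNIV"

definition finite_dim_csubspace :: "'a::complex_vector set \<Rightarrow> bool"
  where "finite_dim_csubspace X \<longleftrightarrow> (\<exists>B. finite B \<and> X = cspan B)"

text \<open>\<open>orth_proj Y\<close> is the orthogonal projection onto a closed subspace \<open>Y\<close>.\<close>

definition orth_proj :: "'a::complex_inner set \<Rightarrow> 'a \<Rightarrow> 'a"
  where "orth_proj Y x = (THE p. p \<in> Y \<and> (\<forall>y\<in>Y. cinner (x - p) y = 0))"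


section \<open>Operators\<close>

definition bounded_clinear :: "('a::complex_inner \<Rightarrow> 'b::complex_inner) \<Rightarrow> bool"
  where "bounded_clinear A \<longleftrightarrow> bounded_linear A \<and> (\<forall>c x. A (c *\<^sub>C x) = c *\<^sub>C A x)"

definition selfadjoint :: "('a::complex_inner \<Rightarrow> 'a) \<Rightarrow> bool"
  where "selfadjoint A \<longleftrightarrow> (\<forall>x y. cinner (A x) y = cinner x (A y))"

definition psd :: "('a::complex_inner \<Rightarrow> 'a) \<Rightarrow> bool"
  where "psd A \<longleftrightarrow> bounded_clinear A \<and> selfadjoint A \<and> (\<forall>x. 0 \<le> Re (cinner (A x) x))"

definition loewner_le :: "('a::complex_inner \<Rightarrow> 'a) \<Rightarrow> ('a \<Rightarrow> 'a) \<Rightarrow> bool" (infix \<open>\<preceq>\<^sub>L\<close> 50)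
  where "A \<preceq>\<^sub>L B \<longleftrightarrow> psd (\<lambda>x. B x - A x)"

definition cadjoint :: "('a::complex_inner \<Rightarrow> 'a) \<Rightarrow> 'a \<Rightarrow> 'a"
  where "cadjoint A = (THE A'. \<forall>x y. cinner (A x) y = cinner x (A' y))"

text \<open>\<open>abs_op A\<close> is the positive square root of \<open>A\<^sup>* A\<close>.\<close>

definition abs_op :: "('a::complex_inner \<Rightarrow> 'a) \<Rightarrow> 'a \<Rightarrow> 'a"
  where "abs_op A = (THE R. psd R \<and> R \<circ> R = cadjoint A \<circ> A)"

definition trace_class :: "('a::complex_inner \<Rightarrow> 'a) \<Rightarrow> bool"
  where "trace_class A \<longleftrightarrow>
    bounded_clinear A \<and> (\<exists>B. is_onb B \<and> (\<lambda>e. cinner (abs_op A e) e) summable_on B)"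

text \<open>For a trace class operator the sum below is the same for every orthonormal basis.\<close>

definition ctrace :: "('a::complex_inner \<Rightarrow> 'a) \<Rightarrow> complex"
  where "ctrace A = (\<Sum>\<^sub>\<infinity>e\<in>(SOME B. is_onb B). cinner (A e) e)"

definition trace_norm :: "('a::complex_inner \<Rightarrow> 'a) \<Rightarrow> real"
  where "trace_norm A = Re (ctrace (abs_op A))"

definition op_support :: "('a::complex_inner \<Rightarrow> 'a) \<Rightarrow> 'a set"
  where "op_support A = closure (range A)"

text \<open>\<open>rank1 x y\<close> is the operator \<open>x y\<^sup>\<or>\<close>.\<close>

definition rank1 :: "'a::complex_inner \<Rightarrow> 'a \<Rightarrow> 'a \<Rightarrow> 'a"
  where "rank1 x y z = cinner z y *\<^sub>C x"

text \<open>\<open>F\<close> restricts to a bounded linear map between the Banach spaces of trace class operators;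
  its values outside the trace class are irrelevant.\<close>

definition trace_class_bounded_clinear ::
    "(('a::complex_inner \<Rightarrow> 'a) \<Rightarrow> ('b::complex_inner \<Rightarrow> 'b)) \<Rightarrow> bool"
  where "trace_class_bounded_clinear F \<longleftrightarrow>
    (\<forall>A. trace_class A \<longrightarrow> trace_class (F A)) \<and>
    (\<forall>A B. trace_class A \<and> trace_class B \<longrightarrow> F (\<lambda>x. A x + B x) = (\<lambda>y. F A y + F B y)) \<and>
    (\<forall>c A. trace_class A \<longrightarrow> F (\<lambda>x. c *\<^sub>C A x) = (\<lambda>y. c *\<^sub>C F A y)) \<and>
    (\<exists>K. \<forall>A. trace_class A \<longrightarrow> trace_norm (F A) \<le> K * trace_norm A)"


section \<open>Hilbert space tensor products\<close>

text \<open>\<open>'c\<close> together with \<open>T\<close>, where \<open>T x y\<close> is \<open>x \<otimes> y\<close>, is the Hilbert space tensor product of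
  \<open>'a\<close> and \<open>'b\<close>. These properties determine it up to a unique isomorphism of Hilbert spaces
  compatible with the elementary tensors.\<close>

definition hilbert_tensor ::
    "('a::chilbert_space \<Rightarrow> 'b::chilbert_space \<Rightarrow> 'c::chilbert_space) \<Rightarrow> bool"
  where "hilbert_tensor T \<longleftrightarrow>
    (\<forall>x x' y. T (x + x') y = T x y + T x' y) \<and>
    (\<forall>x y y'. T x (y + y') = T x y + T x y') \<and>
    (\<forall>c x y. T (c *\<^sub>C x) y = c *\<^sub>C T x y \<and> T x (c *\<^sub>C y) = c *\<^sub>C T x y) \<and>
    (\<forall>x y u v. cinner (T x y) (T u v) = cinner x u * cinner y v) \<and>
    closure (cspan {T x y |x y. True}) = UNIV"

definition tensor_op ::
    "('a::chilbert_space \<Rightarrow> 'b::chilbert_space \<Rightarrow> 'c::chilbert_space) \<Rightarrow>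
      ('a \<Rightarrow> 'a) \<Rightarrow> ('b \<Rightarrow> 'b) \<Rightarrow> 'c \<Rightarrow> 'c"
  where "tensor_op T A B = (THE C. bounded_clinear C \<and> (\<forall>x y. C (T x y) = T (A x) (B y)))"

text \<open>On trace class operators the two partial traces are uniquely determined by the defining
  conditions; \<open>ptrace1\<close> traces out the first factor and \<open>ptrace2\<close> the second one.\<close>

definition ptrace1 ::
    "('a::chilbert_space \<Rightarrow> 'b::chilbert_space \<Rightarrow> 'c::chilbert_space) \<Rightarrow> ('c \<Rightarrow> 'c) \<Rightarrow> 'b \<Rightarrow> 'b"
  where "ptrace1 T = (SOME F. trace_class_bounded_clinear F \<and>
    (\<forall>x y u v. F (rank1 (T x y) (T u v)) = (\<lambda>z. cinner x u *\<^sub>C rank1 y v z)))"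

definition ptrace2 ::
    "('a::chilbert_space \<Rightarrow> 'b::chilbert_space \<Rightarrow> 'c::chilbert_space) \<Rightarrow> ('c \<Rightarrow> 'c) \<Rightarrow> 'a \<Rightarrow> 'a"
  where "ptrace2 T = (SOME F. trace_class_bounded_clinear F \<and>
    (\<forall>x y u v. F (rank1 (T x y) (T u v)) = (\<lambda>z. cinner y v *\<^sub>C rank1 x u z)))"


section \<open>The semidefinite programming problem\<close>

text \<open>The basis vectors are numbered from 0, so the first \<open>n\<close> of them are \<open>e 0, \<dots>, e (n - 1)\<close>.\<close>

definition trunc_proj :: "(nat \<Rightarrow> 'a::complex_inner) \<Rightarrow> nat \<Rightarrow> 'a \<Rightarrow> 'a"
  where "trunc_proj e n = orth_proj (cspan (e ` {..<n}))"

definition trunc_tensor ::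
    "('a::chilbert_space \<Rightarrow> 'b::chilbert_space \<Rightarrow> 'c::chilbert_space) \<Rightarrow>
      (nat \<Rightarrow> 'a) \<Rightarrow> (nat \<Rightarrow> 'b) \<Rightarrow> nat \<Rightarrow> 'c \<Rightarrow> 'c"
  where "trunc_tensor T e1 e2 n = tensor_op T (trunc_proj e1 n) (trunc_proj e2 n)"

definition trunc_op :: "(nat \<Rightarrow> 'a::complex_inner) \<Rightarrow> nat \<Rightarrow> ('a \<Rightarrow> 'a) \<Rightarrow> 'a \<Rightarrow> 'a"
  where "trunc_op e n A = trunc_proj e n \<circ> A \<circ> trunc_proj e n"

definition sdp_feasible ::
    "('a::chilbert_space \<Rightarrow> 'b::chilbert_space \<Rightarrow> 'c::chilbert_space) \<Rightarrow>
      (nat \<Rightarrow> 'a) \<Rightarrow> (nat \<Rightarrow> 'b) \<Rightarrow> ('a \<Rightarrow> 'a) \<Rightarrow> ('b \<Rightarrow> 'b) \<Rightarrow> nat \<Rightarrow> ('c \<Rightarrow> 'c) set"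
  where "sdp_feasible T e1 e2 \<rho>1 \<rho>2 n =
    {X. ptrace2 T X \<preceq>\<^sub>L trunc_op e1 n \<rho>1 \<and> ptrace1 T X \<preceq>\<^sub>L trunc_op e2 n \<rho>2 \<and>
        (\<exists>Y. psd Y \<and> X = trunc_tensor T e1 e2 n \<circ> Y \<circ> trunc_tensor T e1 e2 n)}"

text \<open>For feasible \<open>X\<close> the trace in the objective is real.\<close>

definition sdp_max ::
    "('a::chilbert_space \<Rightarrow> 'b::chilbert_space \<Rightarrow> 'c::chilbert_space) \<Rightarrow>
      (nat \<Rightarrow> 'a) \<Rightarrow> (nat \<Rightarrow> 'b) \<Rightarrow> ('a \<Rightarrow> 'a) \<Rightarrow> ('b \<Rightarrow> 'b) \<Rightarrow> 'c set \<Rightarrow> nat \<Rightarrow> real"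
  where "sdp_max T e1 e2 \<rho>1 \<rho>2 \<X> n =
    (GREATEST m. \<exists>X\<in>sdp_feasible T e1 e2 \<rho>1 \<rho>2 n.
        m = Re (ctrace (X \<circ> orth_proj (trunc_tensor T e1 e2 n ` \<X>))))"

end

theory Submission
  imports Defs
begin

text \<open>A coupling \<open>\<rho>\<close> supported on \<open>\<X>\<close> yields the feasible compressions \<open>Q\<^sub>n \<rho> Q\<^sub>n\<close> with
  \<open>Q\<^sub>n = P\<^sub>n\<^sub>,\<^sub>1 \<otimes> P\<^sub>n\<^sub>,\<^sub>2\<close>, whose objective values tend to the trace of \<open>\<rho>\<close>. Conversely, feasible operators
  are positive of trace at most 1, so a subsequence of optimal solutions converges weakly to some \<open>\<rho>\<close>.
  In the weak limit the partial traces can only decrease (Fatou), so the marginals of \<open>\<rho>\<close> are at most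
  \<open>\<rho>\<^sub>1\<close> and \<open>\<rho>\<^sub>2\<close>. As \<open>\<X>\<close> has finite dimension and \<open>Q\<^sub>n\<close> tends to the identity uniformly on its unit ball,
  the objective converges to the mass of \<open>\<rho>\<close> on \<open>\<X>\<close>. This mass is therefore 1, hence \<open>\<rho>\<close> lives on \<open>\<X>\<close>, and
  comparing traces turns the inequalities between marginals into equalities.

  The existence of partial traces rests on the characterization of the trace norm as the supremum
  of \<open>\<Sum>\<^sub>i |\<langle>A f\<^sub>i, g\<^sub>i\<rangle>|\<close> over finite Bessel families \<open>f\<close>, \<open>g\<close>, which makes the required bounds for a partial
  trace immediate.\<close>

text \<open>Traces and partial traces are opaque as defined: \<open>ctrace\<close> sums over a basis
  picked by \<open>SOME\<close>, and \<open>ptrace1\<close> is some bounded map with prescribed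
  values on elementary rank-one operators. Both become computable on finite rank operators, by
  Parseval and by density of elementary tensors, and the argument is arranged so that partial traces
  are evaluated only there: feasible operators are compressed by \<open>Q n\<close>, and a coupling
  lives on \<X>. The weak limit has no such a priori reason to have finite rank, which dictates the
  order of the converse. Its mass is first bounded by 1 through finite sums, which pass to weak
  limits; mass 1 on \<X> then forces finite rank; only after that are its marginals touched. A
  second obstacle is that the dimension of the image of \<X> under \<open>Q n\<close> varies with
  \<open>n\<close>. Orthonormal systems may therefore contain zero vectors, so that the index set
  \<open>{..<d}\<close> stays fixed; the same convention covers factors of finite dimension.
  Finally, swapping the factors turns \<open>ptrace2\<close> into \<open>ptrace1\<close>, so facts
  about marginals are proved for one factor.\<close>

lemma cinner_zero_left [simp]: "cinner 0 y = 0"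
  using cinner_add_left[of 0 0 y] by simp

lemma cinner_zero_right [simp]: "cinner x 0 = 0"
  using cinner_commute[of x 0] by simp

lemma cinner_add_right: "cinner x (y + z) = cinner x y + cinner x z"
  by (metis cinner_add_left cinner_commute complex_cnj_add)

lemma cinner_scaleC_right: "cinner x (c *\<^sub>C y) = cnj c * cinner x y"
  by (metis cinner_scaleC_left cinner_commute complex_cnj_mult)

lemma cinner_minus_left [simp]: "cinner (- x) y = - cinner x y"
  using cinner_add_left[of "- x" x y] by (simp add: eq_neg_iff_add_eq_0)

lemma cinner_minus_right [simp]: "cinner x (- y) = - cinner x y"
  using cinner_add_right[of x "- y" y] by (simp add: eq_neg_iff_add_eq_0)

lemma cinner_diff_left: "cinner (x - y) z = cinner x z - cinner y z"
  using cinner_add_left[of x "- y" z] by simp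

lemma cinner_diff_right: "cinner x (y - z) = cinner x y - cinner x z"
  using cinner_add_right[of x y "- z"] by simp

lemma cinner_scaleR_left: "cinner (r *\<^sub>R x) y = complex_of_real r * cinner x y"
  by (metis scaleC_of_real cinner_scaleC_left)

lemma cinner_scaleR_right: "cinner x (r *\<^sub>R y) = complex_of_real r * cinner x y"
  by (metis scaleC_of_real cinner_scaleC_right complex_cnj_complex_of_real)

lemma cinner_sum_left: "cinner (\<Sum>i\<in>I. f i) y = (\<Sum>i\<in>I. cinner (f i) y)"
  by (induction I rule: infinite_finite_induct) (auto simp: cinner_add_left)

lemma cinner_sum_right: "cinner y (\<Sum>i\<in>I. f i) = (\<Sum>i\<in>I. cinner y (f i))"
  by (induction I rule: infinite_finite_induct) (auto simp: cinner_add_right)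

lemma cinner_self: "cinner x x = complex_of_real ((norm x)\<^sup>2)"
proof (rule complex_eqI)
  show "Re (cinner x x) = Re (complex_of_real ((norm x)\<^sup>2))"
    by (simp add: Re_cinner power2_norm_eq_inner)
  show "Im (cinner x x) = Im (complex_of_real ((norm x)\<^sup>2))"
    using arg_cong[OF cinner_commute[of x x], of Im] by simp
qed

lemma Re_cinner_self: "Re (cinner x x) = (norm x)\<^sup>2"
  by (simp add: cinner_self)

lemma cinner_self_eq_0 [simp]: "cinner x x = 0 \<longleftrightarrow> x = 0"
  by (simp add: cinner_self)

lemma norm_scaleC [simp]: "norm (c *\<^sub>C x) = cmod c * norm (x :: 'a::complex_inner)"
proof -
  have "complex_of_real ((norm (c *\<^sub>C x))\<^sup>2) = c * cnj c * cinner x x"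
    unfolding cinner_self[symmetric] by (simp add: cinner_scaleC_left cinner_scaleC_right)
  also have "\<dots> = complex_of_real ((cmod c * norm x)\<^sup>2)"
    by (simp add: cinner_self complex_norm_square[symmetric] power_mult_distrib)
  finally have "(norm (c *\<^sub>C x))\<^sup>2 = (cmod c * norm x)\<^sup>2"
    using of_real_eq_iff by blast
  then show ?thesis by simp
qed

lemma cmod_cinner_commute: "cmod (cinner x y) = cmod (cinner y x)"
  by (metis cinner_commute complex_mod_cnj)

lemma cinner_mult_commute: "cinner x y * cinner y x = complex_of_real ((cmod (cinner x y))\<^sup>2)"
  by (metis cinner_commute complex_norm_square of_real_power)

lemma ex_phase: "\<exists>c. cmod c = 1 \<and> c * z = complex_of_real (cmod z)"
proof (cases "z = 0")
  case False
  then show ?thesis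
    by (intro exI[of _ "cnj z / cmod z"])
      (simp add: norm_divide complex_norm_square[symmetric] mult.commute power2_eq_square)
qed (auto intro: exI[of _ 1])

text \<open>Multiplying \<open>x\<close> by a phase makes the inner product real and nonnegative,
  which reduces the claim to the real Cauchy-Schwarz inequality.\<close>

lemma Cauchy_Schwarz_cinner: "cmod (cinner x y) \<le> norm x * norm y"
proof -
  obtain c where c: "cmod c = 1" "c * cinner x y = complex_of_real (cmod (cinner x y))"
    using ex_phase by blast
  then have "cmod (cinner x y) = Re (cinner (c *\<^sub>C x) y)"
    by (simp add: cinner_scaleC_left)
  also have "\<dots> \<le> norm (c *\<^sub>C x) * norm y"
    unfolding Re_cinner by (rule norm_cauchy_schwarz)
  finally show ?thesis using c by simp
qed

lemma cinner_eqI: "(\<And>y. cinner x y = cinner z y) \<Longrightarrow> x = z"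
  using cinner_self_eq_0[of "x - z"] by (simp add: cinner_diff_left)

lemma bounded_bilinear_cinner: "bounded_bilinear cinner"
  by standard (auto simp: cinner_add_left cinner_add_right cinner_scaleR_left cinner_scaleR_right
      scaleR_conv_of_real intro!: exI[of _ 1] Cauchy_Schwarz_cinner)

lemmas tendsto_cinner = bounded_bilinear.tendsto[OF bounded_bilinear_cinner]
lemmas bounded_linear_cinner_left = bounded_bilinear.bounded_linear_left[OF bounded_bilinear_cinner]

lemma bounded_linear_scaleC_right: "bounded_linear (\<lambda>x :: 'a::complex_inner. c *\<^sub>C x)"
proof (rule bounded_linear_intro[of _ "cmod c"])
  show "c *\<^sub>C r *\<^sub>R x = r *\<^sub>R c *\<^sub>C x" for r and x :: 'a
    by (metis mult.commute scaleC_of_real scaleC_scaleC)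
qed (auto simp: scaleC_add_right)


section \<open>Bounded operators\<close>

lemma bounded_clinearI:
  assumes "\<And>x y. A (x + y) = A x + A y" and "\<And>c x. A (c *\<^sub>C x) = c *\<^sub>C A x"
    and "\<And>x. norm (A x) \<le> K * norm x"
  shows "bounded_clinear A"
  unfolding bounded_clinear_def
proof (intro conjI allI)
  show "bounded_linear A"
  proof (rule bounded_linear_intro[of _ K])
    show "A (r *\<^sub>R x) = r *\<^sub>R A x" for r x
      by (metis assms(2) scaleC_of_real)
  qed (use assms in \<open>auto simp: mult.commute\<close>)
qed (rule assms)

lemma
  assumes "bounded_clinear A"
  shows bounded_clinear_bounded_linear: "bounded_linear A"
    and bounded_clinear_add: "A (x + y) = A x + A y"
    and bounded_clinear_diff: "A (x - y) = A x - A y"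
    and bounded_clinear_zero: "A 0 = 0"
    and bounded_clinear_scaleC: "A (c *\<^sub>C x) = c *\<^sub>C A x"
    and bounded_clinear_scaleR: "A (r *\<^sub>R x) = r *\<^sub>R A x"
    and bounded_clinear_sum: "A (\<Sum>i\<in>I. f i) = (\<Sum>i\<in>I. A (f i))"
  using assms by (auto simp: bounded_clinear_def linear_simps linear_sum bounded_linear.linear)

lemma bounded_clinear_boundE:
  assumes "bounded_clinear A"
  obtains K where "K > 0" "\<And>x. norm (A x) \<le> K * norm x"
  using bounded_linear.pos_bounded[OF bounded_clinear_bounded_linear[OF assms]]
  by (metis mult.commute)

lemma bounded_clinear_tendsto:
  "bounded_clinear A \<Longrightarrow> (f \<longlongrightarrow> x) F \<Longrightarrow> ((\<lambda>i. A (f i)) \<longlongrightarrow> A x) F"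
  by (rule bounded_linear.tendsto[OF bounded_clinear_bounded_linear])

lemma bounded_clinear_id: "bounded_clinear (\<lambda>x. x)"
  by (rule bounded_clinearI[of _ 1]) auto

lemma bounded_clinear_compose:
  assumes A: "bounded_clinear A" and B: "bounded_clinear B"
  shows "bounded_clinear (\<lambda>x. A (B x))"
  using bounded_linear_compose[of A B] assms by (auto simp: bounded_clinear_def)

lemma bounded_clinear_add_fun:
  assumes "bounded_clinear A" "bounded_clinear B"
  shows "bounded_clinear (\<lambda>x. A x + B x)"
  using assms by (auto simp: bounded_clinear_def bounded_linear_add scaleC_add_right)

lemma bounded_clinear_diff_fun:
  assumes "bounded_clinear A" "bounded_clinear B"
  shows "bounded_clinear (\<lambda>x. A x - B x)"
  using assms
  by (auto simp: bounded_clinear_def bounded_linear_sub complex_vector.scale_right_diff_distrib)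

lemma bounded_clinear_scaleC_fun:
  assumes "bounded_clinear A"
  shows "bounded_clinear (\<lambda>x. c *\<^sub>C A x)"
  using assms bounded_linear_compose[OF bounded_linear_scaleC_right]
  by (auto simp: bounded_clinear_def scaleC_scaleC mult.commute)

lemma bounded_clinear_0: "bounded_clinear (\<lambda>x. 0)"
  by (rule bounded_clinearI[of _ 0]) auto

lemma bounded_clinear_sum_fun:
  "(\<And>i. i \<in> I \<Longrightarrow> bounded_clinear (A i)) \<Longrightarrow> bounded_clinear (\<lambda>x. \<Sum>i\<in>I. A i x)"
  by (induction I rule: infinite_finite_induct) (auto intro: bounded_clinear_add_fun bounded_clinear_0)

lemma bounded_clinear_rank1: "bounded_clinear (rank1 x y)"
proof (rule bounded_clinearI[of _ "norm x * norm y"])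
  show "norm (rank1 x y z) \<le> norm x * norm y * norm z" for z
    using mult_left_mono[OF Cauchy_Schwarz_cinner[of z y], of "norm x"]
    by (simp add: rank1_def mult_ac)
qed (auto simp: rank1_def cinner_add_left scaleC_add_left cinner_scaleC_left scaleC_scaleC)

lemma csubspace_closure:
  assumes "csubspace (M :: 'a::complex_inner set)"
  shows "csubspace (closure M)"
proof (rule complex_vector.subspaceI)
  show "0 \<in> closure M"
    using closure_subset complex_vector.subspace_0[OF assms] by blast
next
  fix x y assume "x \<in> closure M" "y \<in> closure M"
  then obtain f g where "\<And>n. f n \<in> M" "f \<longlonglongrightarrow> x" "\<And>n. g n \<in> M" "g \<longlonglongrightarrow> y"
    by (auto simp: closure_sequential)
  then show "x + y \<in> closure M"
    unfolding closure_sequential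
    by (intro exI[of _ "\<lambda>n. f n + g n"])
      (auto intro: tendsto_add complex_vector.subspace_add[OF assms])
next
  fix c x assume "x \<in> closure M"
  then obtain f where "\<And>n. f n \<in> M" "f \<longlonglongrightarrow> x"
    by (auto simp: closure_sequential)
  then show "c *\<^sub>C x \<in> closure M"
    unfolding closure_sequential
    by (intro exI[of _ "\<lambda>n. c *\<^sub>C f n"])
      (auto intro: bounded_linear.tendsto[OF bounded_linear_scaleC_right]
        complex_vector.subspace_scale[OF assms])
qed

lemma bounded_clinear_eq_on_dense:
  assumes A: "bounded_clinear A" and B: "bounded_clinear B"
    and S: "closure (cspan S) = UNIV" and eq: "\<And>x. x \<in> S \<Longrightarrow> A x = B x"
  shows "A = B"
proof
  fix x
  let ?D = "{x. A x = B x}"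
  have "csubspace ?D"
    by (rule complex_vector.subspaceI)
      (auto simp: A B bounded_clinear_add bounded_clinear_scaleC bounded_clinear_zero)
  moreover have "closed ?D"
    by (intro closed_Collect_eq linear_continuous_on bounded_clinear_bounded_linear A B)
  ultimately have "closure (cspan S) \<subseteq> ?D"
    by (intro closure_minimal complex_vector.span_minimal) (auto simp: eq)
  then show "A x = B x" using S by auto
qed

lemma orthogonal_dense_eq_0:
  assumes S: "closure (cspan S) = UNIV" and orth: "\<And>y. y \<in> S \<Longrightarrow> cinner x y = 0"
  shows "x = 0"
proof -
  have "cinner y x = 0" if "y \<in> S" for y
    using orth[OF that] cinner_commute[of y x] by simp
  then have "(\<lambda>y. cinner y x) = (\<lambda>y. 0)"
    using bounded_clinearI[of "\<lambda>y. cinner y x" "norm x"]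
    by (intro bounded_clinear_eq_on_dense[OF _ bounded_clinear_0 S])
      (auto simp: cinner_add_left cinner_scaleC_left scaleC_complex_def
        Cauchy_Schwarz_cinner mult.commute[of "norm x"])
  then show ?thesis using cinner_self_eq_0 by metis
qed


section \<open>Projections, the Riesz representation, adjoints\<close>

text \<open>A minimizing sequence for the distance to \<open>x\<close> is Cauchy by the
  parallelogram law, and a minimizer leaves an orthogonal remainder, because any component along
  \<open>M\<close> could still be removed.\<close>

lemma projection_exists:
  fixes M :: "'a::chilbert_space set"
  assumes M: "csubspace M" and cl: "closed M"
  obtains p where "p \<in> M" "\<And>y. y \<in> M \<Longrightarrow> cinner (x - p) y = 0"
proof -
  define d where "d = (INF y\<in>M. (norm (x - y))\<^sup>2)"
  have M0: "0 \<in> M" using complex_vector.subspace_0[OF M] .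
  have d_le: "d \<le> (norm (x - y))\<^sup>2" if "y \<in> M" for y
    unfolding d_def by (rule cINF_lower[OF _ that]) (auto intro!: bdd_belowI[of _ 0])
  have "\<exists>y\<in>M. (norm (x - y))\<^sup>2 < d + 1 / Suc n" for n
  proof -
    have "d < d + 1 / Suc n" by simp
    then show ?thesis unfolding d_def
      by (subst (asm) (1) cINF_less_iff) (use M0 in \<open>auto intro!: bdd_belowI[of _ 0]\<close>)
  qed
  then obtain f where f: "\<And>n. f n \<in> M" "\<And>n. (norm (x - f n))\<^sup>2 < d + 1 / Suc n"
    by metis
  \<comment> \<open>The midpoint of \<open>f m\<close> and \<open>f n\<close> stays in
    \<open>M\<close>, at squared distance at least \<open>d\<close> from \<open>x\<close>; the
    parallelogram law then leaves only the excess of the two squared distances over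
    \<open>d\<close>, doubled.\<close>
  have close: "(norm (f m - f n))\<^sup>2 < 2 / Suc m + 2 / Suc n" for m n
  proof -
    let ?h = "(1/2) *\<^sub>R (f m + f n)"
    have "?h \<in> M"
      by (metis complex_vector.subspace_add complex_vector.subspace_scale M f(1) scaleC_of_real)
    then have "4 * d \<le> (norm (2 *\<^sub>R (x - ?h)))\<^sup>2"
      using d_le[of ?h] by (simp add: power_mult_distrib)
    also have "2 *\<^sub>R (x - ?h) = (x - f m) + (x - f n)"
      by (simp add: algebra_simps scaleR_2)
    also have "(norm ((x - f m) + (x - f n)))\<^sup>2 =
        2 * (norm (x - f m))\<^sup>2 + 2 * (norm (x - f n))\<^sup>2 - (norm (f m - f n))\<^sup>2"
      by (simp add: power2_norm_eq_inner inner_diff_left inner_diff_right inner_add_left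
          inner_add_right inner_commute)
    finally show ?thesis
      using f(2)[of m] f(2)[of n] unfolding divide_inverse by linarith
  qed
  have "Cauchy f"
  proof (rule metric_CauchyI)
    fix e :: real assume "e > 0"
    then obtain N where N: "4 / Suc N < e\<^sup>2"
      using reals_Archimedean[of "e\<^sup>2 / 4"] by (auto simp: field_simps)
    have "dist (f m) (f n) < e" if "m \<ge> N" "n \<ge> N" for m n
    proof -
      have "2 / Suc m \<le> 2 / Suc N" "2 / Suc n \<le> 2 / Suc N"
        using that by (auto intro!: divide_left_mono)
      then have "(norm (f m - f n))\<^sup>2 < e\<^sup>2" using close[of m n] N by simp
      then show ?thesis
        using \<open>e > 0\<close> by (simp add: dist_norm power_less_imp_less_base)
    qed
    then show "\<exists>N. \<forall>m\<ge>N. \<forall>n\<ge>N. dist (f m) (f n) < e" by blast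
  qed
  then obtain p where p: "f \<longlonglongrightarrow> p" using Cauchy_convergent convergent_def by blast
  have pM: "p \<in> M" using closed_sequentially[OF cl _ p] f(1) by blast
  have "(\<lambda>n. (norm (x - f n))\<^sup>2) \<longlonglongrightarrow> (norm (x - p))\<^sup>2"
    by (intro tendsto_intros p)
  moreover have "(\<lambda>n. d + 1 / Suc n) \<longlonglongrightarrow> d + 0"
    by (intro tendsto_intros LIMSEQ_Suc[OF lim_1_over_n])
  ultimately have pd: "(norm (x - p))\<^sup>2 \<le> d"
    using LIMSEQ_le f(2) by (metis (mono_tags, lifting) add_0_right less_imp_le)
  have "cinner (x - p) y = 0" if y: "y \<in> M" for y
  proof (rule ccontr)
    let ?z = "x - p" and ?c = "cinner (x - p) y"
    assume nz: "?c \<noteq> 0"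
    then have y0: "norm y > 0" by auto
    \<comment> \<open>The coefficient of the projection of \<open>?z\<close> onto \<open>y\<close>:
      subtracting that component shortens \<open>?z\<close> strictly, against the minimality of
      \<open>d\<close>.\<close>
    let ?t = "?c / (norm y)\<^sup>2"
    have "p + ?t *\<^sub>C y \<in> M"
      by (intro complex_vector.subspace_add[OF M] complex_vector.subspace_scale[OF M] pM y)
    then have "(norm ?z)\<^sup>2 \<le> (norm (?z - ?t *\<^sub>C y))\<^sup>2"
      using d_le pd by (metis diff_diff_add order_trans)
    also have "complex_of_real ((norm (?z - ?t *\<^sub>C y))\<^sup>2) =
        complex_of_real ((norm ?z)\<^sup>2 - (cmod ?c)\<^sup>2 / (norm y)\<^sup>2)"
    proof -
      have "complex_of_real ((norm (?z - ?t *\<^sub>C y))\<^sup>2) = cinner ?z ?z - cnj ?t * ?c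
          - ?t * cnj ?c + ?t * cnj ?t * cinner y y"
        unfolding cinner_self[symmetric] using cinner_commute[of y ?z]
        by (simp add: cinner_diff_left[of ?z] cinner_diff_right[of _ ?z] cinner_scaleC_left
            cinner_scaleC_right)
      also have "\<dots> = cinner ?z ?z - ?c * cnj ?c / (norm y)\<^sup>2"
        using y0 by (simp add: cinner_self field_simps power2_eq_square)
      finally show ?thesis
        by (simp add: cinner_self complex_norm_square[symmetric] flip: of_real_power)
    qed
    then have "(norm (?z - ?t *\<^sub>C y))\<^sup>2 = (norm ?z)\<^sup>2 - (cmod ?c)\<^sup>2 / (norm y)\<^sup>2"
      using of_real_eq_iff by blast
    finally show False using nz y0 by (simp add: divide_le_0_iff)
  qed
  then show thesis using that pM by blast
qed

lemma dense_if_orthogonal_trivial: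
  fixes S :: "'a::chilbert_space set"
  assumes "\<And>x. (\<And>y. y \<in> S \<Longrightarrow> cinner x y = 0) \<Longrightarrow> x = 0"
  shows "closure (cspan S) = UNIV"
proof -
  have "x \<in> closure (cspan S)" for x
  proof -
    obtain p where p: "p \<in> closure (cspan S)"
      "\<And>y. y \<in> closure (cspan S) \<Longrightarrow> cinner (x - p) y = 0"
      by (metis projection_exists csubspace_closure complex_vector.subspace_span closed_closure)
    have "x - p = 0"
    proof (rule assms)
      fix y assume "y \<in> S"
      then have "y \<in> closure (cspan S)"
        using closure_subset complex_vector.span_base by blast
      then show "cinner (x - p) y = 0" by (rule p)
    qed
    then show ?thesis using p by simp
  qed
  then show ?thesis by blast
qed

text \<open>The part \<open>u\<close> of \<open>z\<close> orthogonal to the kernel spans the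
  orthogonal complement of the kernel, so the representing vector is the multiple of
  \<open>u\<close> with the right value at \<open>u\<close>.\<close>

lemma riesz_representation:
  fixes \<phi> :: "'a::chilbert_space \<Rightarrow> complex"
  assumes \<phi>: "bounded_clinear \<phi>"
  obtains w where "\<And>x. \<phi> x = cinner x w"
proof (cases "\<forall>x. \<phi> x = 0")
  case True
  then show thesis using that[of 0] by simp
next
  case False
  then obtain z where z: "\<phi> z \<noteq> 0" by blast
  let ?K = "{x. \<phi> x = 0}"
  have "csubspace ?K"
    by (rule complex_vector.subspaceI)
      (auto simp: \<phi> bounded_clinear_add bounded_clinear_scaleC bounded_clinear_zero scaleC_complex_def)
  moreover have "closed ?K"
    by (intro closed_Collect_eq linear_continuous_on bounded_clinear_bounded_linear \<phi> continuous_intros)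
  ultimately obtain p where p: "\<phi> p = 0" "\<And>y. \<phi> y = 0 \<Longrightarrow> cinner (z - p) y = 0"
    using projection_exists[of ?K z] by auto
  define u where "u = z - p"
  have fu: "\<phi> u \<noteq> 0" using z p by (simp add: u_def bounded_clinear_diff[OF \<phi>])
  then have u0: "u \<noteq> 0" using bounded_clinear_zero[OF \<phi>] by auto
  have "\<phi> x = cinner x (cnj (\<phi> u / cinner u u) *\<^sub>C u)" for x
  proof -
    have "\<phi> (x - (\<phi> x / \<phi> u) *\<^sub>C u) = 0"
      using fu by (simp add: \<phi> bounded_clinear_diff bounded_clinear_scaleC scaleC_complex_def)
    then have "cinner u (x - (\<phi> x / \<phi> u) *\<^sub>C u) = 0" using p u_def by blast
    then have "cinner (x - (\<phi> x / \<phi> u) *\<^sub>C u) u = 0" by (metis cinner_commute complex_cnj_zero)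
    then have "cinner x u = \<phi> x / \<phi> u * cinner u u"
      by (simp add: cinner_diff_left cinner_scaleC_left)
    then show ?thesis using fu u0 by (simp add: cinner_scaleC_right)
  qed
  then show thesis by (rule that)
qed

text \<open>Common source of the adjoint, the partial trace and the weak limit: each is first
  obtained as a bounded form, and the Riesz representation turns the form into an operator.\<close>

lemma sesquilinear_operator:
  fixes G :: "'a::complex_inner \<Rightarrow> 'b::chilbert_space \<Rightarrow> complex"
  assumes "\<And>x x' y. G (x + x') y = G x y + G x' y" and "\<And>c x y. G (c *\<^sub>C x) y = c * G x y"
    and "\<And>x y y'. G x (y + y') = G x y + G x y'" and "\<And>c x y. G x (c *\<^sub>C y) = cnj c * G x y"
    and K: "\<And>x y. cmod (G x y) \<le> K * norm x * norm y"
  obtains A where "bounded_clinear A" "\<And>x y. cinner (A x) y = G x y"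
proof -
  have "\<exists>w. \<forall>y. cinner w y = G x y" for x
  proof -
    have "bounded_clinear (\<lambda>y. cnj (G x y))"
      by (rule bounded_clinearI[of _ "K * norm x"]) (auto simp: assms scaleC_complex_def)
    then obtain w where "\<And>y. cnj (G x y) = cinner y w"
      using riesz_representation by blast
    then have "cinner w y = G x y" for y
      by (metis cinner_commute complex_cnj_cnj)
    then show ?thesis by blast
  qed
  then obtain A where A: "\<And>x y. cinner (A x) y = G x y" by metis
  have "bounded_clinear A"
  proof (rule bounded_clinearI[of _ "\<bar>K\<bar>"])
    show "A (x + y) = A x + A y" for x y
      by (rule cinner_eqI) (simp add: A cinner_add_left assms)
    show "A (c *\<^sub>C x) = c *\<^sub>C A x" for c x
      by (rule cinner_eqI) (simp add: A cinner_scaleC_left assms)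
    show "norm (A x) \<le> \<bar>K\<bar> * norm x" for x
    proof (cases "A x = 0")
      case False
      have "(norm (A x))\<^sup>2 = cmod (cinner (A x) (A x))" by (simp add: cinner_self norm_power)
      also have "\<dots> \<le> K * norm x * norm (A x)" unfolding A by (rule K)
      also have "\<dots> \<le> \<bar>K\<bar> * norm x * norm (A x)" by (intro mult_right_mono) auto
      finally show ?thesis using False by (simp add: power2_eq_square)
    qed simp
  qed
  then show thesis using that A by blast
qed

lemma adjoint_exists:
  fixes A :: "'a::chilbert_space \<Rightarrow> 'b::complex_inner"
  assumes A: "bounded_clinear A"
  obtains A' where "bounded_clinear A'" "\<And>x y. cinner (A x) y = cinner x (A' y)"
proof -
  obtain K where K: "K > 0" "\<And>x. norm (A x) \<le> K * norm x"
    using bounded_clinear_boundE[OF A] by blast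
  have "cmod (cinner x (A y)) \<le> K * norm x * norm y" for x y
    using order_trans[OF Cauchy_Schwarz_cinner[of x "A y"] mult_left_mono[OF K(2)[of y], of "norm x"]]
    by (simp add: mult_ac)
  then obtain A' where A': "bounded_clinear A'" "\<And>x y. cinner (A' x) y = cinner x (A y)"
    using sesquilinear_operator[of "\<lambda>x y. cinner x (A y)" K]
    by (auto simp: cinner_add_left cinner_add_right cinner_scaleC_left cinner_scaleC_right
        bounded_clinear_add[OF A] bounded_clinear_scaleC[OF A])
  have "cinner (A x) y = cinner x (A' y)" for x y
    using A'(2)[of y x] cinner_commute[of "A x" y] cinner_commute[of x "A' y"] by simp
  then show thesis using that A'(1) by blast
qed

lemma cadjoint_eqI:
  assumes "\<And>x y. cinner (A x) y = cinner x (A' y)"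
  shows "cadjoint A = A'"
  unfolding cadjoint_def
proof (rule the_equality)
  fix B assume B: "\<forall>x y. cinner (A x) y = cinner x (B y)"
  have "cinner (B y) x = cinner (A' y) x" for x y
    using assms[of x y] B cinner_commute[of "B y" x] cinner_commute[of "A' y" x] by simp
  then show "B = A'" by (intro ext, rule cinner_eqI)
qed (simp add: assms)

text \<open>Makes the \<open>SOME\<close> in \<open>ctrace\<close> meaningful. A maximal orthonormal
  set is complete, since a nonzero vector orthogonal to it could be normalized and added.\<close>

lemma onb_exists: "\<exists>B :: 'a::chilbert_space set. is_onb B"
proof -
  define \<A> where "\<A> = {B :: 'a set. (\<forall>x\<in>B. norm x = 1) \<and> (\<forall>x\<in>B. \<forall>y\<in>B. x \<noteq> y \<longrightarrow> cinner x y = 0)}"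
  have "\<exists>M\<in>\<A>. \<forall>X\<in>\<A>. M \<subseteq> X \<longrightarrow> X = M"
  proof (rule subset_Zorn')
    fix C assume "subset.chain \<A> C"
    then have C: "C \<subseteq> \<A>" "\<And>X Y. X \<in> C \<Longrightarrow> Y \<in> C \<Longrightarrow> X \<subseteq> Y \<or> Y \<subseteq> X"
      by (auto simp: subset.chain_def)
    show "\<Union> C \<in> \<A>"
      unfolding \<A>_def
    proof (intro CollectI conjI ballI impI)
      show "norm x = 1" if "x \<in> \<Union> C" for x using that C(1) by (auto simp: \<A>_def)
      fix x y assume "x \<in> \<Union> C" "y \<in> \<Union> C" "x \<noteq> y"
      then obtain X Y where "X \<in> C" "Y \<in> C" "x \<in> X" "y \<in> Y" by blast
      then obtain Z where "Z \<in> C" "x \<in> Z" "y \<in> Z" using C(2)[of X Y] by blast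
      then show "cinner x y = 0" using C(1) \<open>x \<noteq> y\<close> by (auto simp: \<A>_def)
    qed
  qed
  then obtain B where B: "B \<in> \<A>" "\<And>X. X \<in> \<A> \<Longrightarrow> B \<subseteq> X \<Longrightarrow> X = B" by blast
  have "closure (cspan B) = UNIV"
  proof (rule dense_if_orthogonal_trivial, rule ccontr)
    fix x assume x: "\<And>y. y \<in> B \<Longrightarrow> cinner x y = 0" "x \<noteq> 0"
    let ?u = "(1 / norm x) *\<^sub>R x"
    have u: "cinner ?u y = 0" "cinner y ?u = 0" if "y \<in> B" for y
      using x(1)[OF that] cinner_commute[of y x]
      by (simp_all only: cinner_scaleR_left cinner_scaleR_right) auto
    have "insert ?u B \<in> \<A>"
      using B(1) x(2) u by (auto simp: \<A>_def)
    then have "?u \<in> B" using B(2) by blast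
    then have "cinner ?u ?u = 0" by (rule u)
    then show False using x(2) by simp
  qed
  then show ?thesis using B(1) by (auto simp: is_onb_def \<A>_def)
qed

lemma is_onb_some: "is_onb (SOME B :: 'a::chilbert_space set. is_onb B)"
  by (rule someI_ex[OF onb_exists])


section \<open>Positive operators and square roots\<close>

lemma psdD:
  assumes "psd A"
  shows "bounded_clinear A" "cinner (A x) y = cinner x (A y)" "0 \<le> Re (cinner (A x) x)"
  using assms by (auto simp: psd_def selfadjoint_def)

lemma psdI:
  assumes "bounded_clinear A" "\<And>x y. cinner (A x) y = cinner x (A y)" "\<And>x. 0 \<le> Re (cinner (A x) x)"
  shows "psd A"
  using assms by (auto simp: psd_def selfadjoint_def)

lemma selfadjoint_cinner_real:
  assumes "\<And>x y. cinner (A x) y = cinner x (A y)"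
  shows "cinner (A x) x = complex_of_real (Re (cinner (A x) x))"
proof -
  have "cinner (A x) x = cnj (cinner (A x) x)"
    using assms[of x x] cinner_commute[of x "A x"] by simp
  then show ?thesis by (simp add: complex_eq_iff)
qed

lemma psd_Cauchy_Schwarz:
  assumes A: "psd A"
  shows "(cmod (cinner (A x) y))\<^sup>2 \<le> Re (cinner (A x) x) * Re (cinner (A y) y)"
proof -
  let ?a = "Re (cinner (A x) x)" and ?b = "Re (cinner (A y) y)" and ?m = "cmod (cinner (A x) y)"
  note lin = bounded_clinear_add[OF psdD(1)[OF A]] bounded_clinear_scaleC[OF psdD(1)[OF A]]
  obtain c where c: "cmod c = 1" "c * cinner (A x) y = complex_of_real ?m"
    using ex_phase by blast
  \<comment> \<open>After the rotation by \<open>c\<close> the cross term is real, so the form is a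
    real quadratic polynomial in \<open>t\<close> that never becomes negative.\<close>
  have q: "0 \<le> ?a * t\<^sup>2 + 2 * t * ?m + ?b" for t :: real
  proof -
    let ?u = "complex_of_real t * c"
    let ?z = "?u *\<^sub>C x + y"
    have "cinner (A ?z) ?z = ?u * cnj ?u * cinner (A x) x + ?u * cinner (A x) y +
        cnj (?u * cinner (A x) y) + cinner (A y) y"
      using psdD(2)[OF A, of y x] cinner_commute[of y "A x"]
      by (simp add: lin cinner_add_left cinner_add_right cinner_scaleC_left cinner_scaleC_right
          algebra_simps)
    also have "?u * cinner (A x) y = complex_of_real (t * ?m)"
      using c(2) by (simp add: mult.assoc)
    also have "?u * cnj ?u = complex_of_real (t\<^sup>2)"
      using complex_norm_square[of ?u] by (simp add: norm_mult c(1))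
    finally have "Re (cinner (A ?z) ?z) = t\<^sup>2 * ?a + 2 * t * ?m + ?b" by simp
    then show ?thesis using psdD(3)[OF A, of ?z] by (simp add: mult.commute)
  qed
  have a: "?a \<ge> 0" "?b \<ge> 0" using psdD(3)[OF A] by auto
  show ?thesis
  proof (cases "?a = 0")
    case True
    have "?m = 0"
    proof (rule ccontr)
      assume "?m \<noteq> 0"
      \<comment> \<open>Without a quadratic term the polynomial is affine, and this \<open>t\<close>
        gives it the value -1. In the other case below, \<open>t\<close> is the minimizer.\<close>
      then show False using q[of "- (?b + 1) / (2 * ?m)"] True by (simp add: field_simps)
    qed
    then show ?thesis using True by simp
  next
    case False
    then show ?thesis using q[of "- ?m / ?a"] a
      by (simp add: field_simps power2_eq_square)
  qed
qed

lemma psd_form_eq_0: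
  assumes "psd A" "Re (cinner (A x) x) = 0"
  shows "A x = 0"
  using psd_Cauchy_Schwarz[OF assms(1), of x "A x"] assms(2) by (simp add: cinner_self)

text \<open>Cauchy-Schwarz for the form of \<open>A\<close>, applied to \<open>x\<close> and
  \<open>A x\<close>, turns a bound on the quadratic form into one on the norm.\<close>

lemma psd_norm_le:
  assumes A: "psd A" and le: "\<And>x. Re (cinner (A x) x) \<le> t * (norm x)\<^sup>2"
  shows "norm (A x) \<le> t * norm x"
proof (cases "A x = 0")
  case True
  have "0 \<le> t * (norm x)\<^sup>2" using psdD(3)[OF A] le order_trans by blast
  then show ?thesis using True by (cases "x = 0") (auto simp: zero_le_mult_iff)
next
  case False
  have "((norm (A x))\<^sup>2)\<^sup>2 = (cmod (cinner (A x) (A x)))\<^sup>2" by (simp add: cinner_self norm_power)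
  also have "\<dots> \<le> Re (cinner (A x) x) * Re (cinner (A (A x)) (A x))"
    by (rule psd_Cauchy_Schwarz[OF A])
  also have "\<dots> \<le> (t * (norm x)\<^sup>2) * (t * (norm (A x))\<^sup>2)"
    by (rule mult_mono[OF le le]) (use psdD(3)[OF A] le order_trans in blast)+
  also have "\<dots> = (t * norm x)\<^sup>2 * (norm (A x))\<^sup>2" by (simp add: power_mult_distrib power2_eq_square)
  finally have "(norm (A x))\<^sup>2 * (norm (A x))\<^sup>2 \<le> (t * norm x)\<^sup>2 * (norm (A x))\<^sup>2"
    by (simp only: power2_eq_square[of "(norm (A x))\<^sup>2"])
  then have "(norm (A x))\<^sup>2 \<le> (t * norm x)\<^sup>2" using False by (simp only: mult_le_cancel_right) simp
  moreover have "0 \<le> t * norm x"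
  proof -
    have "0 \<le> t * (norm x)\<^sup>2" using psdD(3)[OF A] le order_trans by blast
    then show ?thesis by (cases "x = 0") (auto simp: zero_le_mult_iff)
  qed
  ultimately show ?thesis by (rule power2_le_imp_le)
qed

section \<open>Square roots of positive operators by a majorized iteration\<close>

primrec sqrt_majorant :: "nat \<Rightarrow> real" where
  "sqrt_majorant 0 = 0"
| "sqrt_majorant (Suc n) = (1 + (sqrt_majorant n)\<^sup>2) / 2"

lemma sqrt_majorant_bounds: "0 \<le> sqrt_majorant n" "sqrt_majorant n \<le> 1"
proof -
  have "0 \<le> sqrt_majorant n \<and> sqrt_majorant n \<le> 1"
    by (induction n) (auto simp: power_le_one)
  then show "0 \<le> sqrt_majorant n" "sqrt_majorant n \<le> 1" by auto
qed

lemma sqrt_majorant_Suc_ge: "sqrt_majorant n \<le> sqrt_majorant (Suc n)"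
  using sum_squares_ge_zero[of "sqrt_majorant n - 1" 0] by (simp add: power2_eq_square algebra_simps)

text \<open>\<open>sqrt_majorant\<close> is the operator iteration below for the scalar
  \<open>C = 1\<close>. It dominates the norms and the increments of that iteration, so operator
  convergence reduces to a bounded increasing real sequence.\<close>

lemma sqrt_majorant_Cauchy: "Cauchy sqrt_majorant"
proof -
  have "incseq sqrt_majorant" by (rule incseq_SucI) (rule sqrt_majorant_Suc_ge)
  then obtain L where "sqrt_majorant \<longlonglongrightarrow> L"
    using incseq_convergent[of sqrt_majorant 1] sqrt_majorant_bounds(2) by metis
  then show ?thesis by (simp add: LIMSEQ_imp_Cauchy)
qed

text \<open>The square root of \<open>1 - C\<close> is \<open>1 - Y\<close> where \<open>Y\<close> is the fixed point of \<open>Y = (C + Y\<^sup>2) / 2\<close>.\<close>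

primrec sqrt_iter :: "('a::complex_inner \<Rightarrow> 'a) \<Rightarrow> nat \<Rightarrow> 'a \<Rightarrow> 'a" where
  "sqrt_iter C 0 = (\<lambda>x. 0)"
| "sqrt_iter C (Suc n) = (\<lambda>x. (1/2) *\<^sub>R (C x + sqrt_iter C n (sqrt_iter C n x)))"

context
  fixes C :: "'a::chilbert_space \<Rightarrow> 'a"
  assumes C: "bounded_clinear C" and C_le: "\<And>x. norm (C x) \<le> norm x"
begin

lemma sqrt_iter_bounded_clinear: "bounded_clinear (sqrt_iter C n)"
proof (induction n)
  case (Suc n)
  show ?case
    unfolding sqrt_iter.simps scaleC_of_real[symmetric]
    by (intro bounded_clinear_scaleC_fun bounded_clinear_add_fun C bounded_clinear_compose[OF Suc Suc])
qed (simp add: bounded_clinear_0)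

lemma sqrt_iter_norm_le: "norm (sqrt_iter C n x) \<le> sqrt_majorant n * norm x"
proof (induction n arbitrary: x)
  case (Suc n)
  have "norm (sqrt_iter C n (sqrt_iter C n x)) \<le> sqrt_majorant n * (sqrt_majorant n * norm x)"
    by (rule order_trans[OF Suc mult_left_mono[OF Suc sqrt_majorant_bounds(1)]])
  then have "norm (C x + sqrt_iter C n (sqrt_iter C n x)) \<le> norm x + (sqrt_majorant n)\<^sup>2 * norm x"
    by (intro norm_triangle_le) (use C_le[of x] in \<open>simp add: power2_eq_square\<close>)
  then show ?case unfolding sqrt_iter.simps norm_scaleR by (simp add: algebra_simps)
qed simp

lemma sqrt_iter_diff:
  "norm (sqrt_iter C (Suc n) x - sqrt_iter C n x) \<le> (sqrt_majorant (Suc n) - sqrt_majorant n) * norm x"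
proof (induction n arbitrary: x)
  case 0
  then show ?case using C_le[of x] by simp
next
  case (Suc n)
  let ?Y = "sqrt_iter C n" and ?Z = "sqrt_iter C (Suc n)"
  let ?y = "sqrt_majorant n" and ?z = "sqrt_majorant (Suc n)"
  have "sqrt_iter C (Suc (Suc n)) x - ?Z x = (1/2) *\<^sub>R (?Z (?Z x) - ?Y (?Y x))"
  proof -
    have "?Z x = (1/2) *\<^sub>R (C x + ?Y (?Y x))"
      "sqrt_iter C (Suc (Suc n)) x = (1/2) *\<^sub>R (C x + ?Z (?Z x))"
      unfolding sqrt_iter.simps by (rule refl)+
    then show ?thesis by (simp add: scaleR_diff_right[symmetric] del: sqrt_iter.simps)
  qed
  \<comment> \<open>Operator form of
    \<open>?z * ?z - ?y * ?y = (?z - ?y) * ?z + ?y * (?z - ?y)\<close>, so that each summand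
    contains one increment controlled by the induction hypothesis.\<close>
  also have "?Z (?Z x) - ?Y (?Y x) = (?Z (?Z x) - ?Y (?Z x)) + ?Y (?Z x - ?Y x)"
    unfolding bounded_clinear_diff[OF sqrt_iter_bounded_clinear] by simp
  also have "norm ((1/2) *\<^sub>R \<dots>) \<le> (1/2) * ((?z - ?y) * (?z * norm x) + ?y * ((?z - ?y) * norm x))"
  proof -
    have "norm (?Z (?Z x) - ?Y (?Z x)) \<le> (?z - ?y) * (?z * norm x)"
      by (rule order_trans[OF Suc mult_left_mono[OF sqrt_iter_norm_le]])
        (use sqrt_majorant_Suc_ge[of n] in linarith)
    moreover have "norm (?Y (?Z x - ?Y x)) \<le> ?y * ((?z - ?y) * norm x)"
      by (rule order_trans[OF sqrt_iter_norm_le mult_left_mono[OF Suc sqrt_majorant_bounds(1)]])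
    ultimately show ?thesis
      unfolding norm_scaleR by (intro mult_mono norm_triangle_le) auto
  qed
  also have "\<dots> = (sqrt_majorant (Suc (Suc n)) - ?z) * norm x"
  proof -
    have "?z = (1 + ?y\<^sup>2) / 2" "sqrt_majorant (Suc (Suc n)) = (1 + ?z\<^sup>2) / 2"
      unfolding sqrt_majorant.simps by (rule refl)+
    then have "sqrt_majorant (Suc (Suc n)) - ?z = (?z\<^sup>2 - ?y\<^sup>2) / 2"
      by (metis add_diff_cancel_left diff_divide_distrib)
    then have *: "sqrt_majorant (Suc (Suc n)) - ?z = (?z - ?y) * (?z + ?y) / 2"
      by (simp add: power2_eq_square algebra_simps del: sqrt_majorant.simps)
    show ?thesis unfolding * by (simp add: algebra_simps del: sqrt_majorant.simps)
  qed
  finally show ?case .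
qed

lemma sqrt_iter_Cauchy_bound:
  "m \<le> n \<Longrightarrow> norm (sqrt_iter C n x - sqrt_iter C m x) \<le> (sqrt_majorant n - sqrt_majorant m) * norm x"
proof (induction n rule: dec_induct)
  case (step n)
  have "norm (sqrt_iter C (Suc n) x - sqrt_iter C m x) \<le>
      norm (sqrt_iter C (Suc n) x - sqrt_iter C n x) + norm (sqrt_iter C n x - sqrt_iter C m x)"
    using norm_triangle_ineq[of "sqrt_iter C (Suc n) x - sqrt_iter C n x" "sqrt_iter C n x - sqrt_iter C m x"]
    by (simp del: sqrt_iter.simps)
  also have "\<dots> \<le> (sqrt_majorant (Suc n) - sqrt_majorant n) * norm x
      + (sqrt_majorant n - sqrt_majorant m) * norm x"
    by (intro add_mono sqrt_iter_diff step)
  finally show ?case by (simp add: algebra_simps)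
qed simp

lemma sqrt_iter_convergent: "\<exists>y. (\<lambda>n. sqrt_iter C n x) \<longlonglongrightarrow> y"
proof -
  have "Cauchy (\<lambda>n. sqrt_iter C n x)"
  proof (rule metric_CauchyI)
    fix e :: real assume e: "e > 0"
    then have "e / (norm x + 1) > 0" by (simp add: add_nonneg_pos)
    then obtain N where N: "\<And>m n. m \<ge> N \<Longrightarrow> n \<ge> N \<Longrightarrow>
        dist (sqrt_majorant m) (sqrt_majorant n) < e / (norm x + 1)"
      using metric_CauchyD[OF sqrt_majorant_Cauchy] by metis
    have *: "dist (sqrt_iter C n x) (sqrt_iter C m x) < e" if "m \<le> n" "N \<le> m" for m n
    proof -
      have "dist (sqrt_iter C n x) (sqrt_iter C m x) \<le> (sqrt_majorant n - sqrt_majorant m) * norm x"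
        using sqrt_iter_Cauchy_bound[OF that(1)] by (simp add: dist_norm)
      also have "\<dots> \<le> e / (norm x + 1) * norm x"
        using N[of n m] that by (intro mult_right_mono) (auto simp: dist_real_def)
      also have "\<dots> = e * (norm x / (norm x + 1))" by simp
      also have "\<dots> < e * 1"
        using e by (intro mult_strict_left_mono) (auto simp: divide_less_eq_1 add_nonneg_pos)
      also have "\<dots> = e" by simp
      finally show ?thesis .
    qed
    then have "dist (sqrt_iter C m x) (sqrt_iter C n x) < e" if "N \<le> m" "N \<le> n" for m n
      using that by (metis dist_commute nle_le)
    then show "\<exists>N. \<forall>m\<ge>N. \<forall>n\<ge>N. dist (sqrt_iter C m x) (sqrt_iter C n x) < e" by blast
  qed
  then show ?thesis using Cauchy_convergent convergent_def by blast
qed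

text \<open>All properties are inherited from the iterates by pointwise limits. The last one,
  commutation with whatever commutes with \<open>C\<close>, is there for the uniqueness of square
  roots.\<close>

lemma sqrt_fixed_point:
  assumes C_sa: "\<And>x y. cinner (C x) y = cinner x (C y)"
  obtains Y where "bounded_clinear Y" "\<And>x. norm (Y x) \<le> norm x"
    "\<And>x y. cinner (Y x) y = cinner x (Y y)" "\<And>x. Y x = (1/2) *\<^sub>R (C x + Y (Y x))"
    "\<And>B x. bounded_clinear B \<Longrightarrow> (\<And>x. B (C x) = C (B x)) \<Longrightarrow> B (Y x) = Y (B x)"
proof -
  let ?Y = "sqrt_iter C"
  obtain Y where lim: "\<And>x. (\<lambda>n. ?Y n x) \<longlonglongrightarrow> Y x" using sqrt_iter_convergent by metis
  have le1: "norm (?Y n x) \<le> norm x" for n x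
    using order_trans[OF sqrt_iter_norm_le mult_right_mono[OF sqrt_majorant_bounds(2)]] by simp
  have Y_le: "norm (Y x) \<le> norm x" for x
    by (rule LIMSEQ_le_const2[OF tendsto_norm[OF lim]]) (use le1 in blast)
  have Y: "bounded_clinear Y"
  proof (rule bounded_clinearI[of _ 1])
    show "Y (x + y) = Y x + Y y" for x y
      using lim[of "x + y"] tendsto_add[OF lim[of x] lim[of y]]
      by (simp add: bounded_clinear_add[OF sqrt_iter_bounded_clinear] LIMSEQ_unique)
    show "Y (c *\<^sub>C x) = c *\<^sub>C Y x" for c x
      using lim[of "c *\<^sub>C x"] bounded_linear.tendsto[OF bounded_linear_scaleC_right lim[of x]]
      by (simp add: bounded_clinear_scaleC[OF sqrt_iter_bounded_clinear] LIMSEQ_unique)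
  qed (simp add: Y_le)
  \<comment> \<open>The index occurs twice. The iterates are contractions uniformly in
    \<open>n\<close>, so the inner iterate may be replaced by its limit \<open>Y x\<close> before
    the outer limit is taken.\<close>
  have lim2: "(\<lambda>n. ?Y n (?Y n x)) \<longlonglongrightarrow> Y (Y x)" for x
  proof -
    have "(\<lambda>n. ?Y n (?Y n x - Y x)) \<longlonglongrightarrow> 0"
    proof (rule Lim_null_comparison)
      show "\<forall>\<^sub>F n in sequentially. norm (?Y n (?Y n x - Y x)) \<le> norm (?Y n x - Y x)"
        using le1 by simp
      show "(\<lambda>n. norm (?Y n x - Y x)) \<longlonglongrightarrow> 0"
        using lim[of x] by (simp add: LIM_zero tendsto_norm_zero)
    qed
    from tendsto_add[OF this lim[of "Y x"]] show ?thesis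
      by (simp add: bounded_clinear_diff[OF sqrt_iter_bounded_clinear])
  qed
  have sa: "cinner (?Y n x) y = cinner x (?Y n y)" for n x y
  proof (induction n arbitrary: x y)
    case (Suc n)
    then show ?case
      by (simp add: cinner_scaleR_left cinner_scaleR_right cinner_add_left cinner_add_right C_sa)
  qed simp
  have com: "B (?Y n x) = ?Y n (B x)" if "bounded_clinear B" "\<And>x. B (C x) = C (B x)" for B n x
    by (induction n arbitrary: x)
      (simp_all add: that bounded_clinear_zero bounded_clinear_scaleR bounded_clinear_add)
  show thesis
  proof (rule that[OF Y Y_le])
    show "cinner (Y x) y = cinner x (Y y)" for x y
      using LIMSEQ_unique[OF tendsto_cinner[OF lim[of x] tendsto_const[of y]]]
        tendsto_cinner[OF tendsto_const[of x] lim[of y]] by (simp add: sa)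
    show "Y x = (1/2) *\<^sub>R (C x + Y (Y x))" for x
    proof (rule LIMSEQ_unique[OF LIMSEQ_Suc[OF lim]])
      show "(\<lambda>n. ?Y (Suc n) x) \<longlonglongrightarrow> (1/2) *\<^sub>R (C x + Y (Y x))"
        unfolding sqrt_iter.simps by (intro tendsto_intros lim2)
    qed
    show "B (Y x) = Y (B x)" if "bounded_clinear B" "\<And>x. B (C x) = C (B x)" for B x
      using LIMSEQ_unique[OF bounded_clinear_tendsto[OF that(1) lim]] lim by (simp add: com that)
  qed
qed

end

lemma psd_sqrt_exists:
  fixes A :: "'a::chilbert_space \<Rightarrow> 'a"
  assumes A: "psd A"
  obtains S where "psd S" "\<And>x. S (S x) = A x"
    "\<And>B x. bounded_clinear B \<Longrightarrow> (\<And>x. B (A x) = A (B x)) \<Longrightarrow> B (S x) = S (B x)"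
proof -
  obtain K where K: "K > 0" "\<And>x. norm (A x) \<le> K * norm x"
    using bounded_clinear_boundE[OF psdD(1)[OF A]] by blast
  \<comment> \<open>Dividing by the norm bound \<open>K\<close> puts \<open>C\<close> between 0 and
    1. The fixed point equation says that \<open>1 - Y\<close> squares to \<open>1 - C\<close>,
    which is \<open>A\<close> divided by \<open>K\<close>; hence the factor \<open>sqrt K\<close> in
    \<open>S\<close>.\<close>
  define C where "C = (\<lambda>x. x - complex_of_real (1 / K) *\<^sub>C A x)"
  have C: "bounded_clinear C" unfolding C_def
    by (intro bounded_clinear_diff_fun bounded_clinear_id bounded_clinear_scaleC_fun psdD(1)[OF A])
  have form: "cinner (C x) y = cinner x y - cinner (A x) y / K" for x y
    by (simp add: C_def cinner_diff_left cinner_scaleC_left)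
  have sa: "cinner (C x) y = cinner x (C y)" for x y
    by (simp add: C_def cinner_diff_left cinner_scaleC_left cinner_diff_right cinner_scaleC_right
        psdD(2)[OF A])
  have AK: "Re (cinner (A x) x) \<le> K * (norm x)\<^sup>2" for x
    using order_trans[OF complex_Re_le_cmod order_trans[OF Cauchy_Schwarz_cinner
        mult_right_mono[OF K(2) norm_ge_zero]]] by (simp add: power2_eq_square mult.assoc)
  have "psd C"
    using AK K(1) by (intro psdI C sa) (simp add: form Re_cinner_self field_simps)
  then have C_le: "norm (C x) \<le> norm x" for x
    using psd_norm_le[of C 1] psdD(3)[OF A] K(1) by (simp add: form Re_cinner_self)
  obtain Y where Y: "bounded_clinear Y" "\<And>x. norm (Y x) \<le> norm x"
    "\<And>x y. cinner (Y x) y = cinner x (Y y)" "\<And>x. Y x = (1/2) *\<^sub>R (C x + Y (Y x))"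
    "\<And>B x. bounded_clinear B \<Longrightarrow> (\<And>x. B (C x) = C (B x)) \<Longrightarrow> B (Y x) = Y (B x)"
    using sqrt_fixed_point[OF C C_le sa] by blast
  define S where "S = (\<lambda>x. complex_of_real (sqrt K) *\<^sub>C (x - Y x))"
  have S: "bounded_clinear S" unfolding S_def
    by (intro bounded_clinear_diff_fun bounded_clinear_id bounded_clinear_scaleC_fun Y(1))
  show thesis
  proof (rule that)
    show "psd S"
    proof (rule psdI[OF S])
      show "cinner (S x) y = cinner x (S y)" for x y
        by (simp add: S_def cinner_scaleC_left cinner_scaleC_right cinner_diff_left
            cinner_diff_right Y(3))
      have "Re (cinner (Y x) x) \<le> (norm x)\<^sup>2" for x
        using order_trans[OF complex_Re_le_cmod order_trans[OF Cauchy_Schwarz_cinner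
            mult_right_mono[OF Y(2) norm_ge_zero]]] by (simp add: power2_eq_square)
      then show "0 \<le> Re (cinner (S x) x)" for x
        using K(1) by (simp add: S_def cinner_scaleC_left cinner_diff_left Re_cinner_self)
    qed
    show "S (S x) = A x" for x
    proof -
      have "2 *\<^sub>R Y x = C x + Y (Y x)"
        using arg_cong[OF Y(4)[of x], of "\<lambda>z. 2 *\<^sub>R z"] by simp
      then have "x - Y x - Y (x - Y x) = complex_of_real (1 / K) *\<^sub>C A x"
        by (simp add: C_def bounded_clinear_diff[OF Y(1)] scaleR_2 algebra_simps)
      moreover have "S (S x) = complex_of_real (sqrt K * sqrt K) *\<^sub>C (x - Y x - Y (x - Y x))"
        unfolding S_def
        by (simp only: bounded_clinear_scaleC[OF Y(1)] scaleC_scaleC of_real_mult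
            complex_vector.scale_right_diff_distrib[symmetric])
      ultimately show ?thesis using K(1) by (simp add: scaleC_scaleC)
    qed
    show "B (S x) = S (B x)" if B: "bounded_clinear B" "\<And>x. B (A x) = A (B x)" for B x
    proof -
      have "B (Y x) = Y (B x)"
        by (rule Y(5)[OF B(1)])
          (simp add: C_def bounded_clinear_diff[OF B(1)] bounded_clinear_scaleC[OF B(1)] B(2))
      then show ?thesis
        by (simp add: S_def bounded_clinear_diff[OF B(1)] bounded_clinear_scaleC[OF B(1)])
    qed
  qed
qed

text \<open>Any positive root \<open>P\<close> commutes with its square, hence with the constructed
  root \<open>Q\<close>. Then \<open>P + Q\<close> kills \<open>y = P x - Q x\<close>, so both
  positive forms vanish at \<open>y\<close>, which gives \<open>P y = Q y = 0\<close> and finally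
  \<open>y = 0\<close>.\<close>

lemma psd_sqrt_unique:
  fixes R :: "'a::chilbert_space \<Rightarrow> 'a"
  assumes R: "psd R" and S: "psd S" and eq: "R \<circ> R = S \<circ> S"
  shows "R = S"
proof -
  have A: "psd (R \<circ> R)"
  proof (rule psdI)
    show "bounded_clinear (R \<circ> R)"
      unfolding comp_def by (rule bounded_clinear_compose[OF psdD(1)[OF R] psdD(1)[OF R]])
    show "cinner ((R \<circ> R) x) y = cinner x ((R \<circ> R) y)" for x y
      using psdD(2)[OF R, of "R x" y] psdD(2)[OF R, of x "R y"] by simp
    show "0 \<le> Re (cinner ((R \<circ> R) x) x)" for x
      using psdD(2)[OF R, of "R x" x] by (simp add: Re_cinner_self)
  qed
  obtain Q where Q: "psd Q" "\<And>x. Q (Q x) = R (R x)"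
    "\<And>B x. bounded_clinear B \<Longrightarrow> (\<And>x. B (R (R x)) = R (R (B x))) \<Longrightarrow> B (Q x) = Q (B x)"
    using psd_sqrt_exists[OF A] by auto
  have "P = Q" if P: "psd P" "\<And>x. P (P x) = R (R x)" for P
  proof
    fix x
    note linP = bounded_clinear_add[OF psdD(1)[OF P(1)]] bounded_clinear_diff[OF psdD(1)[OF P(1)]]
    note linQ = bounded_clinear_add[OF psdD(1)[OF Q(1)]] bounded_clinear_diff[OF psdD(1)[OF Q(1)]]
    have com: "P (Q z) = Q (P z)" for z
      by (rule Q(3)[OF psdD(1)[OF P(1)]]) (metis P(2))
    define y where "y = P x - Q x"
    have "P y + Q y = 0"
      by (simp add: y_def linP linQ com P(2) Q(2))
    then have "Re (cinner (P y) y) + Re (cinner (Q y) y) = 0"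
      by (metis cinner_add_left cinner_zero_left plus_complex.simps(1) zero_complex.simps(1))
    then have "Re (cinner (P y) y) = 0" "Re (cinner (Q y) y) = 0"
      using psdD(3)[OF P(1), of y] psdD(3)[OF Q(1), of y] by auto
    then have 0: "P y = 0" "Q y = 0" using psd_form_eq_0 P(1) Q(1) by blast+
    have "cinner y y = cinner x (P y) - cinner x (Q y)"
      by (subst (1) y_def) (simp add: cinner_diff_left psdD(2)[OF P(1)] psdD(2)[OF Q(1)])
    then show "P x = Q x" using 0 by (simp add: y_def)
  qed
  from this[OF R] this[OF S] show ?thesis using eq by (metis comp_apply)
qed

section \<open>Absolute value and polar decomposition\<close>

lemma psd_adjoint_comp:
  assumes A: "bounded_clinear A" and A': "bounded_clinear A'"
    and adj: "\<And>x y. cinner (A x) y = cinner x (A' y)"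
  shows "psd (\<lambda>x. A' (A x))"
proof (rule psdI)
  show "bounded_clinear (\<lambda>x. A' (A x))" by (rule bounded_clinear_compose[OF A' A])
  have *: "cinner (A' z) x = cinner z (A x)" for z x
    using arg_cong[OF adj[of x z], of cnj] cinner_commute[of "A' z" x] cinner_commute[of z "A x"]
    by simp
  show "cinner (A' (A x)) y = cinner x (A' (A y))" for x y
    using *[of "A x" y] adj[of x "A y"] by simp
  show "0 \<le> Re (cinner (A' (A x)) x)" for x
    using *[of "A x" x] by (simp add: Re_cinner_self)
qed

lemma abs_op:
  fixes A :: "'a::chilbert_space \<Rightarrow> 'a"
  assumes A: "bounded_clinear A"
  shows "psd (abs_op A)" "norm (abs_op A x) = norm (A x)"
proof -
  obtain A' where A': "bounded_clinear A'" "\<And>x y. cinner (A x) y = cinner x (A' y)"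
    using adjoint_exists[OF A] by blast
  obtain S where S: "psd S" "\<And>x. S (S x) = A' (A x)"
    using psd_sqrt_exists[OF psd_adjoint_comp[OF A A']] by metis
  have "\<exists>!R. psd R \<and> R \<circ> R = cadjoint A \<circ> A"
  proof (rule ex1I[of _ S])
    show *: "psd S \<and> S \<circ> S = cadjoint A \<circ> A"
      using S by (simp add: cadjoint_eqI[OF A'(2)] comp_def)
    show "R = S" if "psd R \<and> R \<circ> R = cadjoint A \<circ> A" for R
      using psd_sqrt_unique[of R S] that * by simp
  qed
  from theI'[OF this] have R: "psd (abs_op A)" "abs_op A \<circ> abs_op A = A' \<circ> A"
    by (simp_all add: abs_op_def cadjoint_eqI[OF A'(2)])
  show "psd (abs_op A)" by fact
  have "cinner (abs_op A x) (abs_op A x) = cinner x (A' (A x))"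
    using psdD(2)[OF R(1), of x "abs_op A x"] fun_cong[OF R(2), of x] by simp
  then have "cinner (abs_op A x) (abs_op A x) = cinner (A x) (A x)" by (simp add: A'(2))
  then have "(norm (abs_op A x))\<^sup>2 = (norm (A x))\<^sup>2" by (metis Re_cinner_self)
  then show "norm (abs_op A x) = norm (A x)" by simp
qed

lemma abs_op_psd:
  fixes A :: "'a::chilbert_space \<Rightarrow> 'a"
  assumes A: "psd A"
  shows "abs_op A = A"
  unfolding abs_op_def cadjoint_eqI[OF psdD(2)[OF A]]
  using A psd_sqrt_unique by (intro the_equality) auto

text \<open>Sending \<open>abs_op A x\<close> to \<open>A x\<close> is isometric on the range of
  \<open>abs_op A\<close>; \<open>W\<close> is its continuous extension to the closure, preceded by
  the projection onto that closure. Later only the contractivity of \<open>W\<close> and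
  \<open>W'\<close> matters besides the two factorizations, since contractions preserve Bessel
  families.\<close>

lemma polar_decomposition:
  fixes A :: "'a::chilbert_space \<Rightarrow> 'a"
  assumes A: "bounded_clinear A"
  obtains W W' where "bounded_clinear W" "bounded_clinear W'"
    "\<And>x y. cinner (W x) y = cinner x (W' y)" "\<And>x. norm (W x) \<le> norm x" "\<And>x. norm (W' x) \<le> norm x"
    "\<And>x. A x = W (abs_op A x)" "\<And>x. abs_op A x = W' (A x)"
proof -
  let ?R = "abs_op A"
  note R = psdD(1)[OF abs_op(1)[OF A]] and R_norm = abs_op(2)[OF A]
  define M where "M = closure (range ?R)"
  have "csubspace (range ?R)"
  proof (rule complex_vector.subspaceI)
    show "0 \<in> range ?R" using bounded_clinear_zero[OF R] by (metis rangeI)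
    show "x + y \<in> range ?R" if "x \<in> range ?R" "y \<in> range ?R" for x y
      using that bounded_clinear_add[OF R] by (metis (no_types, lifting) rangeE rangeI)
    show "c *\<^sub>C x \<in> range ?R" if "x \<in> range ?R" for c x
      using that bounded_clinear_scaleC[OF R] by (metis (no_types, lifting) rangeE rangeI)
  qed
  then have M: "csubspace M" "closed M" "\<And>x. ?R x \<in> M"
    using csubspace_closure closure_subset[of "range ?R"] by (auto simp: M_def)
  have iso: "norm (A x - A y) = norm (?R x - ?R y)" for x y
    using R_norm[of "x - y"] by (simp add: bounded_clinear_diff[OF A] bounded_clinear_diff[OF R])
  obtain V0 where V0: "\<And>x. V0 (?R x) = A x"
  proof
    \<comment> \<open>The choice of a preimage is harmless: by \<open>iso\<close>, two vectors with
      the same image under \<open>abs_op A\<close> have the same image under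
      \<open>A\<close>.\<close>
    show "A (SOME z. ?R z = ?R x) = A x" for x
      using iso[of "SOME z. ?R z = ?R x" x] someI[of "\<lambda>z. ?R z = ?R x" x] by simp
  qed
  have "uniformly_continuous_on (range ?R) V0"
    unfolding uniformly_continuous_on_def
    by (auto simp: V0 dist_norm iso)
  then obtain V where V: "uniformly_continuous_on M V" "\<And>x. x \<in> range ?R \<Longrightarrow> V0 x = V x"
    unfolding M_def by (rule uniformly_continuous_on_extension_on_closure) blast
  have VR: "V (?R x) = A x" for x using V(2) V0 by auto
  have approx: "\<exists>f. (\<lambda>n. ?R (f n)) \<longlonglongrightarrow> y \<and> (\<lambda>n. A (f n)) \<longlonglongrightarrow> V y" if y: "y \<in> M" for y
  proof -
    obtain g where g: "\<And>n. g n \<in> range ?R" "g \<longlonglongrightarrow> y"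
      using y by (auto simp: M_def closure_sequential)
    then have "\<exists>f. \<forall>n. g n = ?R (f n)" by (intro choice) blast
    then obtain f where f: "\<And>n. g n = ?R (f n)" by blast
    have "(\<lambda>n. V (g n)) \<longlonglongrightarrow> V y"
    proof (rule continuous_on_tendsto_compose[OF uniformly_continuous_imp_continuous[OF V(1)] g(2) y])
      show "\<forall>\<^sub>F n in sequentially. g n \<in> M" using f M(3) by simp
    qed
    then have "(\<lambda>n. A (f n)) \<longlonglongrightarrow> V y" by (simp add: f VR)
    moreover have "(\<lambda>n. ?R (f n)) \<longlonglongrightarrow> y" using g(2) by (simp add: f[abs_def, symmetric])
    ultimately show ?thesis by blast
  qed
  have V_add: "V (x + y) = V x + V y" if xy: "x \<in> M" "y \<in> M" for x y
  proof -
    obtain f g where "(\<lambda>n. ?R (f n)) \<longlonglongrightarrow> x" "(\<lambda>n. A (f n)) \<longlonglongrightarrow> V x"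
      "(\<lambda>n. ?R (g n)) \<longlonglongrightarrow> y" "(\<lambda>n. A (g n)) \<longlonglongrightarrow> V y"
      using approx xy by metis
    then have lim: "(\<lambda>n. ?R (f n + g n)) \<longlonglongrightarrow> x + y" "(\<lambda>n. A (f n + g n)) \<longlonglongrightarrow> V x + V y"
      by (auto simp: bounded_clinear_add[OF R] bounded_clinear_add[OF A] intro: tendsto_add)
    have "x + y \<in> M" using complex_vector.subspace_add[OF M(1)] xy by blast
    from continuous_on_tendsto_compose[OF uniformly_continuous_imp_continuous[OF V(1)] lim(1) this]
    have "(\<lambda>n. V (?R (f n + g n))) \<longlonglongrightarrow> V (x + y)" using M(3) by simp
    then show ?thesis unfolding VR using lim(2) LIMSEQ_unique by blast
  qed
  have V_scale: "V (c *\<^sub>C x) = c *\<^sub>C V x" if x: "x \<in> M" for c x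
  proof -
    obtain f where "(\<lambda>n. ?R (f n)) \<longlonglongrightarrow> x" "(\<lambda>n. A (f n)) \<longlonglongrightarrow> V x"
      using approx x by metis
    then have lim: "(\<lambda>n. ?R (c *\<^sub>C f n)) \<longlonglongrightarrow> c *\<^sub>C x" "(\<lambda>n. A (c *\<^sub>C f n)) \<longlonglongrightarrow> c *\<^sub>C V x"
      by (auto simp: bounded_clinear_scaleC[OF R] bounded_clinear_scaleC[OF A]
          intro: bounded_linear.tendsto[OF bounded_linear_scaleC_right])
    have "c *\<^sub>C x \<in> M" using complex_vector.subspace_scale[OF M(1)] x by blast
    from continuous_on_tendsto_compose[OF uniformly_continuous_imp_continuous[OF V(1)] lim(1) this]
    have "(\<lambda>n. V (?R (c *\<^sub>C f n))) \<longlonglongrightarrow> V (c *\<^sub>C x)" using M(3) by simp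
    then show ?thesis unfolding VR using lim(2) LIMSEQ_unique by blast
  qed
  have V_norm: "norm (V x) = norm x" if "x \<in> M" for x
  proof -
    obtain f where f: "(\<lambda>n. ?R (f n)) \<longlonglongrightarrow> x" "(\<lambda>n. A (f n)) \<longlonglongrightarrow> V x"
      using approx \<open>x \<in> M\<close> by metis
    from tendsto_norm[OF f(1)] have "(\<lambda>n. norm (A (f n))) \<longlonglongrightarrow> norm x" by (simp add: R_norm)
    then show ?thesis using tendsto_norm[OF f(2)] LIMSEQ_unique by blast
  qed
  have "\<exists>p. p \<in> M \<and> (\<forall>y\<in>M. cinner (x - p) y = 0)" for x
    by (rule projection_exists[OF M(1,2), of x]) blast
  then obtain P where P: "\<And>x. P x \<in> M" "\<And>x y. y \<in> M \<Longrightarrow> cinner (x - P x) y = 0"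
    by metis
  have P_eq: "P x = p" if "p \<in> M" "\<And>y. y \<in> M \<Longrightarrow> cinner (x - p) y = 0" for x p
  proof -
    have "p - P x \<in> M" using that(1) P(1) complex_vector.subspace_diff[OF M(1)] by blast
    then have "cinner (x - P x) (p - P x) - cinner (x - p) (p - P x) = 0" using that(2) P(2) by simp
    then have "cinner (p - P x) (p - P x) = 0" by (simp add: cinner_diff_left)
    then show ?thesis by simp
  qed
  have P_add: "P (x + y) = P x + P y" for x y
    by (rule P_eq) (use P complex_vector.subspace_add[OF M(1)] in
      \<open>auto simp: add_diff_add cinner_add_left\<close>)
  have P_scale: "P (c *\<^sub>C x) = c *\<^sub>C P x" for c x
    by (rule P_eq) (use P complex_vector.subspace_scale[OF M(1)] in
      \<open>auto simp: complex_vector.scale_right_diff_distrib[symmetric] cinner_scaleC_left\<close>)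
  have P_id: "P x = x" if "x \<in> M" for x by (rule P_eq) (auto simp: that)
  have P_norm: "norm (P x) \<le> norm x" for x
  proof -
    have "cinner (P x) (P x) = cinner x (P x)" using P(2)[OF P(1), of x x] by (simp add: cinner_diff_left)
    then have "(norm (P x))\<^sup>2 = Re (cinner x (P x))" by (metis Re_cinner_self)
    also have "\<dots> \<le> norm x * norm (P x)"
      using complex_Re_le_cmod Cauchy_Schwarz_cinner order_trans by blast
    finally show ?thesis by (cases "P x = 0") (auto simp: power2_eq_square)
  qed
  define W where "W = (\<lambda>x. V (P x))"
  have W_norm: "norm (W x) \<le> norm x" for x using P_norm V_norm[OF P(1)] by (simp add: W_def)
  have W: "bounded_clinear W"
    by (rule bounded_clinearI[of _ 1])
      (use W_norm P(1) in \<open>auto simp: W_def P_add P_scale V_add V_scale\<close>)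
  obtain W' where W': "bounded_clinear W'" "\<And>x y. cinner (W x) y = cinner x (W' y)"
    using adjoint_exists[OF W] by blast
  have W'_norm: "norm (W' x) \<le> norm x" for x
  proof -
    have "(norm (W' x))\<^sup>2 = cmod (cinner (W (W' x)) x)"
      by (simp add: W'(2) cinner_self norm_power)
    also have "\<dots> \<le> norm (W' x) * norm x"
      using Cauchy_Schwarz_cinner[of "W (W' x)" x] mult_right_mono[OF W_norm[of "W' x"] norm_ge_zero[of x]]
      by linarith
    finally show ?thesis by (cases "W' x = 0") (auto simp: power2_eq_square)
  qed
  have AW: "A x = W (?R x)" for x by (simp add: W_def P_id[OF M(3)] VR)
  have "W' (A x) = ?R x" for x
  proof -
    \<comment> \<open>The inner product of \<open>W' (A x)\<close> with \<open>?R x\<close> equals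
      the squared norm of \<open>?R x\<close>, so expanding the square leaves a difference of
      squared norms, which contractivity of \<open>W'\<close> makes nonpositive.\<close>
    have "norm (W' (A x) - ?R x) ^ 2 = (norm (W' (A x)))\<^sup>2 - (norm (?R x))\<^sup>2"
    proof -
      have "cinner (W' (A x)) (?R x) = cnj (cinner (W (?R x)) (A x))"
        unfolding W'(2) by (rule cinner_commute)
      then have 1: "cinner (W' (A x)) (?R x) = complex_of_real ((norm (?R x))\<^sup>2)"
        by (simp add: AW[symmetric] cinner_self R_norm)
      then have "cinner (?R x) (W' (A x)) = complex_of_real ((norm (?R x))\<^sup>2)"
        using cinner_commute[of "?R x" "W' (A x)"] by simp
      with 1 cinner_self[of "?R x"] show ?thesis
        unfolding Re_cinner_self[symmetric] by (simp add: cinner_diff_left cinner_diff_right)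
    qed
    also have "\<dots> \<le> 0" using W'_norm[of "A x"] by (simp add: R_norm)
    finally show ?thesis by simp
  qed
  then show thesis using that W W' W_norm W'_norm AW by metis
qed


section \<open>Complete orthogonal systems\<close>

text \<open>Zero vectors are allowed, as in the padding of \<^const>\<open>countable_orthogonal_basis\<close>.\<close>

definition orthosys :: "'i set \<Rightarrow> ('i \<Rightarrow> 'a::complex_inner) \<Rightarrow> bool"
  where "orthosys J e \<longleftrightarrow> (\<forall>i\<in>J. norm (e i) = 1 \<or> e i = 0) \<and>
    (\<forall>i\<in>J. \<forall>j\<in>J. i \<noteq> j \<longrightarrow> cinner (e i) (e j) = 0)"

definition complete_sys :: "'i set \<Rightarrow> ('i \<Rightarrow> 'a::complex_inner) \<Rightarrow> bool"
  where "complete_sys J e \<longleftrightarrow> orthosys J e \<and> closure (cspan (e ` J)) = UNIV"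

text \<open>For an \<open>orthosys\<close> on a finite set this is the orthogonal projection onto
  the span, as zero vectors drop out of the sum.\<close>

definition sys_proj :: "'i set \<Rightarrow> ('i \<Rightarrow> 'a::complex_inner) \<Rightarrow> 'a \<Rightarrow> 'a"
  where "sys_proj F e x = (\<Sum>i\<in>F. cinner x (e i) *\<^sub>C e i)"

lemma orthosys_subset: "orthosys J e \<Longrightarrow> F \<subseteq> J \<Longrightarrow> orthosys F e"
  by (auto simp: orthosys_def)

lemma orthosys_norm_le: "orthosys F e \<Longrightarrow> i \<in> F \<Longrightarrow> norm (e i) \<le> 1"
  unfolding orthosys_def by (metis le_numeral_extra(4) norm_zero zero_le_one)

lemma bounded_clinear_sys_proj: "bounded_clinear (sys_proj F e)"
proof -
  have "bounded_clinear (\<lambda>x. \<Sum>i\<in>F. rank1 (e i) (e i) x)"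
    by (rule bounded_clinear_sum_fun) (rule bounded_clinear_rank1)
  then show ?thesis by (simp add: sys_proj_def[abs_def] rank1_def)
qed

lemma sys_proj_selfadjoint: "cinner (sys_proj F e x) y = cinner x (sys_proj F e y)"
  using cinner_commute[of _ y]
  by (simp add: sys_proj_def cinner_sum_left cinner_sum_right cinner_scaleC_left
      cinner_scaleC_right mult.commute)

lemma orthosys_cinner_scale: "orthosys J e \<Longrightarrow> j \<in> J \<Longrightarrow> cinner (e j) (e j) *\<^sub>C e j = e j"
  by (cases "e j = 0") (auto simp: orthosys_def cinner_self)

lemma sys_proj_base:
  assumes "orthosys F e" "finite F" "j \<in> F"
  shows "sys_proj F e (e j) = e j"
proof -
  have "sys_proj F e (e j) = (\<Sum>i\<in>F. if i = j then e j else 0)"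
    unfolding sys_proj_def
  proof (rule sum.cong)
    show "cinner (e j) (e i) *\<^sub>C e i = (if i = j then e j else 0)" if "i \<in> F" for i
      using assms that orthosys_cinner_scale[OF assms(1,3)] by (auto simp: orthosys_def)
  qed simp
  then show ?thesis using assms by simp
qed

lemma sys_proj_in_span: "sys_proj F e x \<in> cspan (e ` F)"
  unfolding sys_proj_def
  by (intro complex_vector.span_sum complex_vector.span_scale complex_vector.span_base) auto

lemma sys_proj_id:
  assumes "orthosys F e" "finite F" "x \<in> cspan (e ` F)"
  shows "sys_proj F e x = x"
proof -
  have "csubspace {x. sys_proj F e x = x}"
    by (rule complex_vector.subspaceI)
      (auto simp: bounded_clinear_add[OF bounded_clinear_sys_proj]
        bounded_clinear_scaleC[OF bounded_clinear_sys_proj]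
        bounded_clinear_zero[OF bounded_clinear_sys_proj])
  then have "cspan (e ` F) \<subseteq> {x. sys_proj F e x = x}"
    by (intro complex_vector.span_minimal) (auto simp: sys_proj_base[OF assms(1,2)])
  then show ?thesis using assms(3) by blast
qed

lemma sys_proj_idem:
  assumes "orthosys F e" "finite F"
  shows "sys_proj F e (sys_proj F e x) = sys_proj F e x"
  by (rule sys_proj_id[OF assms sys_proj_in_span])

lemma sys_proj_norm:
  assumes "orthosys F e" "finite F"
  shows "(norm (sys_proj F e x))\<^sup>2 = (\<Sum>i\<in>F. (cmod (cinner x (e i)))\<^sup>2)"
proof -
  have "complex_of_real ((norm (sys_proj F e x))\<^sup>2) = cinner x (sys_proj F e x)"
    by (simp only: cinner_self[symmetric] sys_proj_selfadjoint sys_proj_idem[OF assms])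
  also have "\<dots> = complex_of_real (\<Sum>i\<in>F. (cmod (cinner x (e i)))\<^sup>2)"
    by (simp add: sys_proj_def cinner_sum_right cinner_scaleC_right complex_norm_square mult.commute
        del: of_real_power)
  finally show ?thesis using of_real_eq_iff by blast
qed

lemma sys_proj_orthogonal:
  assumes "orthosys F e" "finite F" "y \<in> cspan (e ` F)"
  shows "cinner (x - sys_proj F e x) y = 0"
proof -
  have "cinner (sys_proj F e x) y = cinner x y"
    by (simp only: sys_proj_selfadjoint sys_proj_id[OF assms])
  then show ?thesis by (simp add: cinner_diff_left)
qed

lemma norm_add_orthogonal:
  assumes "cinner x y = 0"
  shows "(norm (x + y))\<^sup>2 = (norm x)\<^sup>2 + (norm y)\<^sup>2"
proof -
  have "cinner y x = 0" using assms cinner_commute[of y x] by simp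
  then show ?thesis
    using assms unfolding Re_cinner_self[symmetric] by (simp add: cinner_add_left cinner_add_right)
qed

lemma sys_proj_pythagoras:
  assumes "orthosys F e" "finite F"
  shows "(norm x)\<^sup>2 = (norm (x - sys_proj F e x))\<^sup>2 + (norm (sys_proj F e x))\<^sup>2"
  using norm_add_orthogonal[OF sys_proj_orthogonal[OF assms sys_proj_in_span, of x x]] by simp

lemma sys_proj_norm_le:
  assumes "orthosys F e" "finite F"
  shows "norm (sys_proj F e x) \<le> norm x"
proof -
  have "(norm (sys_proj F e x))\<^sup>2 \<le> (norm x)\<^sup>2" using sys_proj_pythagoras[OF assms, of x] by simp
  then show ?thesis by (rule power2_le_imp_le) simp
qed

lemma sys_proj_best_approximation:
  assumes "orthosys F e" "finite F" "y \<in> cspan (e ` F)"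
  shows "norm (x - sys_proj F e x) \<le> norm (x - y)"
proof -
  have "sys_proj F e x - y \<in> cspan (e ` F)"
    by (rule complex_vector.span_diff[OF sys_proj_in_span assms(3)])
  from norm_add_orthogonal[OF sys_proj_orthogonal[OF assms(1,2) this, of x]]
  have "(norm (x - sys_proj F e x))\<^sup>2 \<le> (norm (x - y))\<^sup>2" by simp
  then show ?thesis by (rule power2_le_imp_le) simp
qed

lemma orthosys_bessel:
  assumes "orthosys F e" "finite F"
  shows "(\<Sum>i\<in>F. (cmod (cinner x (e i)))\<^sup>2) \<le> (norm x)\<^sup>2"
  using sys_proj_pythagoras[OF assms, of x] by (simp add: sys_proj_norm[OF assms])

text \<open>The finite partial sums are best approximations. Once \<open>F\<close> contains the
  indices of a combination close to \<open>x\<close>, every larger finite set does at least as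
  well.\<close>

lemma complete_sys_expansion:
  assumes "complete_sys J e"
  shows "((\<lambda>i. cinner x (e i) *\<^sub>C e i) has_sum x) J"
proof -
  have J: "orthosys J e" "x \<in> closure (cspan (e ` J))" using assms by (auto simp: complete_sys_def)
  have "((\<lambda>F. sys_proj F e x) \<longlongrightarrow> x) (finite_subsets_at_top J)"
  proof (rule tendstoI)
    fix \<epsilon> :: real assume "\<epsilon> > 0"
    then obtain y where y: "y \<in> cspan (e ` J)" "dist y x < \<epsilon>"
      using J(2) by (meson closure_approachable)
    then obtain S r where S: "finite S" "S \<subseteq> e ` J" "y = (\<Sum>a\<in>S. r a *\<^sub>C a)"
      by (auto simp: complex_vector.span_explicit)
    then obtain F where F: "finite F" "F \<subseteq> J" "S = e ` F"
      using finite_subset_image[OF S(1,2)] by blast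
    have "dist (sys_proj G e x) x < \<epsilon>" if G: "finite G" "F \<subseteq> G" "G \<subseteq> J" for G
    proof -
      have "y \<in> cspan (e ` G)"
        unfolding S(3) using F(3) G(2)
        by (intro complex_vector.span_sum complex_vector.span_scale complex_vector.span_base) auto
      then have "norm (x - sys_proj G e x) \<le> norm (x - y)"
        by (rule sys_proj_best_approximation[OF orthosys_subset[OF J(1) G(3)] G(1)])
      then show ?thesis using y(2) by (simp add: dist_norm norm_minus_commute)
    qed
    then show "\<forall>\<^sub>F F in finite_subsets_at_top J. dist (sys_proj F e x) x < \<epsilon>"
      using F(1,2) by (auto simp: eventually_finite_subsets_at_top)
  qed
  then show ?thesis by (simp add: has_sum_def sys_proj_def[abs_def])
qed

lemma complete_sys_parseval:
  assumes "complete_sys J e"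
  shows "((\<lambda>i. cinner x (e i) * cinner (e i) y) has_sum cinner x y) J"
  using has_sum_bounded_linear[OF bounded_linear_cinner_left complete_sys_expansion[OF assms]]
  by (simp add: cinner_scaleC_left comp_def)

lemma complete_sys_parseval_norm:
  assumes "complete_sys J e"
  shows "((\<lambda>i. (cmod (cinner x (e i)))\<^sup>2) has_sum (norm x)\<^sup>2) J"
  using has_sum_Re[OF complete_sys_parseval[OF assms, of x x]]
  by (simp add: cinner_mult_commute Re_cinner_self flip: of_real_power)

lemma is_onb_complete_sys: "is_onb B \<Longrightarrow> complete_sys B (\<lambda>x. x)"
  unfolding is_onb_def complete_sys_def orthosys_def by simp

lemma has_sum_finite_sum:
  fixes f :: "'i \<Rightarrow> 'j \<Rightarrow> 'a::{topological_comm_monoid_add}"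
  assumes "\<And>k. k \<in> K \<Longrightarrow> (f k has_sum s k) J"
  shows "((\<lambda>j. \<Sum>k\<in>K. f k j) has_sum (\<Sum>k\<in>K. s k)) J"
  using assms by (induction K rule: infinite_finite_induct) (auto intro: has_sum_add)


section \<open>Bessel families and the trace norm\<close>

text \<open>Weaker than orthonormality, since it has to survive contractions: the images of an
  orthonormal system under a projection or under a factor of the polar decomposition need not be
  orthogonal.\<close>

definition bessel :: "'i set \<Rightarrow> ('i \<Rightarrow> 'a::complex_inner) \<Rightarrow> bool"
  where "bessel I f \<longleftrightarrow> finite I \<and> (\<forall>x. (\<Sum>i\<in>I. (cmod (cinner x (f i)))\<^sup>2) \<le> (norm x)\<^sup>2)"

lemma orthosys_imp_bessel: "orthosys F e \<Longrightarrow> finite F \<Longrightarrow> bessel F e"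
  by (simp add: bessel_def orthosys_bessel)

lemma bessel_contraction:
  assumes f: "bessel I f" and adj: "\<And>x y. cinner (W x) y = cinner x (W' y)"
    and le: "\<And>x. norm (W' x) \<le> norm x"
  shows "bessel I (\<lambda>i. W (f i))"
  unfolding bessel_def
proof (intro conjI allI)
  show "finite I" using f by (simp add: bessel_def)
  fix x
  have "cmod (cinner x (W (f i))) = cmod (cinner (W' x) (f i))" for i
    by (metis adj cmod_cinner_commute)
  then have "(\<Sum>i\<in>I. (cmod (cinner x (W (f i))))\<^sup>2) \<le> (norm (W' x))\<^sup>2"
    using f by (simp add: bessel_def)
  also have "\<dots> \<le> (norm x)\<^sup>2" using le by (simp add: power_mono)
  finally show "(\<Sum>i\<in>I. (cmod (cinner x (W (f i))))\<^sup>2) \<le> (norm x)\<^sup>2" .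
qed

text \<open>Comparison of Hilbert-Schmidt norms: expand each \<open>S (f i)\<close> by Parseval in
  the basis \<open>e\<close>, exchange the sums, and apply the Bessel inequality of \<open>f\<close>
  to the vectors \<open>S' (e j)\<close>.\<close>

lemma bessel_sum_norm_le:
  assumes adj: "\<And>x y. cinner (S x) y = cinner x (S' y)" and e: "complete_sys J e"
    and le: "\<And>F. finite F \<Longrightarrow> F \<subseteq> J \<Longrightarrow> (\<Sum>j\<in>F. (norm (S' (e j)))\<^sup>2) \<le> t"
    and f: "bessel I f"
  shows "(\<Sum>i\<in>I. (norm (S (f i)))\<^sup>2) \<le> t"
proof (rule has_sum_le_finite_sums)
  show "((\<lambda>j. \<Sum>i\<in>I. (cmod (cinner (S (f i)) (e j)))\<^sup>2) has_sum (\<Sum>i\<in>I. (norm (S (f i)))\<^sup>2)) J"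
    by (intro has_sum_finite_sum complete_sys_parseval_norm[OF e])
  fix F assume F: "finite F" "F \<subseteq> J"
  have "(\<Sum>j\<in>F. \<Sum>i\<in>I. (cmod (cinner (S (f i)) (e j)))\<^sup>2) \<le> (\<Sum>j\<in>F. (norm (S' (e j)))\<^sup>2)"
  proof (rule sum_mono)
    fix j
    have "cmod (cinner (S (f i)) (e j)) = cmod (cinner (S' (e j)) (f i))" for i
      by (metis adj cmod_cinner_commute)
    then show "(\<Sum>i\<in>I. (cmod (cinner (S (f i)) (e j)))\<^sup>2) \<le> (norm (S' (e j)))\<^sup>2"
      using f by (simp add: bessel_def)
  qed
  also have "\<dots> \<le> t" by (rule le[OF F])
  finally show "(\<Sum>j\<in>F. \<Sum>i\<in>I. (cmod (cinner (S (f i)) (e j)))\<^sup>2) \<le> t" .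
qed

lemma psd_sqrt_form:
  assumes "psd S" "\<And>x. S (S x) = A x"
  shows "Re (cinner (A x) x) = (norm (S x))\<^sup>2"
  using psdD(2)[OF assms(1), of "S x" x] by (simp add: assms(2) Re_cinner_self)

text \<open>With the root \<open>S\<close> of \<open>A\<close> the form is the squared norm of
  \<open>S x\<close>, so a trace bound in one basis is a Hilbert-Schmidt bound for \<open>S\<close>,
  and this carries over to every Bessel family.\<close>

lemma psd_trace_le:
  fixes A :: "'a::chilbert_space \<Rightarrow> 'a"
  assumes A: "psd A" and e: "complete_sys J e"
    and le: "\<And>F. finite F \<Longrightarrow> F \<subseteq> J \<Longrightarrow> (\<Sum>j\<in>F. Re (cinner (A (e j)) (e j))) \<le> t"
    and f: "bessel I f"
  shows "(\<Sum>i\<in>I. Re (cinner (A (f i)) (f i))) \<le> t"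
proof -
  obtain S where S: "psd S" "\<And>x. S (S x) = A x" using psd_sqrt_exists[OF A] by metis
  show ?thesis
    using bessel_sum_norm_le[OF psdD(2)[OF S(1)] e _ f, of t] le
    by (simp add: psd_sqrt_form[OF S])
qed

text \<open>A bounded operator is trace class iff it has such a bound; the least one is its trace norm.\<close>

definition trace_bound :: "('a::complex_inner \<Rightarrow> 'a) \<Rightarrow> real \<Rightarrow> bool"
  where "trace_bound A M \<longleftrightarrow> (\<forall>(I :: nat set) f g. bessel I f \<longrightarrow> bessel I g \<longrightarrow>
    (\<Sum>i\<in>I. cmod (cinner (A (f i)) (g i))) \<le> M)"

text \<open>A definition cannot quantify over index types, hence the \<open>nat set\<close> in
  \<open>trace_bound\<close>; a finite family over any other type is reindexed.\<close>

lemma trace_boundD: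
  assumes A: "trace_bound A M" and f: "bessel I f" and g: "bessel I g"
  shows "(\<Sum>i\<in>I. cmod (cinner (A (f i)) (g i))) \<le> M"
proof -
  have "finite I" using f by (simp add: bessel_def)
  then obtain h where h: "bij_betw h {0..<card I} I"
    using ex_bij_betw_nat_finite by blast
  have tr: "bessel {0..<card I} (\<lambda>i. u (h i))" if "bessel I u" for u :: "_ \<Rightarrow> 'a"
    using that by (simp add: bessel_def sum.reindex_bij_betw[OF h, of "\<lambda>i. (cmod (cinner _ (u i)))\<^sup>2"])
  show ?thesis
    using A tr[OF f] tr[OF g] sum.reindex_bij_betw[OF h, of "\<lambda>i. cmod (cinner (A (f i)) (g i))"]
    unfolding trace_bound_def by metis
qed

lemma trace_bound_nonneg: "trace_bound A M \<Longrightarrow> 0 \<le> M"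
  using trace_boundD[of A M "{}" "\<lambda>_. 0" "\<lambda>_. 0"] by (simp add: bessel_def)

lemma trace_bound_cinner:
  assumes A: "bounded_clinear A" and M: "trace_bound A M"
  shows "cmod (cinner (A x) y) \<le> M * norm x * norm y"
proof (cases "x = 0 \<or> y = 0")
  case True
  then show ?thesis using bounded_clinear_zero[OF A] by auto
next
  case False
  have *: "bessel {0::nat} (\<lambda>_. (1 / norm z) *\<^sub>R z)" if "z \<noteq> 0" for z :: 'a
    by (rule orthosys_imp_bessel) (use that in \<open>simp_all add: orthosys_def\<close>)
  have "cmod (cinner (A ((1 / norm x) *\<^sub>R x)) ((1 / norm y) *\<^sub>R y)) \<le> M"
    using trace_boundD[OF M *[of x] *[of y]] False by simp
  then show ?thesis using False
    by (simp add: bounded_clinear_scaleR[OF A] cinner_scaleR_left cinner_scaleR_right norm_divide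
        norm_mult field_simps)
qed

lemma trace_bound_add:
  assumes "trace_bound A M" "trace_bound B N"
  shows "trace_bound (\<lambda>x. A x + B x) (M + N)"
  unfolding trace_bound_def
proof (intro allI impI)
  fix I :: "nat set" and f g :: "nat \<Rightarrow> 'a" assume fg: "bessel I f" "bessel I g"
  have "(\<Sum>i\<in>I. cmod (cinner (A (f i) + B (f i)) (g i))) \<le>
      (\<Sum>i\<in>I. cmod (cinner (A (f i)) (g i)) + cmod (cinner (B (f i)) (g i)))"
    unfolding cinner_add_left by (intro sum_mono norm_triangle_ineq)
  also have "\<dots> \<le> M + N"
    unfolding sum.distrib by (intro add_mono trace_boundD[OF _ fg] assms)
  finally show "(\<Sum>i\<in>I. cmod (cinner (A (f i) + B (f i)) (g i))) \<le> M + N" .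
qed

lemma trace_bound_scaleC:
  "trace_bound A M \<Longrightarrow> trace_bound (\<lambda>x. c *\<^sub>C A x) (cmod c * M)"
  by (auto simp: trace_bound_def cinner_scaleC_left norm_mult sum_distrib_left[symmetric]
      intro: mult_left_mono)

lemma trace_bound_0: "trace_bound (\<lambda>x. 0) 0"
  by (simp add: trace_bound_def)

lemma trace_bound_sum:
  "(\<And>k. k \<in> K \<Longrightarrow> trace_bound (A k) (M k)) \<Longrightarrow>
    trace_bound (\<lambda>x. \<Sum>k\<in>K. A k x) (\<Sum>k\<in>K. M k)"
  by (induction K rule: infinite_finite_induct) (auto intro: trace_bound_add trace_bound_0)

lemma trace_bound_rank1: "trace_bound (rank1 x y) (norm x * norm y)"
  unfolding trace_bound_def
proof (intro allI impI)
  fix I :: "nat set" and f g :: "nat \<Rightarrow> 'a" assume fg: "bessel I f" "bessel I g"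
  have "(\<Sum>i\<in>I. cmod (cinner (rank1 x y (f i)) (g i))) =
      (\<Sum>i\<in>I. \<bar>cmod (cinner x (g i))\<bar> * \<bar>cmod (cinner y (f i))\<bar>)"
    by (simp add: rank1_def cinner_scaleC_left norm_mult cmod_cinner_commute[of "f _" y] mult.commute)
  also have "\<dots> \<le> L2_set (\<lambda>i. cmod (cinner x (g i))) I * L2_set (\<lambda>i. cmod (cinner y (f i))) I"
    by (rule L2_set_mult_ineq)
  also have "\<dots> \<le> norm x * norm y"
    using fg by (intro mult_mono) (auto simp: L2_set_def bessel_def intro!: real_le_lsqrt sum_nonneg)
  finally show "(\<Sum>i\<in>I. cmod (cinner (rank1 x y (f i)) (g i))) \<le> norm x * norm y" .
qed

text \<open>Writing \<open>A\<close> as \<open>W\<close> after \<open>S\<close> after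
  \<open>S\<close>, with \<open>S\<close> the root of \<open>abs_op A\<close>, turns the summand
  into the inner product of \<open>S (f i)\<close> and \<open>S (W' (g i))\<close>. The
  arithmetic-geometric mean inequality splits it into two Hilbert-Schmidt sums, each at most
  \<open>t\<close>.\<close>

lemma trace_bound_abs_op:
  fixes A :: "'a::chilbert_space \<Rightarrow> 'a"
  assumes A: "bounded_clinear A" and e: "complete_sys J e"
    and le: "\<And>F. finite F \<Longrightarrow> F \<subseteq> J \<Longrightarrow> (\<Sum>j\<in>F. Re (cinner (abs_op A (e j)) (e j))) \<le> t"
  shows "trace_bound A t"
  unfolding trace_bound_def
proof (intro allI impI)
  fix I :: "nat set" and f g :: "nat \<Rightarrow> 'a" assume f: "bessel I f" and g: "bessel I g"
  obtain W W' where W: "\<And>x y. cinner (W x) y = cinner x (W' y)" "\<And>x. norm (W x) \<le> norm x"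
    "\<And>x. A x = W (abs_op A x)"
    using polar_decomposition[OF A] by metis
  obtain S where S: "psd S" "\<And>x. S (S x) = abs_op A x"
    using psd_sqrt_exists[OF abs_op(1)[OF A]] by metis
  have g': "bessel I (\<lambda>i. W' (g i))"
  proof (rule bessel_contraction[OF g _ W(2)])
    show "cinner (W' x) y = cinner x (W y)" for x y
      using W(1)[of y x] cinner_commute[of "W' x" y] cinner_commute[of x "W y"] by simp
  qed
  have *: "(\<Sum>i\<in>I. (norm (S (h i)))\<^sup>2) \<le> t" if "bessel I h" for h
    using bessel_sum_norm_le[OF psdD(2)[OF S(1)] e _ that, of t] le
    by (simp add: psd_sqrt_form[OF S])
  have "(\<Sum>i\<in>I. cmod (cinner (A (f i)) (g i))) \<le>
      (\<Sum>i\<in>I. ((norm (S (f i)))\<^sup>2 + (norm (S (W' (g i))))\<^sup>2) / 2)"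
  proof (rule sum_mono)
    fix i
    have "cmod (cinner (A (f i)) (g i)) = cmod (cinner (S (f i)) (S (W' (g i))))"
      by (simp add: W(3) W(1) S(2)[symmetric] psdD(2)[OF S(1)])
    also have "\<dots> \<le> norm (S (f i)) * norm (S (W' (g i)))" by (rule Cauchy_Schwarz_cinner)
    also have "\<dots> \<le> ((norm (S (f i)))\<^sup>2 + (norm (S (W' (g i))))\<^sup>2) / 2"
      using sum_squares_bound[of "norm (S (f i))" "norm (S (W' (g i)))"] by simp
    finally show "cmod (cinner (A (f i)) (g i)) \<le> ((norm (S (f i)))\<^sup>2 + (norm (S (W' (g i))))\<^sup>2) / 2" .
  qed
  also have "\<dots> \<le> t"
    using *[OF f] *[OF g'] by (simp add: sum.distrib flip: sum_divide_distrib)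
  finally show "(\<Sum>i\<in>I. cmod (cinner (A (f i)) (g i))) \<le> t" .
qed

text \<open>Since \<open>abs_op A\<close> is \<open>W'\<close> after \<open>A\<close>, its diagonal
  entry at \<open>e j\<close> is the inner product of \<open>A (e j)\<close> with
  \<open>W (e j)\<close>, and the vectors \<open>W (e j)\<close> again form a Bessel family.\<close>

lemma abs_op_trace_le:
  fixes A :: "'a::chilbert_space \<Rightarrow> 'a"
  assumes A: "bounded_clinear A" and M: "trace_bound A M" and F: "orthosys F e" "finite F"
  shows "(\<Sum>j\<in>F. Re (cinner (abs_op A (e j)) (e j))) \<le> M"
proof -
  obtain W W' where W: "\<And>x y. cinner (W x) y = cinner x (W' y)" "\<And>x. norm (W' x) \<le> norm x"
    "\<And>x. abs_op A x = W' (A x)"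
    using polar_decomposition[OF A] by metis
  have W': "cinner (W' x) y = cinner x (W y)" for x y
    using W(1)[of y x] cinner_commute[of "W' x" y] cinner_commute[of x "W y"] by simp
  note b = orthosys_imp_bessel[OF F]
  have "(\<Sum>j\<in>F. Re (cinner (abs_op A (e j)) (e j))) \<le> (\<Sum>j\<in>F. cmod (cinner (A (e j)) (W (e j))))"
    unfolding W(3) W' by (intro sum_mono complex_Re_le_cmod)
  also have "\<dots> \<le> M" by (rule trace_boundD[OF M b bessel_contraction[OF b W(1,2)]])
  finally show ?thesis .
qed

lemma psd_form_summable:
  fixes A :: "'a::chilbert_space \<Rightarrow> 'a"
  assumes A: "psd A"
    and le: "\<And>F. finite F \<Longrightarrow> F \<subseteq> B \<Longrightarrow> (\<Sum>e\<in>F. Re (cinner (A e) e)) \<le> t"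
  shows "(\<lambda>e. cinner (A e) e) summable_on B" "Re (\<Sum>\<^sub>\<infinity>e\<in>B. cinner (A e) e) \<le> t"
proof -
  have "(\<lambda>e. Re (cinner (A e) e)) summable_on B"
    using psdD(3)[OF A] le by (intro nonneg_bdd_above_summable_on) (auto intro!: bdd_aboveI[of _ t])
  from has_sum_of_real[OF has_sum_infsum[OF this], where 'a = complex]
  have hs: "((\<lambda>e. cinner (A e) e) has_sum (of_real (\<Sum>\<^sub>\<infinity>e\<in>B. Re (cinner (A e) e)))) B"
    by (simp flip: selfadjoint_cinner_real[of A, OF psdD(2)[OF A]])
  then show "(\<lambda>e. cinner (A e) e) summable_on B" by (rule has_sum_imp_summable)
  from has_sum_le_finite_sums[OF has_sum_Re[OF hs] le]
  show "Re (\<Sum>\<^sub>\<infinity>e\<in>B. cinner (A e) e) \<le> t"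
    by (simp add: infsumI[OF hs])
qed

lemma psd_sum_le_infsum:
  assumes A: "psd A" and s: "(\<lambda>e. cinner (A e) e) summable_on B" and F: "finite F" "F \<subseteq> B"
  shows "(\<Sum>e\<in>F. Re (cinner (A e) e)) \<le> Re (\<Sum>\<^sub>\<infinity>e\<in>B. cinner (A e) e)"
  using finite_sum_le_has_sum[OF has_sum_Re[OF has_sum_infsum[OF s]] F(1) F(2)] psdD(3)[OF A]
  by blast

text \<open>The right hand side involves neither a basis nor \<open>abs_op\<close>, which is not
  additive; closure of the trace class under sums becomes immediate.\<close>

lemma trace_class_iff:
  fixes A :: "'a::chilbert_space \<Rightarrow> 'a"
  shows "trace_class A \<longleftrightarrow> bounded_clinear A \<and> (\<exists>M. trace_bound A M)"
proof
  assume "trace_class A"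
  then obtain B where A: "bounded_clinear A" and B: "is_onb B"
    and s: "(\<lambda>e. cinner (abs_op A e) e) summable_on B"
    by (auto simp: trace_class_def)
  have "trace_bound A (Re (\<Sum>\<^sub>\<infinity>e\<in>B. cinner (abs_op A e) e))"
    by (intro trace_bound_abs_op[OF A is_onb_complete_sys[OF B]]
        psd_sum_le_infsum[OF abs_op(1)[OF A] s])
  then show "bounded_clinear A \<and> (\<exists>M. trace_bound A M)" using A by blast
next
  assume "bounded_clinear A \<and> (\<exists>M. trace_bound A M)"
  then obtain M where A: "bounded_clinear A" and M: "trace_bound A M" by blast
  obtain B :: "'a set" where B: "is_onb B" using onb_exists by blast
  have "orthosys B (\<lambda>x. x)" using is_onb_complete_sys[OF B] by (simp add: complete_sys_def)
  then have "(\<Sum>e\<in>F. Re (cinner (abs_op A e) e)) \<le> M" if "finite F" "F \<subseteq> B" for F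
    using abs_op_trace_le[OF A M orthosys_subset] that by blast
  then have "(\<lambda>e. cinner (abs_op A e) e) summable_on B"
    by (intro psd_form_summable(1)[OF abs_op(1)[OF A]])
  then show "trace_class A" using A B by (auto simp: trace_class_def)
qed

lemma trace_class_bounded_clinear_op: "trace_class A \<Longrightarrow> bounded_clinear A"
  by (simp add: trace_class_def)

lemma trace_norm_le:
  fixes A :: "'a::chilbert_space \<Rightarrow> 'a"
  assumes A: "bounded_clinear A" and M: "trace_bound A M"
  shows "trace_norm A \<le> M"
  unfolding trace_norm_def ctrace_def
proof (rule psd_form_summable(2)[OF abs_op(1)[OF A]])
  fix F :: "'a set" assume F: "finite F" "F \<subseteq> (SOME B. is_onb B)"
  have "orthosys F (\<lambda>x. x)"
    using is_onb_complete_sys[OF is_onb_some] orthosys_subset[OF _ F(2)]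
    unfolding complete_sys_def by blast
  then show "(\<Sum>e\<in>F. Re (cinner (abs_op A e) e)) \<le> M"
    using abs_op_trace_le[OF A M _ F(1)] by blast
qed

lemma trace_bound_trace_norm:
  fixes A :: "'a::chilbert_space \<Rightarrow> 'a"
  assumes "trace_class A"
  shows "trace_bound A (trace_norm A)"
proof -
  from assms obtain M where A: "bounded_clinear A" and M: "trace_bound A M"
    using trace_class_iff by blast
  note onb = is_onb_complete_sys[OF is_onb_some]
  have "(\<lambda>e. cinner (abs_op A e) e) summable_on (SOME B. is_onb B)"
  proof (rule psd_form_summable(1)[OF abs_op(1)[OF A]])
    fix F :: "'a set" assume F: "finite F" "F \<subseteq> (SOME B. is_onb B)"
    have "orthosys F (\<lambda>x. x)"
      using onb orthosys_subset[OF _ F(2)] unfolding complete_sys_def by blast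
    then show "(\<Sum>e\<in>F. Re (cinner (abs_op A e) e)) \<le> M"
      using abs_op_trace_le[OF A M _ F(1)] by blast
  qed
  then show ?thesis
    unfolding trace_norm_def ctrace_def
    by (intro trace_bound_abs_op[OF A onb] psd_sum_le_infsum[OF abs_op(1)[OF A]])
qed

lemma psd_ctrace_bessel_le:
  fixes A :: "'a::chilbert_space \<Rightarrow> 'a"
  assumes A: "psd A" "trace_class A" and f: "bessel I f"
  shows "(\<Sum>i\<in>I. Re (cinner (A (f i)) (f i))) \<le> Re (ctrace A)"
proof -
  have "(\<Sum>i\<in>I. Re (cinner (A (f i)) (f i))) \<le> (\<Sum>i\<in>I. cmod (cinner (A (f i)) (f i)))"
    by (intro sum_mono complex_Re_le_cmod)
  also have "\<dots> \<le> trace_norm A" by (rule trace_boundD[OF trace_bound_trace_norm[OF A(2)] f f])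
  finally show ?thesis by (simp add: trace_norm_def abs_op_psd[OF A(1)])
qed

section \<open>Finite rank operators\<close>

definition finite_rank :: "'k set \<Rightarrow> ('k \<Rightarrow> 'a::complex_inner) \<Rightarrow> ('k \<Rightarrow> 'a) \<Rightarrow> 'a \<Rightarrow> 'a"
  where "finite_rank K x y z = (\<Sum>k\<in>K. rank1 (x k) (y k) z)"

lemma trace_class_rank1: "trace_class (rank1 x (y :: 'a::chilbert_space))"
  using trace_class_iff bounded_clinear_rank1 trace_bound_rank1 by blast

lemma trace_class_finite_rank: "trace_class (finite_rank K x (y :: _ \<Rightarrow> 'a::chilbert_space))"
proof -
  have "trace_bound (\<lambda>z. \<Sum>k\<in>K. rank1 (x k) (y k) z) (\<Sum>k\<in>K. norm (x k) * norm (y k))"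
    by (intro trace_bound_sum) (rule trace_bound_rank1)
  then show ?thesis
    unfolding trace_class_iff finite_rank_def[abs_def]
    by (intro conjI exI bounded_clinear_sum_fun) (rule bounded_clinear_rank1)
qed

text \<open>Parseval holds in every orthonormal basis, so the value does not depend on the one that
  \<open>SOME\<close> picks.\<close>

lemma ctrace_finite_rank:
  fixes x :: "'k \<Rightarrow> 'a::chilbert_space"
  shows "ctrace (finite_rank K x y) = (\<Sum>k\<in>K. cinner (x k) (y k))"
  unfolding ctrace_def
proof (rule infsumI)
  let ?B = "SOME B :: 'a set. is_onb B"
  have "((\<lambda>e. \<Sum>k\<in>K. cinner (x k) e * cinner e (y k)) has_sum (\<Sum>k\<in>K. cinner (x k) (y k))) ?B"
    by (intro has_sum_finite_sum complete_sys_parseval is_onb_complete_sys is_onb_some)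
  then show "((\<lambda>e. cinner (finite_rank K x y e) e) has_sum (\<Sum>k\<in>K. cinner (x k) (y k))) ?B"
    by (simp add: finite_rank_def rank1_def cinner_sum_left cinner_scaleC_left mult.commute)
qed

section \<open>Tensor products and partial traces\<close>

lemma hilbert_tensor_flip:
  assumes "hilbert_tensor T"
  shows "hilbert_tensor (\<lambda>y x. T x y)"
proof -
  have "{T x y |y x. True} = {T x y |x y. True}" by blast
  with assms show ?thesis unfolding hilbert_tensor_def by (simp add: mult.commute)
qed

context
  fixes T :: "'a::chilbert_space \<Rightarrow> 'b::chilbert_space \<Rightarrow> 'c::chilbert_space"
  assumes T: "hilbert_tensor T"
begin

lemma tensor_add_left: "T (x + x') y = T x y + T x' y"
  and tensor_add_right: "T x (y + y') = T x y + T x y'"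
  and tensor_scaleC_left: "T (c *\<^sub>C x) y = c *\<^sub>C T x y"
  and tensor_scaleC_right: "T x (c *\<^sub>C y) = c *\<^sub>C T x y"
  and cinner_tensor: "cinner (T x y) (T u v) = cinner x u * cinner y v"
  and tensor_dense: "closure (cspan {T x y |x y. True}) = UNIV"
  using T by (auto simp: hilbert_tensor_def)

lemma norm_tensor: "norm (T x y) = norm x * norm y"
proof -
  have "complex_of_real ((norm (T x y))\<^sup>2) = complex_of_real ((norm x * norm y)\<^sup>2)"
    unfolding cinner_self[symmetric] cinner_tensor by (simp add: cinner_self power_mult_distrib)
  then have "(norm (T x y))\<^sup>2 = (norm x * norm y)\<^sup>2" using of_real_eq_iff by blast
  then show ?thesis by simp
qed

lemma bounded_clinear_tensor_right: "bounded_clinear (T x)"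
  by (rule bounded_clinearI[of _ "norm x"])
    (auto simp: tensor_add_right tensor_scaleC_right norm_tensor)

lemma bounded_clinear_tensor_left: "bounded_clinear (\<lambda>x. T x y)"
  by (rule bounded_clinearI[of _ "norm y"])
    (auto simp: tensor_add_left tensor_scaleC_left norm_tensor)

lemma tensor_zero [simp]: "T 0 y = 0" "T x 0 = 0"
  using norm_tensor[of 0 y] norm_tensor[of x 0] by auto

text \<open>\<open>L u\<close> is the vector \<open>z\<close> contracted with \<open>u\<close> in
  the first factor, that is, the adjoint of \<open>T u\<close> at \<open>z\<close>.\<close>

lemma ex_slice_right: "\<exists>L. \<forall>u y. cinner (T u y) z = cinner y (L u)"
proof (intro choice allI)
  show "\<exists>L. \<forall>y. cinner (T u y) z = cinner y L" for u
    by (rule adjoint_exists[OF bounded_clinear_tensor_right[of u]]) blast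
qed

lemma ex_slice_left: "\<exists>R. \<forall>u y. cinner (T u y) z = cinner u (R y)"
proof -
  have "\<exists>R. \<forall>y u. cinner (T u y) z = cinner u (R y)"
  proof (intro choice allI)
    show "\<exists>R. \<forall>u. cinner (T u y) z = cinner u R" for y
      by (rule adjoint_exists[OF bounded_clinear_tensor_left[of y]]) blast
  qed
  then show ?thesis by blast
qed

lemma orthosys_tensor:
  assumes a: "orthosys I a" and b: "orthosys J b"
  shows "orthosys (I \<times> J) (\<lambda>(i, j). T (a i) (b j))"
  unfolding orthosys_def
proof (intro conjI ballI impI)
  fix p assume "p \<in> I \<times> J"
  then show "norm (case p of (i, j) \<Rightarrow> T (a i) (b j)) = 1 \<or> (case p of (i, j) \<Rightarrow> T (a i) (b j)) = 0"
    using a b by (cases p) (force simp: orthosys_def norm_tensor)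
next
  fix p q assume "p \<in> I \<times> J" "q \<in> I \<times> J" "p \<noteq> q"
  then show "cinner (case p of (i, j) \<Rightarrow> T (a i) (b j)) (case q of (i, j) \<Rightarrow> T (a i) (b j)) = 0"
    using a b by (cases p; cases q) (auto simp: orthosys_def cinner_tensor)
qed

text \<open>Let \<open>x\<close> be orthogonal to all product vectors. Its slice at each
  \<open>a i\<close> is orthogonal to all \<open>b j\<close>, hence zero; so each slice at a vector
  \<open>y\<close> of the second factor is orthogonal to all \<open>a i\<close>, hence zero too, and
  \<open>x\<close> is orthogonal to every elementary tensor.\<close>

lemma complete_sys_tensor:
  assumes a: "complete_sys I a" and b: "complete_sys J b"
  shows "complete_sys (I \<times> J) (\<lambda>(i, j). T (a i) (b j))"
proof -
  let ?t = "\<lambda>(i, j). T (a i) (b j)"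
  have "x = 0" if x: "\<And>y. y \<in> ?t ` (I \<times> J) \<Longrightarrow> cinner x y = 0" for x
  proof (rule orthogonal_dense_eq_0[OF tensor_dense])
    obtain L where L: "\<And>u y. cinner (T u y) x = cinner y (L u)"
      using ex_slice_right by blast
    obtain R where R: "\<And>u y. cinner (T u y) x = cinner u (R y)"
      using ex_slice_left by blast
    have *: "cinner (T (a i) (b j)) x = 0" if "i \<in> I" "j \<in> J" for i j
      using x[of "T (a i) (b j)"] that cinner_commute[of "T (a i) (b j)" x] by force
    have L0: "L (a i) = 0" if "i \<in> I" for i
    proof (rule orthogonal_dense_eq_0)
      show "closure (cspan (b ` J)) = UNIV" using b by (simp add: complete_sys_def)
      show "cinner (L (a i)) y = 0" if "y \<in> b ` J" for y
        using * \<open>i \<in> I\<close> that L[of "a i" y] cinner_commute[of "L (a i)" y] by auto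
    qed
    have "R y = 0" for y
    proof (rule orthogonal_dense_eq_0)
      show "closure (cspan (a ` I)) = UNIV" using a by (simp add: complete_sys_def)
      show "cinner (R y) u = 0" if "u \<in> a ` I" for u
        using that L0 L[of u y] R[of u y] cinner_commute[of "R y" u] by auto
    qed
    then show "cinner x z = 0" if "z \<in> {T u y |u y. True}" for z
      using that R cinner_commute[of x z] by auto
  qed
  then show ?thesis
    using a b orthosys_tensor[of I a J b] dense_if_orthogonal_trivial[of "?t ` (I \<times> J)"]
    unfolding complete_sys_def by blast
qed

text \<open>Contracting \<open>z\<close> with the \<open>a i\<close> yields slices whose squared
  norms add up to at most that of \<open>z\<close>; within each slice the Bessel inequality of
  \<open>f\<close> applies.\<close>

lemma bessel_tensor:
  assumes a: "orthosys I a" "finite I" and f: "bessel K f"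
  shows "bessel (I \<times> K) (\<lambda>(i, k). T (a i) (f k))"
  unfolding bessel_def
proof (intro conjI allI)
  show "finite (I \<times> K)" using a(2) f by (simp add: bessel_def)
  fix z :: 'c
  obtain s where s: "\<And>x y. cinner (T x y) z = cinner y (s x)"
    using ex_slice_right by blast
  define q where "q = (\<Sum>i\<in>I. (norm (s (a i)))\<^sup>2)"
  \<comment> \<open>The component of \<open>z\<close> in the span of the \<open>a i\<close> tensored
    with the second factor. Its inner product with \<open>z\<close> is \<open>q\<close> and its
    squared norm at most \<open>q\<close>, so Cauchy-Schwarz bounds \<open>q\<close> by the squared
    norm of \<open>z\<close>.\<close>
  define w where "w = (\<Sum>i\<in>I. T (a i) (s (a i)))"
  have "(\<Sum>p\<in>I\<times>K. (cmod (cinner z (case p of (i, k) \<Rightarrow> T (a i) (f k))))\<^sup>2) =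
      (\<Sum>i\<in>I. \<Sum>k\<in>K. (cmod (cinner (s (a i)) (f k)))\<^sup>2)"
    unfolding sum.cartesian_product
    by (intro sum.cong) (auto simp: cmod_cinner_commute[of z] s cmod_cinner_commute[of "f _"])
  also have "\<dots> \<le> q" unfolding q_def using f by (intro sum_mono) (simp add: bessel_def)
  also have "q \<le> (norm z)\<^sup>2"
  proof (cases "q = 0")
    case False
    have q0: "q \<ge> 0" by (simp add: q_def sum_nonneg)
    have "cinner w z = complex_of_real q"
      by (simp add: w_def q_def cinner_sum_left s cinner_self)
    then have "q = cmod (cinner w z)" using q0 by simp
    then have "q\<^sup>2 \<le> (norm w * norm z)\<^sup>2"
      using Cauchy_Schwarz_cinner[of w z] q0 by (simp add: power_mono)
    also have "\<dots> = (norm w)\<^sup>2 * (norm z)\<^sup>2" by (simp add: power_mult_distrib)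
    also have "(norm w)\<^sup>2 \<le> q"
    proof -
      have "cinner w w = (\<Sum>i\<in>I. \<Sum>j\<in>I. cinner (a j) (a i) * cinner (s (a j)) (s (a i)))"
        by (simp add: w_def cinner_sum_left cinner_sum_right cinner_tensor)
      also have "\<dots> = (\<Sum>i\<in>I. cinner (a i) (a i) * cinner (s (a i)) (s (a i)))"
      proof (rule sum.cong[OF refl])
        fix i assume i: "i \<in> I"
        have "(\<Sum>j\<in>I. cinner (a j) (a i) * cinner (s (a j)) (s (a i))) =
            (\<Sum>j\<in>I. if j = i then cinner (a i) (a i) * cinner (s (a i)) (s (a i)) else 0)"
          using a(1) i by (intro sum.cong) (auto simp: orthosys_def)
        then show "(\<Sum>j\<in>I. cinner (a j) (a i) * cinner (s (a j)) (s (a i))) =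
            cinner (a i) (a i) * cinner (s (a i)) (s (a i))"
          using i a(2) by simp
      qed
      also have "\<dots> = complex_of_real (\<Sum>i\<in>I. (norm (a i))\<^sup>2 * (norm (s (a i)))\<^sup>2)"
        by (simp add: cinner_self)
      finally have "(norm w)\<^sup>2 = (\<Sum>i\<in>I. (norm (a i))\<^sup>2 * (norm (s (a i)))\<^sup>2)"
        by (metis Re_cinner_self Re_complex_of_real)
      also have "\<dots> \<le> (\<Sum>i\<in>I. 1 * (norm (s (a i)))\<^sup>2)"
        using a(1) by (intro sum_mono mult_right_mono) (auto simp: orthosys_def)
      finally show ?thesis by (simp add: q_def)
    qed
    finally have "q * q \<le> q * (norm z)\<^sup>2" by (simp add: power2_eq_square mult_right_mono)
    then show ?thesis using q0 False by simp
  qed simp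
  finally show "(\<Sum>p\<in>I\<times>K. (cmod (cinner z (case p of (i, k) \<Rightarrow> T (a i) (f k))))\<^sup>2) \<le> (norm z)\<^sup>2" .
qed

section \<open>Existence of partial traces\<close>

lemma partial_form_bound:
  assumes A: "bounded_clinear A" "trace_bound A M" and a: "orthosys I a" "finite I"
  shows "(\<Sum>i\<in>I. cmod (cinner (A (T (a i) y)) (T (a i) v))) \<le> M * norm y * norm v"
proof (cases "y = 0 \<or> v = 0")
  case True
  then show ?thesis using bounded_clinear_zero[OF A(1)] by auto
next
  case False
  have *: "bessel I (\<lambda>i. T (a i) ((1 / norm z) *\<^sub>R z))" if "z \<noteq> 0" for z
  proof (intro orthosys_imp_bessel a(2))
    have "norm ((1 / norm z) *\<^sub>R z) = 1" using that by simp
    then show "orthosys I (\<lambda>i. T (a i) ((1 / norm z) *\<^sub>R z))"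
      using a(1) by (auto simp: orthosys_def norm_tensor cinner_tensor simp del: norm_scaleR)
  qed
  have R: "T x (r *\<^sub>R z) = r *\<^sub>R T x z" for x r z
    by (rule bounded_clinear_scaleR[OF bounded_clinear_tensor_right])
  have "(\<Sum>i\<in>I. cmod (cinner (A (T (a i) ((1 / norm y) *\<^sub>R y))) (T (a i) ((1 / norm v) *\<^sub>R v)))) \<le> M"
    using False by (intro trace_boundD[OF A(2)] *) auto
  then have "(\<Sum>i\<in>I. cmod (cinner (A (T (a i) y)) (T (a i) v))) / (norm y * norm v) \<le> M"
    by (simp add: R bounded_clinear_scaleR[OF A(1)] cinner_scaleR_left cinner_scaleR_right norm_mult
        norm_divide sum_divide_distrib divide_divide_eq_left mult.commute)
  then show ?thesis using False by (simp add: field_simps)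
qed

text \<open>Summing the diagonal blocks of \<open>A\<close> along \<open>B\<close> gives a bounded
  form. Each trace bound of \<open>A\<close> is inherited, because tensoring a Bessel family with a
  finite part of \<open>B\<close> gives a Bessel family again; this yields the trace class property
  and contractivity in trace norm together.\<close>

lemma partial_trace_exists:
  assumes A: "trace_class A" and B: "is_onb B"
  obtains D where "bounded_clinear D"
    "\<And>y v. ((\<lambda>a. cinner (A (T a y)) (T a v)) has_sum cinner (D y) v) B"
    "\<And>M. trace_bound A M \<Longrightarrow> trace_bound D M"
proof -
  let ?g = "\<lambda>y v a. cinner (A (T a y)) (T a v)"
  have lin: "bounded_clinear A" using A by (rule trace_class_bounded_clinear_op)
  obtain M0 where M0: "trace_bound A M0" using A trace_class_iff by blast
  have orth: "orthosys F (\<lambda>x. x)" if "F \<subseteq> B" for F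
    using is_onb_complete_sys[OF B] orthosys_subset[OF _ that] unfolding complete_sys_def by blast
  have abs_s: "(\<lambda>a. cmod (?g y v a)) summable_on B" for y v
    using partial_form_bound[OF lin M0 orth]
    by (intro nonneg_bdd_above_summable_on) (auto intro!: bdd_aboveI[of _ "M0 * norm y * norm v"])
  then have s: "?g y v summable_on B" for y v by (rule abs_summable_summable)
  define G where "G y v = infsum (?g y v) B" for y v
  have hs: "(?g y v has_sum G y v) B" for y v unfolding G_def by (rule has_sum_infsum[OF s])
  have norm_G: "cmod (G y v) \<le> infsum (\<lambda>a. cmod (?g y v a)) B" for y v
    unfolding G_def by (rule norm_infsum_bound[OF abs_s])
  obtain D where D: "bounded_clinear D" "\<And>y v. cinner (D y) v = G y v"
  proof (rule sesquilinear_operator[of G M0])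
    show "G (y + y') v = G y v + G y' v" for y y' v
      using hs[of "y + y'" v] has_sum_add[OF hs[of y v] hs[of y' v]]
      by (simp add: tensor_add_right bounded_clinear_add[OF lin] cinner_add_left has_sum_unique)
    show "G (c *\<^sub>C y) v = c * G y v" for c y v
      using hs[of "c *\<^sub>C y" v] has_sum_cmult_right[OF hs[of y v], of c]
      by (simp add: tensor_scaleC_right bounded_clinear_scaleC[OF lin] cinner_scaleC_left has_sum_unique)
    show "G y (v + v') = G y v + G y v'" for y v v'
      using hs[of y "v + v'"] has_sum_add[OF hs[of y v] hs[of y v']]
      by (simp add: tensor_add_right cinner_add_right has_sum_unique)
    show "G y (c *\<^sub>C v) = cnj c * G y v" for c y v
      using hs[of y "c *\<^sub>C v"] has_sum_cmult_right[OF hs[of y v], of "cnj c"]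
      by (simp add: tensor_scaleC_right cinner_scaleC_right has_sum_unique)
    show "cmod (G y v) \<le> M0 * norm y * norm v" for y v
      using norm_G[of y v] infsum_le_finite_sums[OF abs_s partial_form_bound[OF lin M0 orth]]
      by (meson order_trans)
  qed blast
  have "trace_bound D M" if M: "trace_bound A M" for M
    unfolding trace_bound_def
  proof (intro allI impI)
    fix I :: "nat set" and f g :: "nat \<Rightarrow> 'b" assume f: "bessel I f" and g: "bessel I g"
    have "(\<Sum>k\<in>I. cmod (cinner (D (f k)) (g k))) \<le>
        (\<Sum>k\<in>I. infsum (\<lambda>a. cmod (?g (f k) (g k) a)) B)"
      unfolding D(2) by (intro sum_mono norm_G)
    also have "\<dots> \<le> M"
    proof (rule has_sum_le_finite_sums)
      show "((\<lambda>a. \<Sum>k\<in>I. cmod (?g (f k) (g k) a)) has_sum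
          (\<Sum>k\<in>I. infsum (\<lambda>a. cmod (?g (f k) (g k) a)) B)) B"
        by (intro has_sum_finite_sum has_sum_infsum abs_s)
      fix F assume F: "finite F" "F \<subseteq> B"
      note b = bessel_tensor[OF orth[OF F(2)] F(1)]
      show "(\<Sum>a\<in>F. \<Sum>k\<in>I. cmod (?g (f k) (g k) a)) \<le> M"
        using trace_boundD[OF M b[OF f] b[OF g]]
        by (simp add: sum.cartesian_product case_prod_unfold)
    qed
    finally show "(\<Sum>k\<in>I. cmod (cinner (D (f k)) (g k))) \<le> M" .
  qed
  then show thesis using that[OF D(1)] hs by (simp add: D(2))
qed

text \<open>Without existence the \<open>SOME\<close> in \<open>ptrace1\<close> says nothing. One
  basis \<open>B\<close> serves all operators, so linearity follows from uniqueness of sums.\<close>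

lemma ptrace1_exists:
  "\<exists>F. trace_class_bounded_clinear F \<and>
    (\<forall>x y u v. F (rank1 (T x y) (T u v)) = (\<lambda>z. cinner x u *\<^sub>C rank1 y v z))"
proof -
  obtain B :: "'a set" where B: "is_onb B" using onb_exists by blast
  have "\<exists>D. bounded_clinear D \<and> (\<forall>y v. ((\<lambda>a. cinner (A (T a y)) (T a v)) has_sum cinner (D y) v) B) \<and>
      (\<forall>M. trace_bound A M \<longrightarrow> trace_bound D M)" if "trace_class A" for A
    by (rule partial_trace_exists[OF that B]) blast
  then obtain F where F: "\<And>A. trace_class A \<Longrightarrow> bounded_clinear (F A)"
    "\<And>A y v. trace_class A \<Longrightarrow> ((\<lambda>a. cinner (A (T a y)) (T a v)) has_sum cinner (F A y) v) B"
    "\<And>A M. trace_class A \<Longrightarrow> trace_bound A M \<Longrightarrow> trace_bound (F A) M"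
    by metis
  have F_eq: "F A = D" if "trace_class A"
    "\<And>y v. ((\<lambda>a. cinner (A (T a y)) (T a v)) has_sum cinner (D y) v) B" for A D
  proof
    fix y
    show "F A y = D y"
      by (rule cinner_eqI) (rule has_sum_unique[OF F(2)[OF that(1)] that(2)])
  qed
  have "trace_class_bounded_clinear F"
    unfolding trace_class_bounded_clinear_def
  proof (intro conjI allI impI)
    show "trace_class (F A)" if A: "trace_class A" for A
    proof -
      obtain M where "trace_bound A M" using A trace_class_iff[of A] by blast
      then show ?thesis using F(1,3)[OF A] trace_class_iff[of "F A"] by blast
    qed
    show "F (\<lambda>x. A x + A' x) = (\<lambda>y. F A y + F A' y)" if *: "trace_class A \<and> trace_class A'" for A A'
    proof (rule F_eq)
      show "trace_class (\<lambda>x. A x + A' x)"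
        using * bounded_clinear_add_fun[of A A'] trace_bound_add[of A _ A'] unfolding trace_class_iff by blast
      show "((\<lambda>a. cinner (A (T a y) + A' (T a y)) (T a v)) has_sum cinner (F A y + F A' y) v) B" for y v
        unfolding cinner_add_left by (intro has_sum_add F(2)) (use * in auto)
    qed
    show "F (\<lambda>x. c *\<^sub>C A x) = (\<lambda>y. c *\<^sub>C F A y)" if *: "trace_class A" for c A
    proof (rule F_eq)
      show "trace_class (\<lambda>x. c *\<^sub>C A x)"
        using * bounded_clinear_scaleC_fun[of A c] trace_bound_scaleC[of A _ c] unfolding trace_class_iff by blast
      show "((\<lambda>a. cinner (c *\<^sub>C A (T a y)) (T a v)) has_sum cinner (c *\<^sub>C F A y) v) B" for y v
        unfolding cinner_scaleC_left by (intro has_sum_cmult_right F(2) *)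
    qed
    show "\<exists>K. \<forall>A. trace_class A \<longrightarrow> trace_norm (F A) \<le> K * trace_norm A"
      using trace_norm_le[OF F(1) F(3)[OF _ trace_bound_trace_norm]] by (intro exI[of _ 1]) simp
  qed
  moreover have "F (rank1 (T x y) (T u v)) = (\<lambda>z. cinner x u *\<^sub>C rank1 y v z)" for x y u v
  proof (rule F_eq[OF trace_class_rank1])
    fix z w
    have "((\<lambda>a. cinner z v * cinner y w * (cinner x a * cinner a u)) has_sum
        cinner z v * cinner y w * cinner x u) B"
      by (intro has_sum_cmult_right complete_sys_parseval is_onb_complete_sys B)
    then show "((\<lambda>a. cinner (rank1 (T x y) (T u v) (T a z)) (T a w)) has_sum
        cinner (cinner x u *\<^sub>C rank1 y v z) w) B"
      by (simp add: rank1_def cinner_scaleC_left cinner_tensor mult_ac)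
  qed
  ultimately show ?thesis by blast
qed

section \<open>Values of the chosen partial trace on finite rank operators\<close>

lemma ptrace1:
  shows ptrace1_trace_class_bounded_clinear: "trace_class_bounded_clinear (ptrace1 T)"
    and ptrace1_rank1_tensor: "ptrace1 T (rank1 (T x y) (T u v)) = (\<lambda>z. cinner x u *\<^sub>C rank1 y v z)"
  using someI_ex[OF ptrace1_exists] unfolding ptrace1_def by blast+

text \<open>The defining values concern elementary tensors only. The trace norm bound makes the left
  hand side a bounded sesquilinear form in \<open>z\<close> and \<open>w\<close>, so it is
  determined by density. Here \<open>R y z\<close> is \<open>z\<close> contracted with
  \<open>y\<close> in the second factor.\<close>

lemma ptrace1_rank1:
  assumes R: "\<And>x y z. cinner (T x y) z = cinner x (R y z)" "\<And>y. bounded_clinear (R y)"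
  shows "cinner (ptrace1 T (rank1 z w) y) v = cinner (R v z) (R y w)"
proof -
  note P = ptrace1_trace_class_bounded_clinear[unfolded trace_class_bounded_clinear_def]
  have P_add: "ptrace1 T (\<lambda>x. A x + B x) = (\<lambda>y. ptrace1 T A y + ptrace1 T B y)"
    and P_scale: "ptrace1 T (\<lambda>x. c *\<^sub>C A x) = (\<lambda>y. c *\<^sub>C ptrace1 T A y)"
    if "trace_class A" "trace_class B" for A B c
    using P that by blast+
  obtain K where K: "\<And>A. trace_class A \<Longrightarrow> trace_norm (ptrace1 T A) \<le> K * trace_norm A"
    using P by blast
  define G where "G z w = cinner (ptrace1 T (rank1 z w) y) v" for z w
  note tc = trace_class_rank1 trace_class_rank1
  obtain A where A: "bounded_clinear A" "\<And>z w. cinner (A z) w = G z w"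
  proof (rule sesquilinear_operator[of G "\<bar>K\<bar> * norm y * norm v"])
    show "G (z + z') w = G z w + G z' w" for z z' w
    proof -
      have "rank1 (z + z') w = (\<lambda>x. rank1 z w x + rank1 z' w x)"
        by (auto simp: rank1_def scaleC_add_right)
      then show ?thesis by (simp add: G_def P_add[OF tc] cinner_add_left)
    qed
    show "G (c *\<^sub>C z) w = c * G z w" for c z w
    proof -
      have "rank1 (c *\<^sub>C z) w = (\<lambda>x. c *\<^sub>C rank1 z w x)"
        by (auto simp: rank1_def scaleC_scaleC mult.commute)
      then show ?thesis by (simp add: G_def P_scale[OF tc] cinner_scaleC_left)
    qed
    show "G z (w + w') = G z w + G z w'" for z w w'
    proof -
      have "rank1 z (w + w') = (\<lambda>x. rank1 z w x + rank1 z w' x)"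
        by (auto simp: rank1_def cinner_add_right scaleC_add_left)
      then show ?thesis by (simp add: G_def P_add[OF tc] cinner_add_left)
    qed
    show "G z (c *\<^sub>C w) = cnj c * G z w" for c z w
    proof -
      have "rank1 z (c *\<^sub>C w) = (\<lambda>x. cnj c *\<^sub>C rank1 z w x)"
        by (auto simp: rank1_def scaleC_scaleC cinner_scaleC_right)
      then show ?thesis by (simp add: G_def P_scale[OF tc] cinner_scaleC_left)
    qed
    show "cmod (G z w) \<le> \<bar>K\<bar> * norm y * norm v * norm z * norm w" for z w
    proof -
      have tc': "trace_class (ptrace1 T (rank1 z w))" using P trace_class_rank1 by blast
      have nn: "0 \<le> trace_norm (rank1 z w)"
        by (rule trace_bound_nonneg[OF trace_bound_trace_norm[OF trace_class_rank1]])
      have "trace_norm (ptrace1 T (rank1 z w)) \<le> K * trace_norm (rank1 z w)"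
        by (rule K[OF trace_class_rank1])
      also have "\<dots> \<le> \<bar>K\<bar> * (norm z * norm w)"
        using trace_norm_le[OF bounded_clinear_rank1 trace_bound_rank1, of z w] nn
        by (intro mult_mono) auto
      finally have "trace_norm (ptrace1 T (rank1 z w)) * (norm y * norm v) \<le>
          \<bar>K\<bar> * (norm z * norm w) * (norm y * norm v)"
        by (rule mult_right_mono) simp
      then show ?thesis
        using trace_bound_cinner[OF trace_class_bounded_clinear_op[OF tc']
            trace_bound_trace_norm[OF tc'], of y v]
        by (simp add: G_def mult_ac)
    qed
  qed blast
  have A_eq: "A = (\<lambda>z. T (R v z) y)"
  proof (rule bounded_clinear_eq_on_dense[OF A(1) _ tensor_dense])
    show "bounded_clinear (\<lambda>z. T (R v z) y)"
      by (rule bounded_clinear_compose[OF bounded_clinear_tensor_left R(2)])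
    fix z assume "z \<in> {T x y |x y. True}"
    then obtain x y0 where z: "z = T x y0" by blast
    have R_tensor: "R v' (T x' y') = cinner y' v' *\<^sub>C x'" for v' x' y'
    proof -
      have "cinner u (R v' (T x' y')) = cinner u (cinner y' v' *\<^sub>C x')" for u
        using cinner_commute[of v' y']
        by (simp add: R(1)[symmetric] cinner_tensor cinner_scaleC_right mult.commute)
      then have "cinner (R v' (T x' y')) u = cinner (cinner y' v' *\<^sub>C x') u" for u
        by (metis cinner_commute)
      then show ?thesis by (rule cinner_eqI)
    qed
    have "A z - T (R v z) y = 0"
    proof (rule orthogonal_dense_eq_0[OF tensor_dense])
      fix w assume "w \<in> {T x y |x y. True}"
      then obtain u v0 where w: "w = T u v0" by blast
      show "cinner (A z - T (R v z) y) w = 0"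
        by (simp add: cinner_diff_left A(2) G_def z w ptrace1_rank1_tensor R_tensor cinner_tensor
            cinner_scaleC_left rank1_def)
    qed
    then show "A z = T (R v z) y" by simp
  qed
  have "cinner (ptrace1 T (rank1 z w) y) v = cinner (A z) w" by (simp add: A(2) G_def)
  then show ?thesis by (simp add: A_eq R(1))
qed

lemma ptrace1_zero: "ptrace1 T (\<lambda>x. 0) = (\<lambda>y. 0)"
proof -
  note P = ptrace1_trace_class_bounded_clinear[unfolded trace_class_bounded_clinear_def]
  have "ptrace1 T (\<lambda>x. 0 *\<^sub>C rank1 0 0 x) = (\<lambda>y. 0 *\<^sub>C ptrace1 T (rank1 0 0) y)"
    using P trace_class_rank1 by blast
  then show ?thesis by simp
qed

lemma ptrace1_finite_rank:
  "ptrace1 T (finite_rank K z w) = (\<lambda>y. \<Sum>k\<in>K. ptrace1 T (rank1 (z k) (w k)) y)"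
proof (induction K rule: infinite_finite_induct)
  case (insert k K)
  note P = ptrace1_trace_class_bounded_clinear[unfolded trace_class_bounded_clinear_def]
  have "finite_rank (insert k K) z w = (\<lambda>x. rank1 (z k) (w k) x + finite_rank K z w x)"
    using insert by (auto simp: finite_rank_def)
  then have "ptrace1 T (finite_rank (insert k K) z w) =
      (\<lambda>y. ptrace1 T (rank1 (z k) (w k)) y + ptrace1 T (finite_rank K z w) y)"
    using P trace_class_rank1 trace_class_finite_rank by metis
  then show ?case using insert by simp
qed (simp_all add: finite_rank_def[abs_def] ptrace1_zero)

text \<open>The basis is arbitrary and may be padded with zeros; it is not tied to the one from the
  existence proof. So the truncation basis can be used to compute marginals.\<close>

lemma ptrace1_finite_rank_has_sum:
  assumes a: "complete_sys I a" and A: "A = finite_rank K z w"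
  shows "((\<lambda>i. cinner (A (T (a i) y)) (T (a i) v)) has_sum cinner (ptrace1 T A y) v) I"
proof -
  have "\<exists>R. bounded_clinear R \<and> (\<forall>x z. cinner (T x y) z = cinner x (R z))" for y
    by (rule adjoint_exists[OF bounded_clinear_tensor_left[of y]]) blast
  then obtain R where R: "\<And>x y z. cinner (T x y) z = cinner x (R y z)" "\<And>y. bounded_clinear (R y)"
    by metis
  have "((\<lambda>i. \<Sum>k\<in>K. cinner (R v (z k)) (a i) * cinner (a i) (R y (w k)))
      has_sum (\<Sum>k\<in>K. cinner (R v (z k)) (R y (w k)))) I"
    by (intro has_sum_finite_sum complete_sys_parseval a)
  moreover have "cinner (z k) (T (a i) v) = cinner (R v (z k)) (a i)" for k i
    using R(1)[of "a i" v "z k"] cinner_commute[of "z k" "T (a i) v"]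
      cinner_commute[of "R v (z k)" "a i"] by simp
  ultimately show ?thesis
    by (simp add: A ptrace1_finite_rank cinner_sum_left ptrace1_rank1[OF R] finite_rank_def rank1_def
        cinner_scaleC_left R(1) mult.commute)
qed

lemma ptrace1_bounded_clinear:
  assumes "A = finite_rank K z w"
  shows "bounded_clinear (ptrace1 T A)"
  using ptrace1_trace_class_bounded_clinear trace_class_finite_rank trace_class_bounded_clinear_op
  unfolding assms trace_class_bounded_clinear_def by blast

end

text \<open>The two defining conditions differ only in the order of the quantified vectors, so both
  \<open>SOME\<close> terms choose from the same predicate.\<close>

lemma ptrace2_eq_ptrace1_flip: "ptrace2 T = ptrace1 (\<lambda>y x. T x y)"
proof -
  have "(\<forall>x y u v. F (rank1 (T x y) (T u v)) = (\<lambda>z. cinner y v *\<^sub>C rank1 x u z)) \<longleftrightarrow>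
      (\<forall>x y u v. F (rank1 (T y x) (T v u)) = (\<lambda>z. cinner x u *\<^sub>C rank1 y v z))" for F
    by blast
  then show ?thesis unfolding ptrace1_def ptrace2_def by simp
qed

section \<open>Weak limits\<close>

lemma convergent_if_convergent_on_dense:
  fixes \<phi> :: "nat \<Rightarrow> 'a::complex_inner \<Rightarrow> complex"
  assumes \<phi>: "\<And>k. bounded_clinear (\<phi> k)" "\<And>k x. cmod (\<phi> k x) \<le> C * norm x"
    and S: "closure (cspan S) = UNIV" and conv: "\<And>x. x \<in> S \<Longrightarrow> convergent (\<lambda>k. \<phi> k x)"
  shows "convergent (\<lambda>k. \<phi> k x)"
proof -
  let ?D = "{x. convergent (\<lambda>k. \<phi> k x)}"
  have "csubspace ?D"
  proof (rule complex_vector.subspaceI)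
    show "c *\<^sub>C x \<in> ?D" if "x \<in> ?D" for c x
      using that by (auto simp: bounded_clinear_scaleC[OF \<phi>(1)] scaleC_complex_def convergent_def
          intro: tendsto_mult_left)
  qed (auto simp: bounded_clinear_zero[OF \<phi>(1)] bounded_clinear_add[OF \<phi>(1)]
      intro: convergent_const convergent_add)
  then have "cspan S \<subseteq> ?D" using conv by (intro complex_vector.span_minimal) auto
  then have x: "x \<in> closure ?D" using S closure_mono by blast
  have "Cauchy (\<lambda>k. \<phi> k x)"
  proof (rule metric_CauchyI)
    fix e :: real assume e: "e > 0"
    define C' where "C' = \<bar>C\<bar> + 1"
    have C': "C' > 0" "cmod (\<phi> k z) \<le> C' * norm z" for k z
      using order_trans[OF \<phi>(2)[of k z] mult_right_mono[of C C' "norm z"]] by (auto simp: C'_def)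
    obtain y where y: "convergent (\<lambda>k. \<phi> k y)" "dist y x < e / (3 * C')"
      using x e C'(1) unfolding closure_approachable by (metis divide_pos_pos mem_Collect_eq
          mult_pos_pos zero_less_numeral)
    obtain N where N: "\<And>m n. m \<ge> N \<Longrightarrow> n \<ge> N \<Longrightarrow> dist (\<phi> m y) (\<phi> n y) < e / 3"
      using metric_CauchyD[OF convergent_Cauchy[OF y(1)], of "e / 3"] e by auto
    have close: "dist (\<phi> k x) (\<phi> k y) < e / 3" for k
    proof -
      have "dist (\<phi> k x) (\<phi> k y) \<le> C' * dist y x"
        using C'(2)[of k "x - y"] by (simp add: bounded_clinear_diff[OF \<phi>(1)] dist_norm norm_minus_commute)
      also have "\<dots> < e / 3" using y(2) C'(1) by (simp add: field_simps)
      finally show ?thesis .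
    qed
    have "dist (\<phi> m x) (\<phi> n x) < e" if "m \<ge> N" "n \<ge> N" for m n
      using N[OF that] close[of m] close[of n] dist_triangle[of "\<phi> m x" "\<phi> n x" "\<phi> m y"]
        dist_triangle[of "\<phi> m y" "\<phi> n x" "\<phi> n y"] by (simp add: dist_commute)
    then show "\<exists>N. \<forall>m\<ge>N. \<forall>n\<ge>N. dist (\<phi> m x) (\<phi> n x) < e" by blast
  qed
  then show ?thesis by (rule Cauchy_convergent)
qed

definition weak_limit :: "(nat \<Rightarrow> 'a::complex_inner \<Rightarrow> 'a) \<Rightarrow> ('a \<Rightarrow> 'a) \<Rightarrow> bool"
  where "weak_limit A L \<longleftrightarrow> (\<forall>x y. (\<lambda>k. cinner (A k x) y) \<longlonglongrightarrow> cinner (L x) y)"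

text \<open>The matrix entries with respect to \<open>t\<close> are points of a product of closed
  unit discs. This product is compact by Tychonoff, and sequentially compact as the index type is
  countable. Convergence of the entries spreads to all vectors by density and the uniform norm
  bound, one argument at a time.\<close>

lemma weak_compactness:
  fixes A :: "nat \<Rightarrow> 'a::chilbert_space \<Rightarrow> 'a" and t :: "'i::countable \<Rightarrow> 'a"
  assumes A: "\<And>k. psd (A k)" and le: "\<And>k x. norm (A k x) \<le> norm x" and t: "complete_sys UNIV t"
  obtains r L where "strict_mono r" "weak_limit (A \<circ> r) L" "psd L"
proof -
  have dense: "closure (cspan (range t)) = UNIV" and orth: "orthosys UNIV t"
    using t by (auto simp: complete_sys_def)
  define f where "f k = (\<lambda>(p, q). cinner (A k (t p)) (t q))" for k
  have Ale: "cmod (cinner (A k x) y) \<le> norm x * norm y" for k x y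
    using Cauchy_Schwarz_cinner[of "A k x" y] mult_right_mono[OF le[of k x] norm_ge_zero[of y]]
    by linarith
  have "compactin (product_topology (\<lambda>_. euclidean) UNIV) (PiE UNIV (\<lambda>_ :: 'i \<times> 'i. cball (0 :: complex) 1))"
    by (subst compactin_PiE) simp
  then have "compact (PiE UNIV (\<lambda>_ :: 'i \<times> 'i. cball (0 :: complex) 1))"
    by (simp add: euclidean_product_topology)
  moreover have "f k \<in> PiE UNIV (\<lambda>_. cball 0 1)" for k
  proof -
    have "norm (t p) \<le> 1" for p using orth by (auto simp: orthosys_def dest!: spec[of _ p])
    then have "norm (t p) * norm (t q) \<le> 1" for p q by (simp add: mult_le_one)
    then have "cmod (cinner (A k (t p)) (t q)) \<le> 1" for p q
      using Ale order_trans by blast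
    then show ?thesis by (auto simp: f_def)
  qed
  ultimately obtain l r where r: "strict_mono (r :: nat \<Rightarrow> nat)" and l: "(f \<circ> r) \<longlonglongrightarrow> l"
    using compact_imp_seq_compact unfolding seq_compact_def by metis
  have conv0: "convergent (\<lambda>k. cinner (A (r k) (t p)) (t q))" for p q
  proof -
    have "(\<lambda>k. (f \<circ> r) k (p, q)) \<longlonglongrightarrow> l (p, q)"
      using l by (rule continuous_on_tendsto_compose[OF continuous_on_product_coordinates]) auto
    then show ?thesis by (auto simp: f_def convergent_def)
  qed
  have conv1: "convergent (\<lambda>k. cinner (A (r k) x) (t q))" for x q
  proof (rule convergent_if_convergent_on_dense[OF _ _ dense,
        of "\<lambda>k x. cinner (A (r k) x) (t q)" "norm (t q)"])
    show le': "cmod (cinner (A (r k) x) (t q)) \<le> norm (t q) * norm x" for k x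
      using Ale[of "r k" x "t q"] by (simp add: mult.commute)
    show "bounded_clinear (\<lambda>x. cinner (A (r k) x) (t q))" for k
      by (rule bounded_clinearI[OF _ _ le'])
        (auto simp: bounded_clinear_add[OF psdD(1)[OF A]] bounded_clinear_scaleC[OF psdD(1)[OF A]]
          cinner_add_left cinner_scaleC_left scaleC_complex_def)
  qed (use conv0 in auto)
  \<comment> \<open>The varying vector stands on the left because the density lemma needs
    functionals that are linear in it.\<close>
  have conv2: "convergent (\<lambda>k. cinner y (A (r k) x))" for x y
  proof (rule convergent_if_convergent_on_dense[OF _ _ dense,
        of "\<lambda>k y. cinner y (A (r k) x)" "norm x"])
    show le': "cmod (cinner y (A (r k) x)) \<le> norm x * norm y" for k y
      using Ale[of "r k" x y] by (simp add: cmod_cinner_commute)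
    show "bounded_clinear (\<lambda>y. cinner y (A (r k) x))" for k
      by (rule bounded_clinearI[OF _ _ le'])
        (auto simp: cinner_add_left cinner_scaleC_left scaleC_complex_def)
    show "convergent (\<lambda>k. cinner y (A (r k) x))" if y: "y \<in> range t" for y
    proof -
      obtain q where q: "y = t q" using y by blast
      obtain z where "(\<lambda>k. cinner (A (r k) x) (t q)) \<longlonglongrightarrow> z"
        using conv1 convergent_def by blast
      from tendsto_cnj[OF this] show ?thesis
        unfolding q convergent_def by (auto simp flip: cinner_commute)
    qed
  qed
  define G where "G x y = lim (\<lambda>k. cinner (A (r k) x) y)" for x y
  have lim: "(\<lambda>k. cinner (A (r k) x) y) \<longlonglongrightarrow> G x y" for x y
    using conv2[of x y] unfolding G_def psdD(2)[OF A]
    using conv2[of y x] by (simp add: convergent_LIMSEQ_iff)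
  note lin = bounded_clinear_add[OF psdD(1)[OF A]] bounded_clinear_scaleC[OF psdD(1)[OF A]]
  obtain L where L: "bounded_clinear L" "\<And>x y. cinner (L x) y = G x y"
  proof (rule sesquilinear_operator[of G 1])
    show "G (x + x') y = G x y + G x' y" for x x' y
      using lim[of "x + x'" y] tendsto_add[OF lim[of x y] lim[of x' y]]
      by (simp add: lin cinner_add_left LIMSEQ_unique)
    show "G (c *\<^sub>C x) y = c * G x y" for c x y
      using lim[of "c *\<^sub>C x" y] tendsto_mult_left[OF lim[of x y], of c]
      by (simp add: lin cinner_scaleC_left LIMSEQ_unique)
    show "G x (y + y') = G x y + G x y'" for x y y'
      using lim[of x "y + y'"] tendsto_add[OF lim[of x y] lim[of x y']]
      by (simp add: cinner_add_right LIMSEQ_unique)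
    show "G x (c *\<^sub>C y) = cnj c * G x y" for c x y
      using lim[of x "c *\<^sub>C y"] tendsto_mult_left[OF lim[of x y], of "cnj c"]
      by (simp add: cinner_scaleC_right LIMSEQ_unique)
    show "cmod (G x y) \<le> 1 * norm x * norm y" for x y
      using LIMSEQ_le_const2[OF tendsto_norm[OF lim[of x y]]] Ale by simp
  qed blast
  have wl: "weak_limit (A \<circ> r) L" using lim by (simp add: weak_limit_def L(2))
  have "psd L"
  proof (rule psdI[OF L(1)])
    show "cinner (L x) y = cinner x (L y)" for x y
    proof -
      have "(\<lambda>k. cinner (A (r k) x) y) \<longlonglongrightarrow> cnj (G y x)"
        using tendsto_cnj[OF lim[of y x]]
        by (simp add: psdD(2)[OF A, of _ x y] flip: cinner_commute)
      then have "cinner (L x) y = cnj (cinner (L y) x)"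
        using lim[of x y] LIMSEQ_unique by (simp add: L(2))
      then show ?thesis by (simp flip: cinner_commute)
    qed
    show "0 \<le> Re (cinner (L x) x)" for x
      using LIMSEQ_le_const[OF tendsto_Re[OF lim[of x x]]] psdD(3)[OF A] by (simp add: L(2))
  qed
  then show thesis using that r wl by blast
qed

text \<open>Finite sums of diagonal entries are weakly continuous, whereas the trace is not; hence
  all trace bounds are kept in the form of finite sums.\<close>

lemma weak_limit_sum_le:
  assumes L: "weak_limit A L" and le: "\<And>k. (\<Sum>i\<in>I. Re (cinner (A k (f i)) (f i))) \<le> \<beta> k"
    and \<beta>: "\<beta> \<longlonglongrightarrow> b"
  shows "(\<Sum>i\<in>I. Re (cinner (L (f i)) (f i))) \<le> b"
proof (rule LIMSEQ_le[OF _ \<beta>])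
  show "(\<lambda>k. \<Sum>i\<in>I. Re (cinner (A k (f i)) (f i))) \<longlonglongrightarrow> (\<Sum>i\<in>I. Re (cinner (L (f i)) (f i)))"
    using L by (intro tendsto_sum tendsto_Re) (simp add: weak_limit_def)
qed (use le in blast)


section \<open>Finite dimensional subspaces\<close>

lemma sgn_eq_scaleC: "sgn (z :: 'a::complex_inner) = complex_of_real (inverse (norm z)) *\<^sub>C z"
  by (simp add: sgn_div_norm scaleC_of_real del: of_real_inverse)

text \<open>Vectors that depend on earlier ones become zero instead of being discarded, so the index
  set keeps its length \<open>d\<close> whatever the dimension of the span.\<close>

lemma gram_schmidt:
  fixes b :: "nat \<Rightarrow> 'a::complex_inner"
  shows "\<exists>c. orthosys {..<d} c \<and> cspan (c ` {..<d}) = cspan (b ` {..<d})"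
proof (induction d)
  case 0
  then show ?case by (simp add: orthosys_def)
next
  case (Suc d)
  then obtain c where c: "orthosys {..<d} c" "cspan (c ` {..<d}) = cspan (b ` {..<d})" by blast
  define p where "p = sys_proj {..<d} c (b d)"
  \<comment> \<open>In the dependent case \<open>b d = p\<close>, and \<open>sgn 0 = 0\<close>
    supplies the zero vector.\<close>
  define c' where "c' = c(d := sgn (b d - p))"
  have p: "p \<in> cspan (b ` {..<d})" unfolding p_def c(2)[symmetric] by (rule sys_proj_in_span)
  have img: "f ` {..<Suc d} = insert (f d) (f ` {..<d})" for f :: "nat \<Rightarrow> 'a"
    by (auto simp: lessThan_Suc)
  have c'_img: "c' ` {..<Suc d} = insert (sgn (b d - p)) (c ` {..<d})"
    by (auto simp: c'_def less_Suc_eq image_iff)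

  have orth: "cinner (sgn (b d - p)) (c i) = 0" if "i < d" for i
    unfolding sgn_eq_scaleC cinner_scaleC_left p_def
    using that by (subst sys_proj_orthogonal[OF c(1)]) (auto intro: complex_vector.span_base)
  have "orthosys {..<Suc d} c'"
    using c(1) orth cinner_commute[of "c _" "sgn (b d - p)"]
    by (auto simp: orthosys_def c'_def less_Suc_eq norm_sgn)
  moreover have "cspan (c' ` {..<Suc d}) = cspan (b ` {..<Suc d})"
  proof (rule antisym)
    show "cspan (c' ` {..<Suc d}) \<subseteq> cspan (b ` {..<Suc d})"
    proof (rule complex_vector.span_minimal[OF _ complex_vector.subspace_span])
      have sub: "cspan (b ` {..<d}) \<subseteq> cspan (b ` {..<Suc d})"
        by (rule complex_vector.span_mono) auto
      have "b d - p \<in> cspan (b ` {..<Suc d})"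
      proof (rule complex_vector.span_diff)
        show "b d \<in> cspan (b ` {..<Suc d})" by (rule complex_vector.span_base) simp
      qed (use p sub in blast)
      then have "sgn (b d - p) \<in> cspan (b ` {..<Suc d})"
        unfolding sgn_eq_scaleC by (rule complex_vector.span_scale)
      moreover have "c ` {..<d} \<subseteq> cspan (b ` {..<Suc d})"
        using complex_vector.span_superset[of "c ` {..<d}"] sub unfolding c(2) by blast
      ultimately show "c' ` {..<Suc d} \<subseteq> cspan (b ` {..<Suc d})" unfolding c'_img by blast
    qed
    show "cspan (b ` {..<Suc d}) \<subseteq> cspan (c' ` {..<Suc d})"
    proof (rule complex_vector.span_minimal[OF _ complex_vector.subspace_span])
      have "cspan (c ` {..<d}) \<subseteq> cspan (c' ` {..<Suc d})"
        unfolding c'_img by (rule complex_vector.span_mono) auto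
      then have sub: "cspan (b ` {..<d}) \<subseteq> cspan (c' ` {..<Suc d})" by (simp add: c(2))
      have "sgn (b d - p) \<in> cspan (c' ` {..<Suc d})"
        unfolding c'_img by (rule complex_vector.span_base) simp
      then have "complex_of_real (norm (b d - p)) *\<^sub>C sgn (b d - p) \<in> cspan (c' ` {..<Suc d})"
        by (rule complex_vector.span_scale)
      moreover have "complex_of_real (norm (b d - p)) *\<^sub>C sgn (b d - p) = b d - p"
        by (cases "b d - p = 0") (auto simp: sgn_eq_scaleC scaleC_scaleC simp flip: of_real_mult)
      ultimately have "(b d - p) + p \<in> cspan (c' ` {..<Suc d})"
        using p sub by (intro complex_vector.span_add) auto
      then show "b ` {..<Suc d} \<subseteq> cspan (c' ` {..<Suc d})"
        unfolding img[of b] insert_subset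
        using order_trans[OF complex_vector.span_superset[of "b ` {..<d}"] sub]
        by (simp only: diff_add_cancel simp_thms)
    qed
  qed
  ultimately show ?case by blast
qed

lemma finite_dim_csubspaceE:
  fixes X :: "'a::complex_inner set"
  assumes "finite_dim_csubspace X"
  obtains d :: nat and c where "orthosys {..<d} c" "X = cspan (c ` {..<d})"
proof -
  obtain B where B: "finite B" "X = cspan B" using assms by (auto simp: finite_dim_csubspace_def)
  then obtain b where "B = b ` {..<card B}"
    using ex_bij_betw_nat_finite[OF B(1)] by (metis atLeast0LessThan bij_betw_imp_surj_on)
  then show thesis using that gram_schmidt[of "card B" b] B(2) by metis
qed

lemma orth_proj_span:
  assumes "orthosys F c" "finite F"
  shows "orth_proj (cspan (c ` F)) = sys_proj F c"
proof
  fix x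
  show "orth_proj (cspan (c ` F)) x = sys_proj F c x"
    unfolding orth_proj_def
  proof (rule the_equality)
    show "sys_proj F c x \<in> cspan (c ` F) \<and> (\<forall>y\<in>cspan (c ` F). cinner (x - sys_proj F c x) y = 0)"
      using sys_proj_in_span sys_proj_orthogonal[OF assms] by blast
    fix p assume p: "p \<in> cspan (c ` F) \<and> (\<forall>y\<in>cspan (c ` F). cinner (x - p) y = 0)"
    let ?w = "sys_proj F c x - p"
    have w: "?w \<in> cspan (c ` F)" using p sys_proj_in_span complex_vector.span_diff by blast
    have "cinner (x - p) ?w = 0" "cinner (x - sys_proj F c x) ?w = 0"
      using p w sys_proj_orthogonal[OF assms w] by blast+
    then have "cinner ?w ?w = 0" by (simp add: cinner_diff_left)
    then show "p = sys_proj F c x" by simp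
  qed
qed

lemma image_cspan:
  assumes A: "bounded_clinear A"
  shows "A ` cspan S = cspan (A ` S)"
proof (rule antisym)
  have "csubspace {x. A x \<in> cspan (A ` S)}"
    by (rule complex_vector.subspaceI)
      (auto simp: bounded_clinear_add[OF A] bounded_clinear_scaleC[OF A] bounded_clinear_zero[OF A]
        intro: complex_vector.span_zero complex_vector.span_add complex_vector.span_scale)
  then have "cspan S \<subseteq> {x. A x \<in> cspan (A ` S)}"
    by (intro complex_vector.span_minimal) (auto intro: complex_vector.span_base)
  then show "A ` cspan S \<subseteq> cspan (A ` S)" by blast
  have "csubspace (A ` cspan S)"
  proof (rule complex_vector.subspaceI)
    show "0 \<in> A ` cspan S"
      using bounded_clinear_zero[OF A] complex_vector.span_zero[of S] by (metis imageI)
    show "x + y \<in> A ` cspan S" if xy: "x \<in> A ` cspan S" "y \<in> A ` cspan S" for x y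
    proof -
      obtain x' y' where "x = A x'" "y = A y'" "x' \<in> cspan S" "y' \<in> cspan S" using xy by blast
      then show ?thesis
        using bounded_clinear_add[OF A, of x' y'] complex_vector.span_add[of x' S y'] by (metis imageI)
    qed
    show "k *\<^sub>C x \<in> A ` cspan S" if x: "x \<in> A ` cspan S" for k x
    proof -
      obtain x' where "x = A x'" "x' \<in> cspan S" using x by blast
      then show ?thesis
        using bounded_clinear_scaleC[OF A, of k x'] complex_vector.span_scale[of x' S k] by (metis imageI)
    qed
  qed
  then show "cspan (A ` S) \<subseteq> A ` cspan S"
    by (intro complex_vector.span_minimal) (auto intro: complex_vector.span_base)
qed

text \<open>The span is the fixed point set of a continuous projection. Closedness is needed because
  \<open>op_support\<close> takes a closure.\<close>

lemma closed_cspan_orthosys: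
  assumes "orthosys F c" "finite F"
  shows "closed (cspan (c ` F))"
proof -
  have "cspan (c ` F) = {x. sys_proj F c x = x}"
  proof (intro set_eqI iffI)
    show "x \<in> {x. sys_proj F c x = x}" if "x \<in> cspan (c ` F)" for x
      using sys_proj_id[OF assms that] by simp
    show "x \<in> cspan (c ` F)" if "x \<in> {x. sys_proj F c x = x}" for x
      using that sys_proj_in_span[of F c x] by simp
  qed
  moreover have "closed {x. sys_proj F c x = x}"
    by (intro closed_Collect_eq linear_continuous_on bounded_clinear_bounded_linear
        bounded_clinear_sys_proj continuous_on_id)
  ultimately show ?thesis by simp
qed

lemma psd_compression_finite_rank:
  assumes A: "psd A" and range: "\<And>x. sys_proj F c (A x) = A x"
  shows "A = finite_rank F c (\<lambda>k. A (c k))"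
proof
  fix z
  have "A z = (\<Sum>k\<in>F. cinner (A z) (c k) *\<^sub>C c k)"
    using range[of z] by (simp add: sys_proj_def)
  then show "A z = finite_rank F c (\<lambda>k. A (c k)) z"
    by (simp add: finite_rank_def rank1_def psdD(2)[OF A])
qed

lemma psd_conjugate:
  assumes A: "psd A" and P: "bounded_clinear P" "\<And>x y. cinner (P x) y = cinner x (P y)"
  shows "psd (P \<circ> A \<circ> P)"
proof (rule psdI)
  show "bounded_clinear (P \<circ> A \<circ> P)"
    unfolding comp_def
    by (rule bounded_clinear_compose[OF bounded_clinear_compose[OF P(1) psdD(1)[OF A]] P(1)])
  show "cinner ((P \<circ> A \<circ> P) x) y = cinner x ((P \<circ> A \<circ> P) y)" for x y
    by (simp add: P(2) psdD(2)[OF A])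
  show "0 \<le> Re (cinner ((P \<circ> A \<circ> P) x) x)" for x
    using psdD(3)[OF A, of "P x"] by (simp add: P(2))
qed

text \<open>Moving each \<open>g l\<close> to its projection onto the span of \<open>c\<close>
  changes its diagonal entry by at most twice the distance, and the projected family carries no more
  mass than \<open>A\<close> has on that whole span.\<close>

lemma psd_sum_on_approximate_subspace:
  fixes A :: "'a::chilbert_space \<Rightarrow> 'a"
    and \<epsilon> :: real
  assumes A: "psd A" and le: "\<And>x. norm (A x) \<le> norm x"
    and g: "orthosys G g" "finite G" and c: "orthosys F c" "finite F"
    and near: "\<And>l. l \<in> G \<Longrightarrow> norm (g l - sys_proj F c (g l)) \<le> \<epsilon>"
  shows "(\<Sum>l\<in>G. Re (cinner (A (g l)) (g l))) \<le> (\<Sum>k\<in>F. Re (cinner (A (c k)) (c k))) + 2 * card G * \<epsilon>"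
proof -
  let ?P = "sys_proj F c"
  obtain S where S: "psd S" "\<And>x. S (S x) = A x" using psd_sqrt_exists[OF A] by metis
  obtain B :: "'a set" where B: "is_onb B" using onb_exists by blast
  note onb = is_onb_complete_sys[OF B]
  \<comment> \<open>The right hand side is the squared Hilbert-Schmidt norm of \<open>S\<close>
    after \<open>?P\<close>, which bounds the sum over the Bessel family \<open>g\<close>.\<close>
  have "(\<Sum>l\<in>G. (norm (S (?P (g l))))\<^sup>2) \<le> (\<Sum>k\<in>F. (norm (S (c k)))\<^sup>2)"
  proof (rule bessel_sum_norm_le[OF _ onb _ orthosys_imp_bessel[OF g], where S' = "\<lambda>x. ?P (S x)"])
    show "cinner (S (?P x)) y = cinner x (?P (S y))" for x y
      by (simp add: psdD(2)[OF S(1)] sys_proj_selfadjoint)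
    fix E assume E: "finite E" "E \<subseteq> B"
    have orth: "orthosys E (\<lambda>x. x)"
      using onb orthosys_subset[OF _ E(2)] unfolding complete_sys_def by blast
    have "cmod (cinner (S e) (c k)) = cmod (cinner (S (c k)) e)" for e k
      unfolding psdD(2)[OF S(1), of e] by (rule cmod_cinner_commute)
    then have "(\<Sum>e\<in>E. (norm (?P (S e)))\<^sup>2) = (\<Sum>k\<in>F. \<Sum>e\<in>E. (cmod (cinner (S (c k)) e))\<^sup>2)"
      unfolding sys_proj_norm[OF c] by (subst sum.swap) simp
    also have "\<dots> \<le> (\<Sum>k\<in>F. (norm (S (c k)))\<^sup>2)"
      by (intro sum_mono orthosys_bessel[OF orth E(1)])
    finally show "(\<Sum>e\<in>E. (norm (?P (S e)))\<^sup>2) \<le> (\<Sum>k\<in>F. (norm (S (c k)))\<^sup>2)" .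
  qed
  then have 1: "(\<Sum>l\<in>G. Re (cinner (A (?P (g l))) (?P (g l)))) \<le> (\<Sum>k\<in>F. Re (cinner (A (c k)) (c k)))"
    by (simp add: psd_sqrt_form[OF S])
  have 2: "Re (cinner (A (g l)) (g l)) \<le> Re (cinner (A (?P (g l))) (?P (g l))) + 2 * \<epsilon>" if l: "l \<in> G" for l
  proof -
    let ?w = "g l - ?P (g l)"
    have g1: "norm (g l) \<le> 1" using g(1) l by (auto simp: orthosys_def)
    have P1: "norm (?P (g l)) \<le> 1" using sys_proj_norm_le[OF c] g1 order_trans by blast
    have "cinner (A (g l)) (g l) - cinner (A (?P (g l))) (?P (g l)) =
        cinner (A ?w) (g l) + cinner (A (?P (g l))) ?w"
      by (simp add: bounded_clinear_diff[OF psdD(1)[OF A]] cinner_diff_left cinner_diff_right)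
    moreover have "0 \<le> \<epsilon>" using near[OF l] norm_ge_zero order_trans by blast
    then have "cmod (cinner (A ?w) (g l)) \<le> \<epsilon> * 1"
      using near[OF l] le[of ?w] g1 by (intro order_trans[OF Cauchy_Schwarz_cinner] mult_mono) auto
    moreover have "cmod (cinner (A (?P (g l))) ?w) \<le> 1 * \<epsilon>"
      using near[OF l] le[of "?P (g l)"] P1
      by (intro order_trans[OF Cauchy_Schwarz_cinner] mult_mono) auto
    ultimately show ?thesis
      using complex_Re_le_cmod[of "cinner (A ?w) (g l)"] complex_Re_le_cmod[of "cinner (A (?P (g l))) ?w"]
      by (smt (verit) minus_complex.simps(1) plus_complex.simps(1))
  qed
  have "(\<Sum>l\<in>G. Re (cinner (A (g l)) (g l))) \<le>
      (\<Sum>l\<in>G. Re (cinner (A (?P (g l))) (?P (g l))) + 2 * \<epsilon>)"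
    by (intro sum_mono 2)
  then show ?thesis using 1 by (simp add: sum.distrib)
qed

text \<open>The family \<open>c\<close> already carries the full mass \<open>s\<close>. A unit
  vector orthogonal to it extends it to a family of \<open>d + 1\<close> vectors whose mass still
  cannot exceed \<open>s\<close>, so the form vanishes there and positivity makes \<open>A\<close>
  vanish there.\<close>

lemma psd_supported_on_span:
  fixes A :: "'a::chilbert_space \<Rightarrow> 'a" and c :: "nat \<Rightarrow> 'a"
  assumes A: "psd A"
    and tr: "\<And>f :: nat \<Rightarrow> 'a. bessel {..<Suc d} f \<Longrightarrow> (\<Sum>i<Suc d. Re (cinner (A (f i)) (f i))) \<le> s"
    and c: "orthosys {..<d} c" and ge: "s \<le> (\<Sum>k<d. Re (cinner (A (c k)) (c k)))"
  shows "A = finite_rank {..<d} c (\<lambda>k. A (c k))"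
proof (rule psd_compression_finite_rank[OF A])
  let ?P = "sys_proj {..<d} c"
  have kill: "A (u - ?P u) = 0" for u
  proof (cases "u - ?P u = 0")
    case True
    then show ?thesis using bounded_clinear_zero[OF psdD(1)[OF A]] by simp
  next
    case False
    let ?w = "(1 / norm (u - ?P u)) *\<^sub>R (u - ?P u)"
    have w: "norm ?w = 1" using False by simp
    have orth: "cinner ?w (c i) = 0" if "i < d" for i
      unfolding cinner_scaleR_left
      using that by (subst sys_proj_orthogonal[OF c]) (auto intro: complex_vector.span_base)
    have "orthosys {..<Suc d} (c(d := ?w))"
      using c w orth cinner_commute[of "c _" ?w]
      by (auto simp: orthosys_def less_Suc_eq simp del: norm_scaleR)
    from tr[OF orthosys_imp_bessel[OF this]]
    have "(\<Sum>k<d. Re (cinner (A (c k)) (c k))) + Re (cinner (A ?w) ?w) \<le> s" by simp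
    then have "Re (cinner (A ?w) ?w) = 0" using ge psdD(3)[OF A, of ?w] by linarith
    then have "A ?w = 0" by (rule psd_form_eq_0[OF A])
    then show ?thesis using False by (simp add: bounded_clinear_scaleR[OF psdD(1)[OF A]])
  qed
  fix x
  have "cinner (A x - ?P (A x)) u = 0" for u
    using kill[of u]
    by (simp add: cinner_diff_left sys_proj_selfadjoint psdD(2)[OF A]
        bounded_clinear_diff[OF psdD(1)[OF A]])
  then have "A x - ?P (A x) = 0" by (metis cinner_self_eq_0)
  then show "?P (A x) = A x" by simp
qed

section \<open>Marginals of positive operators\<close>

text \<open>A relation to a basis sum, so that positivity, Fatou and trace comparisons are proved
  without the \<open>SOME\<close> in \<open>ptrace1\<close>.\<close>

definition is_ptrace ::
    "('a::chilbert_space \<Rightarrow> 'b::chilbert_space \<Rightarrow> 'c::chilbert_space) \<Rightarrow> (nat \<Rightarrow> 'a) \<Rightarrow>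
      ('c \<Rightarrow> 'c) \<Rightarrow> ('b \<Rightarrow> 'b) \<Rightarrow> bool"
  where "is_ptrace T a A D \<longleftrightarrow> bounded_clinear D \<and>
    (\<forall>y v. ((\<lambda>i. cinner (A (T (a i) y)) (T (a i) v)) has_sum cinner (D y) v) UNIV)"

lemma is_ptrace1_finite_rank:
  assumes "hilbert_tensor T" "complete_sys UNIV a" "A = finite_rank K z w"
  shows "is_ptrace T a A (ptrace1 T A)"
  using ptrace1_bounded_clinear[OF assms(1,3)] ptrace1_finite_rank_has_sum[OF assms]
  by (simp add: is_ptrace_def)

lemma is_ptrace2_finite_rank:
  assumes "hilbert_tensor T" "complete_sys UNIV b" "A = finite_rank K z w"
  shows "is_ptrace (\<lambda>y x. T x y) b A (ptrace2 T A)"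
  unfolding ptrace2_eq_ptrace1_flip
  by (rule is_ptrace1_finite_rank[OF hilbert_tensor_flip[OF assms(1)] assms(2,3)])

lemma is_ptrace_form:
  assumes "is_ptrace T a A D"
  shows "((\<lambda>i. Re (cinner (A (T (a i) y)) (T (a i) y))) has_sum Re (cinner (D y) y)) UNIV"
  using assms has_sum_Re unfolding is_ptrace_def by blast

lemma is_ptrace_psd:
  assumes A: "psd A" and D: "is_ptrace T a A D"
  shows "psd D"
proof (rule psdI)
  show "bounded_clinear D" using D by (simp add: is_ptrace_def)
  show "cinner (D x) y = cinner x (D y)" for x y
  proof -
    have "((\<lambda>i. cnj (cinner (A (T (a i) y)) (T (a i) x))) has_sum cnj (cinner (D y) x)) UNIV"
      using D by (simp add: is_ptrace_def)
    moreover have "cnj (cinner (A (T (a i) y)) (T (a i) x)) = cinner (A (T (a i) x)) (T (a i) y)" for i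
      unfolding psdD(2)[OF A, of "T (a i) x"] by (simp flip: cinner_commute)
    ultimately have "((\<lambda>i. cinner (A (T (a i) x)) (T (a i) y)) has_sum cnj (cinner (D y) x)) UNIV"
      by simp
    then have "cinner (D x) y = cnj (cinner (D y) x)"
      using D has_sum_unique unfolding is_ptrace_def by blast
    then show ?thesis by (simp flip: cinner_commute)
  qed
  show "0 \<le> Re (cinner (D x) x)" for x
    by (rule has_sum_nonneg[OF is_ptrace_form[OF D]]) (rule psdD(3)[OF A])
qed

lemma is_ptrace_partial_sum_le:
  assumes "psd A" "is_ptrace T a A D" "finite F"
  shows "(\<Sum>i\<in>F. Re (cinner (A (T (a i) y)) (T (a i) y))) \<le> Re (cinner (D y) y)"
  by (rule finite_sum_le_has_sum[OF is_ptrace_form[OF assms(2)] assms(3)])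
    (use psdD(3)[OF assms(1)] in auto)

lemma is_ptrace_weak_limit_le:
  assumes A: "\<And>k. psd (A k)" "\<And>k. is_ptrace T a (A k) (D k)" and L: "weak_limit A L" "is_ptrace T a L E"
    and le: "\<And>k. Re (cinner (D k y) y) \<le> \<beta> k" and \<beta>: "\<beta> \<longlonglongrightarrow> s"
  shows "Re (cinner (E y) y) \<le> s"
proof (rule has_sum_le_finite_sums[OF is_ptrace_form[OF L(2)]])
  fix F :: "nat set" assume "finite F"
  then show "(\<Sum>i\<in>F. Re (cinner (L (T (a i) y)) (T (a i) y))) \<le> s"
    using is_ptrace_partial_sum_le[OF A] le
    by (intro weak_limit_sum_le[OF L(1) _ \<beta>]) (meson order_trans)
qed

text \<open>A finite set of index pairs lies in a rectangle, positivity permits enlarging it, and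
  the sum over \<open>i\<close> for fixed \<open>j\<close> is a partial sum of the marginal's
  diagonal entry at \<open>b j\<close>.\<close>

lemma trace_le_ptrace:
  fixes T :: "'a::chilbert_space \<Rightarrow> 'b::chilbert_space \<Rightarrow> 'c::chilbert_space" and b :: "nat \<Rightarrow> 'b"
  assumes T: "hilbert_tensor T" "complete_sys UNIV a" "complete_sys UNIV b"
    and A: "psd A" "is_ptrace T a A D"
    and le: "\<And>G. finite G \<Longrightarrow> (\<Sum>j\<in>G. Re (cinner (D (b j)) (b j))) \<le> s" and f: "bessel I f"
  shows "(\<Sum>i\<in>I. Re (cinner (A (f i)) (f i))) \<le> s"
proof (rule psd_trace_le[OF A(1) complete_sys_tensor[OF T] _ f])
  fix F :: "(nat \<times> nat) set" assume F: "finite F"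
  let ?h = "\<lambda>(i, j). Re (cinner (A (T (a i) (b j))) (T (a i) (b j)))"
  have "sum ?h F \<le> sum ?h (fst ` F \<times> snd ` F)"
    using F psdD(3)[OF A(1)] by (intro sum_mono2) (auto intro: rev_image_eqI)
  also have "\<dots> = (\<Sum>j\<in>snd ` F. \<Sum>i\<in>fst ` F. ?h (i, j))"
    by (simp add: sum.cartesian_product[symmetric] sum.swap[of _ "fst ` F"])
  also have "\<dots> \<le> (\<Sum>j\<in>snd ` F. Re (cinner (D (b j)) (b j)))"
    using F is_ptrace_partial_sum_le[OF A] by (intro sum_mono) simp
  also have "\<dots> \<le> s" using F by (intro le) simp
  finally show "(\<Sum>p\<in>F. Re (cinner (A (case p of (i, j) \<Rightarrow> T (a i) (b j)))
      (case p of (i, j) \<Rightarrow> T (a i) (b j)))) \<le> s"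
    by (simp add: case_prod_unfold)
qed

text \<open>If \<open>D\<close> fell short of \<open>R\<close> at some \<open>b j\<close>, the total
  mass of \<open>A\<close> would be at most \<open>s\<close> minus that deficit, against the mass
  \<open>s\<close> found on \<open>f\<close>. So \<open>R - D\<close> has zero form at every
  \<open>b j\<close> and, being positive, vanishes there.\<close>

lemma ptrace_eqI:
  fixes T :: "'a::chilbert_space \<Rightarrow> 'b::chilbert_space \<Rightarrow> 'c::chilbert_space" and b :: "nat \<Rightarrow> 'b"
  assumes T: "hilbert_tensor T" "complete_sys UNIV a" "complete_sys UNIV b"
    and A: "psd A" "is_ptrace T a A D" and R: "psd R"
    and D_le: "\<And>y. Re (cinner (D y) y) \<le> Re (cinner (R y) y)"
    and R_le: "\<And>G. finite G \<Longrightarrow> (\<Sum>j\<in>G. Re (cinner (R (b j)) (b j))) \<le> s"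
    and f: "bessel I f" "s \<le> (\<Sum>i\<in>I. Re (cinner (A (f i)) (f i)))"
  shows "D = R"
proof -
  let ?E = "\<lambda>y. R y - D y"
  note D = is_ptrace_psd[OF A]
  have E: "psd ?E"
  proof (rule psdI)
    show "bounded_clinear ?E" by (rule bounded_clinear_diff_fun[OF psdD(1)[OF R] psdD(1)[OF D]])
    show "cinner (?E x) y = cinner x (?E y)" for x y
      by (simp add: cinner_diff_left cinner_diff_right psdD(2)[OF R] psdD(2)[OF D])
    show "0 \<le> Re (cinner (?E x) x)" for x
      using D_le[of x] by (simp add: cinner_diff_left)
  qed
  have "D (b j) = R (b j)" for j
  proof -
    let ?\<delta> = "Re (cinner (?E (b j)) (b j))"
    \<comment> \<open>\<open>G\<close> is enlarged by \<open>j\<close> in the proof so that the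
      deficit at \<open>b j\<close> is always counted.\<close>
    have "(\<Sum>k\<in>G. Re (cinner (D (b k)) (b k))) \<le> s - ?\<delta>" if G: "finite G" for G
    proof -
      have "(\<Sum>k\<in>G. Re (cinner (D (b k)) (b k))) \<le> (\<Sum>k\<in>insert j G. Re (cinner (D (b k)) (b k)))"
        using G psdD(3)[OF D] by (intro sum_mono2) auto
      also have "\<dots> = (\<Sum>k\<in>insert j G. Re (cinner (R (b k)) (b k))) -
          (\<Sum>k\<in>insert j G. Re (cinner (?E (b k)) (b k)))"
        by (simp add: cinner_diff_left sum_subtractf)
      also have "\<dots> \<le> s - ?\<delta>"
        using G psdD(3)[OF E] by (intro diff_mono R_le member_le_sum) auto
      finally show ?thesis .
    qed
    from trace_le_ptrace[OF T A this f(1)] f(2) have "?\<delta> \<le> 0" by simp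
    then have "?\<delta> = 0" using psdD(3)[OF E, of "b j"] by simp
    from psd_form_eq_0[OF E this] show ?thesis by simp
  qed
  then show ?thesis
    using T(3) by (intro bounded_clinear_eq_on_dense[OF psdD(1)[OF D] psdD(1)[OF R]])
      (auto simp: complete_sys_def)
qed


section \<open>Truncations\<close>

lemma cspan_sgn_image:
  fixes e :: "'i \<Rightarrow> 'a::complex_inner"
  shows "cspan ((\<lambda>i. sgn (e i)) ` S) = cspan (e ` S)"
proof (rule antisym)
  show "cspan ((\<lambda>i. sgn (e i)) ` S) \<subseteq> cspan (e ` S)"
    by (rule complex_vector.span_minimal[OF _ complex_vector.subspace_span])
      (auto simp: sgn_eq_scaleC intro!: complex_vector.span_scale intro: complex_vector.span_base)
  have "e i \<in> cspan ((\<lambda>i. sgn (e i)) ` S)" if "i \<in> S" for i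
  proof -
    have "complex_of_real (norm (e i)) *\<^sub>C sgn (e i) \<in> cspan ((\<lambda>i. sgn (e i)) ` S)"
      using that by (intro complex_vector.span_scale complex_vector.span_base) auto
    moreover have "complex_of_real (norm (e i)) *\<^sub>C sgn (e i) = e i"
      by (cases "e i = 0") (auto simp: sgn_eq_scaleC scaleC_scaleC simp flip: of_real_mult)
    ultimately show ?thesis by simp
  qed
  then show "cspan (e ` S) \<subseteq> cspan ((\<lambda>i. sgn (e i)) ` S)"
    by (intro complex_vector.span_minimal) auto
qed

text \<open>\<open>sgn\<close> normalizes the basis vectors and keeps the zero padding.\<close>

lemma countable_orthogonal_basis_complete_sys:
  assumes "countable_orthogonal_basis e"
  shows "complete_sys UNIV (\<lambda>i. sgn (e i))"
proof -
  have "cinner (sgn (e i)) (sgn (e j)) = 0" if "i \<noteq> j" for i j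
    using assms that
    by (simp add: countable_orthogonal_basis_def sgn_eq_scaleC cinner_scaleC_left cinner_scaleC_right)
  then have "orthosys UNIV (\<lambda>i. sgn (e i))" by (auto simp: orthosys_def norm_sgn)
  then show ?thesis
    using assms cspan_sgn_image[of e UNIV]
    by (simp add: countable_orthogonal_basis_def complete_sys_def)
qed

lemma trunc_proj_eq_sys_proj:
  assumes "countable_orthogonal_basis e"
  shows "trunc_proj e n = sys_proj {..<n} (\<lambda>i. sgn (e i))"
proof -
  have "orthosys {..<n} (\<lambda>i. sgn (e i))"
    using countable_orthogonal_basis_complete_sys[OF assms] orthosys_subset
    unfolding complete_sys_def by blast
  from orth_proj_span[OF this] show ?thesis by (simp add: trunc_proj_def cspan_sgn_image)
qed

lemma sys_proj_tensor:
  assumes T: "hilbert_tensor T" and "finite I" "finite J"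
  shows "sys_proj (I \<times> J) (\<lambda>(i, j). T (a i) (b j)) (T x y) = T (sys_proj I a x) (sys_proj J b y)"
proof -
  have "T (sys_proj I a x) (sys_proj J b y) =
      (\<Sum>i\<in>I. \<Sum>j\<in>J. T (cinner x (a i) *\<^sub>C a i) (cinner y (b j) *\<^sub>C b j))"
    unfolding sys_proj_def bounded_clinear_sum[OF bounded_clinear_tensor_left[OF T]]
      bounded_clinear_sum[OF bounded_clinear_tensor_right[OF T]] by (rule sum.swap)
  then show ?thesis
    by (simp add: sys_proj_def sum.cartesian_product cinner_tensor[OF T] tensor_scaleC_left[OF T]
        tensor_scaleC_right[OF T] scaleC_scaleC case_prod_unfold mult.commute)
qed

lemma tensor_op_sys_proj:
  assumes T: "hilbert_tensor T" and "finite I" "finite J"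
  shows "tensor_op T (sys_proj I a) (sys_proj J b) = sys_proj (I \<times> J) (\<lambda>(i, j). T (a i) (b j))"
  unfolding tensor_op_def
proof (rule the_equality)
  fix C assume C: "bounded_clinear C \<and> (\<forall>x y. C (T x y) = T (sys_proj I a x) (sys_proj J b y))"
  then show "C = sys_proj (I \<times> J) (\<lambda>(i, j). T (a i) (b j))"
    by (intro bounded_clinear_eq_on_dense[OF _ bounded_clinear_sys_proj tensor_dense[OF T]])
      (auto simp: sys_proj_tensor[OF assms])
qed (simp add: bounded_clinear_sys_proj sys_proj_tensor[OF assms])

lemma sys_proj_tendsto:
  assumes e: "complete_sys UNIV e" and F: "\<And>n. finite (F n)"
    and ev: "\<And>i. \<forall>\<^sub>F n in sequentially. i \<in> F n"
  shows "(\<lambda>n. sys_proj (F n) e x) \<longlonglongrightarrow> x"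
proof -
  have "\<forall>\<^sub>F n in sequentially. X \<subseteq> F n" if "finite X" for X
    using eventually_ball_finite[OF that, of "\<lambda>n i. i \<in> F n"] ev by (auto simp: subset_eq)
  then have "filterlim F (finite_subsets_at_top UNIV) sequentially"
    using F by (simp add: filterlim_finite_subsets_at_top)
  then show ?thesis
    using complete_sys_expansion[OF e, of x]
    by (simp add: has_sum_def sys_proj_def filterlim_compose)
qed


section \<open>The sequence of semidefinite programs\<close>

locale coupling_sdp =
  fixes T :: "'a::chilbert_space \<Rightarrow> 'b::chilbert_space \<Rightarrow> 'c::chilbert_space"
    and a :: "nat \<Rightarrow> 'a" and b :: "nat \<Rightarrow> 'b" and \<rho>1 :: "'a \<Rightarrow> 'a" and \<rho>2 :: "'b \<Rightarrow> 'b"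
  assumes T: "hilbert_tensor T" and a: "complete_sys UNIV a" and b: "complete_sys UNIV b"
    and \<rho>1: "psd \<rho>1" "trace_class \<rho>1" "ctrace \<rho>1 = 1"
    and \<rho>2: "psd \<rho>2" "trace_class \<rho>2" "ctrace \<rho>2 = 1"
begin

definition t :: "nat \<times> nat \<Rightarrow> 'c" where "t = (\<lambda>(i, j). T (a i) (b j))"

definition Q :: "nat \<Rightarrow> 'c \<Rightarrow> 'c" where "Q n = sys_proj ({..<n} \<times> {..<n}) t"

abbreviation "P1 n \<equiv> sys_proj {..<n} a"
abbreviation "P2 n \<equiv> sys_proj {..<n} b"

text \<open>Here the condition of being a compression becomes the invariance
  \<open>Q n \<circ> X \<circ> Q n = X\<close>, and the Loewner constraints become inequalities of
  quadratic forms; in this shape both can be checked on weak limits.\<close>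

definition feasible :: "nat \<Rightarrow> ('c \<Rightarrow> 'c) set"
  where "feasible n = {X. psd X \<and> Q n \<circ> X \<circ> Q n = X \<and>
    (\<forall>y. Re (cinner (ptrace2 T X y) y) \<le> Re (cinner (\<rho>1 (P1 n y)) (P1 n y))) \<and>
    (\<forall>y. Re (cinner (ptrace1 T X y) y) \<le> Re (cinner (\<rho>2 (P2 n y)) (P2 n y)))}"

lemma flip: "coupling_sdp (\<lambda>y x. T x y) b a \<rho>2 \<rho>1"
  by (simp add: coupling_sdp_def hilbert_tensor_flip T a b \<rho>1 \<rho>2)

lemma t_complete: "complete_sys UNIV t"
  using complete_sys_tensor[OF T a b] by (simp add: t_def)

lemma orthosys_a: "orthosys F a" and orthosys_b: "orthosys F b" and orthosys_t: "orthosys G t"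
  using a b t_complete orthosys_subset[OF _ subset_UNIV] unfolding complete_sys_def by blast+

lemma Q_bounded_clinear: "bounded_clinear (Q n)"
  unfolding Q_def by (rule bounded_clinear_sys_proj)

lemma Q_selfadjoint: "cinner (Q n x) y = cinner x (Q n y)"
  unfolding Q_def by (rule sys_proj_selfadjoint)

lemma Q_idem: "Q n (Q n x) = Q n x"
  unfolding Q_def by (rule sys_proj_idem[OF orthosys_t]) simp

lemma Q_tensor: "Q n (T x y) = T (P1 n x) (P2 n y)"
  unfolding Q_def t_def by (rule sys_proj_tensor[OF T]) auto

lemma Q_tendsto: "(\<lambda>n. Q n x) \<longlonglongrightarrow> x"
  unfolding Q_def
proof (rule sys_proj_tendsto[OF t_complete])
  show "\<forall>\<^sub>F n in sequentially. p \<in> {..<n} \<times> {..<n}" for p :: "nat \<times> nat"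
    using eventually_gt_at_top[of "fst p"] eventually_gt_at_top[of "snd p"]
    by eventually_elim (auto simp: mem_Times_iff)
qed simp

lemma P2_tendsto: "(\<lambda>n. P2 n y) \<longlonglongrightarrow> y"
  by (rule sys_proj_tendsto[OF b]) (auto intro: eventually_gt_at_top)

lemma Q_invariant_finite_rank:
  assumes X: "psd X" "Q n \<circ> X \<circ> Q n = X"
  shows "X = finite_rank ({..<n} \<times> {..<n}) t (\<lambda>p. X (t p))"
proof (rule psd_compression_finite_rank[OF X(1)])
  fix x
  have "X x = Q n (X (Q n x))" using fun_cong[OF X(2), of x] by simp
  then show "sys_proj ({..<n} \<times> {..<n}) t (X x) = X x"
    using Q_idem[of n "X (Q n x)"] by (simp add: Q_def[symmetric])
qed

lemma Q_invariant_is_ptrace1: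
  "psd X \<Longrightarrow> Q n \<circ> X \<circ> Q n = X \<Longrightarrow> is_ptrace T a X (ptrace1 T X)"
  by (rule is_ptrace1_finite_rank[OF T a Q_invariant_finite_rank])

lemma Q_invariant_is_ptrace2:
  "psd X \<Longrightarrow> Q n \<circ> X \<circ> Q n = X \<Longrightarrow> is_ptrace (\<lambda>y x. T x y) b X (ptrace2 T X)"
  by (rule is_ptrace2_finite_rank[OF T b Q_invariant_finite_rank])

lemma feasibleD:
  assumes "X \<in> feasible n"
  shows "psd X" "Q n \<circ> X \<circ> Q n = X" "is_ptrace T a X (ptrace1 T X)"
    "is_ptrace (\<lambda>y x. T x y) b X (ptrace2 T X)"
    "Re (cinner (ptrace1 T X y) y) \<le> Re (cinner (\<rho>2 (P2 n y)) (P2 n y))"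
    "Re (cinner (ptrace2 T X x) x) \<le> Re (cinner (\<rho>1 (P1 n x)) (P1 n x))"
  using assms Q_invariant_is_ptrace1[of X n] Q_invariant_is_ptrace2[of X n] by (auto simp: feasible_def)

lemma \<rho>2_bessel_le: "bessel I f \<Longrightarrow> (\<Sum>i\<in>I. Re (cinner (\<rho>2 (f i)) (f i))) \<le> 1"
  using psd_ctrace_bessel_le[OF \<rho>2(1,2)] \<rho>2(3) by simp

lemma feasible_bessel_le:
  assumes X: "X \<in> feasible n" and f: "bessel I f"
  shows "(\<Sum>i\<in>I. Re (cinner (X (f i)) (f i))) \<le> 1"
proof (rule trace_le_ptrace[OF T a b feasibleD(1,3)[OF X] _ f])
  fix G :: "nat set" assume G: "finite G"
  have "(\<Sum>j\<in>G. Re (cinner (ptrace1 T X (b j)) (b j))) \<le>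
      (\<Sum>j\<in>G. Re (cinner (\<rho>2 (P2 n (b j))) (P2 n (b j))))"
    by (intro sum_mono feasibleD(5)[OF X])
  also have "\<dots> \<le> 1"
    by (intro \<rho>2_bessel_le bessel_contraction[OF orthosys_imp_bessel[OF orthosys_b G]
        sys_proj_selfadjoint sys_proj_norm_le[OF orthosys_b]]) simp
  finally show "(\<Sum>j\<in>G. Re (cinner (ptrace1 T X (b j)) (b j))) \<le> 1" .
qed

lemma feasible_norm_le:
  assumes X: "X \<in> feasible n"
  shows "norm (X x) \<le> norm x"
proof -
  have "Re (cinner (X x) x) \<le> 1 * (norm x)\<^sup>2" for x
  proof (cases "x = 0")
    case False
    let ?u = "\<lambda>_ :: nat. (1 / norm x) *\<^sub>R x"
    have "bessel {0} ?u"
      using False by (intro orthosys_imp_bessel) (auto simp: orthosys_def)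
    from feasible_bessel_le[OF X this] False show ?thesis
      by (simp add: bounded_clinear_scaleR[OF psdD(1)[OF feasibleD(1)[OF X]]] cinner_scaleR_left
          cinner_scaleR_right field_simps power2_eq_square)
  qed simp
  from psd_norm_le[OF feasibleD(1)[OF X] this] show ?thesis by simp
qed

text \<open>Invariance comes first: it makes \<open>L\<close> of finite rank, so that its partial
  traces are basis sums, to which the Fatou argument applies.\<close>

lemma feasible_weak_limit:
  assumes X: "\<And>k. X k \<in> feasible n" and L: "weak_limit X L" "psd L"
  shows "L \<in> feasible n"
proof -
  have "cinner ((Q n \<circ> L \<circ> Q n) x) y = cinner (L x) y" for x y
  proof (rule LIMSEQ_unique)
    show "(\<lambda>k. cinner (X k x) y) \<longlonglongrightarrow> cinner (L x) y" using L(1) by (simp add: weak_limit_def)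
    have "cinner (X k x) y = cinner (X k (Q n x)) (Q n y)" for k
      using fun_cong[OF feasibleD(2)[OF X[of k]], of x] by (simp add: Q_selfadjoint[symmetric])
    then show "(\<lambda>k. cinner (X k x) y) \<longlonglongrightarrow> cinner ((Q n \<circ> L \<circ> Q n) x) y"
      using L(1) by (simp add: weak_limit_def Q_selfadjoint)
  qed
  then have inv: "Q n \<circ> L \<circ> Q n = L"
    by (intro ext, rule cinner_eqI)
  show ?thesis
    unfolding feasible_def
  proof (intro CollectI conjI allI L(2) inv)
    show "Re (cinner (ptrace2 T L y) y) \<le> Re (cinner (\<rho>1 (P1 n y)) (P1 n y))" for y
      by (rule is_ptrace_weak_limit_le[OF feasibleD(1)[OF X] feasibleD(4)[OF X] L(1)
            Q_invariant_is_ptrace2[OF L(2) inv] feasibleD(6)[OF X] tendsto_const])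
    show "Re (cinner (ptrace1 T L y) y) \<le> Re (cinner (\<rho>2 (P2 n y)) (P2 n y))" for y
      by (rule is_ptrace_weak_limit_le[OF feasibleD(1)[OF X] feasibleD(3)[OF X] L(1)
            Q_invariant_is_ptrace1[OF L(2) inv] feasibleD(5)[OF X] tendsto_const])
  qed
qed

lemma feasible_nonempty: "(\<lambda>x. 0) \<in> feasible n"
proof -
  have "psd (\<lambda>x :: 'c. 0 :: 'c)" by (rule psdI) (auto simp: bounded_clinear_0)
  moreover have "ptrace1 T (\<lambda>x. 0) = (\<lambda>y. 0)" "ptrace2 T (\<lambda>x. 0) = (\<lambda>y. 0)"
    using ptrace1_zero[OF T] ptrace1_zero[OF hilbert_tensor_flip[OF T]]
    by (auto simp: ptrace2_eq_ptrace1_flip)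
  ultimately show ?thesis
    using psdD(3)[OF \<rho>1(1)] psdD(3)[OF \<rho>2(1)] bounded_clinear_zero[OF Q_bounded_clinear]
    by (auto simp: feasible_def)
qed

definition objective :: "nat \<Rightarrow> (nat \<Rightarrow> 'c) \<Rightarrow> ('c \<Rightarrow> 'c) \<Rightarrow> real"
  where "objective d g X = (\<Sum>k<d. Re (cinner (X (g k)) (g k)))"

text \<open>A maximizing sequence has a weakly convergent subsequence whose limit is feasible, and
  the objective, a finite sum of diagonal entries, is weakly continuous.\<close>

lemma objective_max_exists:
  assumes g: "orthosys {..<d} g"
  shows "\<exists>X\<in>feasible n. \<forall>Y\<in>feasible n. objective d g Y \<le> objective d g X"
proof -
  define s where "s = (SUP X\<in>feasible n. objective d g X)"
  have bdd: "bdd_above (objective d g ` feasible n)"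
    using feasible_bessel_le[OF _ orthosys_imp_bessel[OF g]]
    by (auto simp: objective_def intro!: bdd_aboveI[of _ 1])
  have "\<exists>X\<in>feasible n. s - 1 / Suc k < objective d g X" for k
  proof -
    have "s - 1 / Suc k < s" by simp
    then show ?thesis
      unfolding s_def[symmetric]
      using less_cSUP_iff[OF _ bdd, of "s - 1 / Suc k"] feasible_nonempty[of n]
      by (auto simp flip: s_def)
  qed
  then obtain X where X: "\<And>k. X k \<in> feasible n" "\<And>k. s - 1 / Suc k < objective d g (X k)"
    by metis
  obtain r L where r: "strict_mono r" and L: "weak_limit (X \<circ> r) L" "psd L"
    by (rule weak_compactness[OF feasibleD(1)[OF X(1)] feasible_norm_le[OF X(1)] t_complete])
  have "L \<in> feasible n" by (rule feasible_weak_limit[OF _ L]) (simp add: X(1))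
  moreover have "s \<le> objective d g L"
  proof (rule LIMSEQ_le)
    show "(\<lambda>k. s - 1 / Suc (r k)) \<longlonglongrightarrow> s"
      using tendsto_diff[OF tendsto_const LIMSEQ_subseq_LIMSEQ[OF LIMSEQ_Suc[OF lim_1_over_n] r], of s]
      by (simp add: comp_def)
    show "(\<lambda>k. objective d g (X (r k))) \<longlonglongrightarrow> objective d g L"
      using L(1) unfolding objective_def weak_limit_def comp_def
      by (intro tendsto_sum tendsto_Re) blast
  qed (use X(2) less_imp_le in blast)
  moreover have "objective d g Y \<le> s" if "Y \<in> feasible n" for Y
    unfolding s_def by (rule cSUP_upper[OF that bdd])
  ultimately show ?thesis by (meson order_trans)
qed

text \<open>\<open>Q n\<close> maps \<open>T (a i) y\<close> to \<open>T (a i) (P2 n y)\<close> for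
  \<open>i < n\<close> and to zero otherwise. The compressed marginal thus lacks the nonnegative
  terms with \<open>i \<ge> n\<close>, which is why the constraints are inequalities.\<close>

lemma compression_ptrace_le:
  assumes \<rho>: "psd \<rho>" "is_ptrace T a \<rho> D" and X: "X = Q n \<circ> \<rho> \<circ> Q n" "is_ptrace T a X E"
  shows "Re (cinner (E y) y) \<le> Re (cinner (D (P2 n y)) (P2 n y))"
proof (rule has_sum_mono[OF is_ptrace_form[OF X(2)] is_ptrace_form[OF \<rho>(2)]])
  fix i
  have "P1 n (a i) = (if i < n then a i else 0)"
  proof (cases "i < n")
    case False
    then show ?thesis
      using orthosys_a[of UNIV] by (auto simp: sys_proj_def orthosys_def intro!: sum.neutral)
  qed (simp add: sys_proj_base[OF orthosys_a])
  then have "Q n (T (a i) y) = (if i < n then T (a i) (P2 n y) else 0)"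
    by (simp add: Q_tensor tensor_zero[OF T])
  moreover have "cinner (X (T (a i) y)) (T (a i) y) = cinner (\<rho> (Q n (T (a i) y))) (Q n (T (a i) y))"
    by (simp add: X(1) Q_selfadjoint)
  ultimately show "Re (cinner (X (T (a i) y)) (T (a i) y)) \<le>
      Re (cinner (\<rho> (T (a i) (P2 n y))) (T (a i) (P2 n y)))"
    using psdD(3)[OF \<rho>(1)] by simp
qed

end

section \<open>The two implications\<close>

context coupling_sdp
begin

text \<open>The flipped sum runs over swapped index pairs; agreement on elementary tensors and
  density avoid any reindexing.\<close>

lemma Q_flip: "coupling_sdp.Q (\<lambda>y x. T x y) b a n = Q n"
proof -
  interpret fl: coupling_sdp "\<lambda>y x. T x y" b a \<rho>2 \<rho>1 by (rule flip)
  show ?thesis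
  proof (rule bounded_clinear_eq_on_dense[OF fl.Q_bounded_clinear Q_bounded_clinear tensor_dense[OF T]])
    show "fl.Q n z = Q n z" if "z \<in> {T x y |x y. True}" for z
      using that fl.Q_tensor Q_tensor by auto
  qed
qed

lemma objective_finite_rank:
  assumes X: "psd X" and c: "orthosys {..<d} c" "\<And>x. X x \<in> cspan (c ` {..<d})"
  shows "complex_of_real (objective d c X) = ctrace X"
proof -
  have "X = finite_rank {..<d} c (\<lambda>k. X (c k))"
    by (rule psd_compression_finite_rank[OF X sys_proj_id[OF c(1) _ c(2)]]) simp
  then have "ctrace X = (\<Sum>k<d. cinner (c k) (X (c k)))" using ctrace_finite_rank by metis
  also have "\<dots> = (\<Sum>k<d. complex_of_real (Re (cinner (X (c k)) (c k))))"
  proof (rule sum.cong[OF refl])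
    fix k
    show "cinner (c k) (X (c k)) = complex_of_real (Re (cinner (X (c k)) (c k)))"
      using selfadjoint_cinner_real[OF psdD(2)[OF X], of "c k"] psdD(2)[OF X, of "c k" "c k"] by simp
  qed
  finally show ?thesis by (simp add: objective_def)
qed

lemma coupling_imp_limit:
  assumes c: "orthosys {..<d} c"
    and g: "\<And>n. orthosys {..<d} (g n)" "\<And>n. cspan (g n ` {..<d}) = Q n ` cspan (c ` {..<d})"
    and \<mu>: "\<And>n. \<exists>X\<in>feasible n. \<mu> n = objective d (g n) X"
      "\<And>n X. X \<in> feasible n \<Longrightarrow> objective d (g n) X \<le> \<mu> n"
    and \<rho>: "psd \<rho>" "ctrace \<rho> = 1" "ptrace1 T \<rho> = \<rho>2" "ptrace2 T \<rho> = \<rho>1"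
      "op_support \<rho> \<subseteq> cspan (c ` {..<d})"
  shows "\<mu> \<longlonglongrightarrow> 1"
proof (rule tendsto_sandwich)
  have range: "\<rho> x \<in> cspan (c ` {..<d})" for x
    using \<rho>(5) closure_subset[of "range \<rho>"] by (auto simp: op_support_def)
  have fr: "\<rho> = finite_rank {..<d} c (\<lambda>k. \<rho> (c k))"
    by (rule psd_compression_finite_rank[OF \<rho>(1) sys_proj_id[OF c _ range]]) simp
  have \<rho>_ptrace: "is_ptrace T a \<rho> \<rho>2" "is_ptrace (\<lambda>y x. T x y) b \<rho> \<rho>1"
    using is_ptrace1_finite_rank[OF T a fr] is_ptrace2_finite_rank[OF T b fr] \<rho>(3,4) by auto
  define X where "X n = Q n \<circ> \<rho> \<circ> Q n" for n
  have X_psd: "psd (X n)" for n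
    unfolding X_def by (rule psd_conjugate[OF \<rho>(1) Q_bounded_clinear Q_selfadjoint])
  have X_inv: "Q n \<circ> X n \<circ> Q n = X n" for n by (auto simp: X_def Q_idem)
  have X_feasible: "X n \<in> feasible n" for n
    unfolding feasible_def
  proof (intro CollectI conjI allI X_psd X_inv)
    show "Re (cinner (ptrace1 T (X n) y) y) \<le> Re (cinner (\<rho>2 (P2 n y)) (P2 n y))" for y
      by (rule compression_ptrace_le[OF \<rho>(1) \<rho>_ptrace(1) X_def
            Q_invariant_is_ptrace1[OF X_psd X_inv]])
    have X_flip: "X n = coupling_sdp.Q (\<lambda>y x. T x y) b a n \<circ> \<rho> \<circ> coupling_sdp.Q (\<lambda>y x. T x y) b a n"
      by (simp add: X_def Q_flip)
    show "Re (cinner (ptrace2 T (X n) y) y) \<le> Re (cinner (\<rho>1 (P1 n y)) (P1 n y))" for y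
      by (rule coupling_sdp.compression_ptrace_le[OF flip \<rho>(1) \<rho>_ptrace(2) X_flip
            Q_invariant_is_ptrace2[OF X_psd X_inv]])
  qed
  \<comment> \<open>Moving both factors \<open>Q n\<close> onto the vectors turns the trace into a
    finite sum that converges along with \<open>Q n\<close>.\<close>
  have "ctrace (X n) = (\<Sum>k<d. cinner (Q n (c k)) (Q n (\<rho> (c k))))" for n
  proof -
    have "X n = finite_rank {..<d} (\<lambda>k. Q n (c k)) (\<lambda>k. Q n (\<rho> (c k)))"
    proof
      fix z
      have "X n z = Q n (\<Sum>k<d. cinner (Q n z) (\<rho> (c k)) *\<^sub>C c k)"
        using fun_cong[OF fr, of "Q n z"] by (simp add: X_def finite_rank_def rank1_def)
      then show "X n z = finite_rank {..<d} (\<lambda>k. Q n (c k)) (\<lambda>k. Q n (\<rho> (c k))) z"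
        by (simp add: bounded_clinear_sum[OF Q_bounded_clinear] bounded_clinear_scaleC[OF Q_bounded_clinear]
            finite_rank_def rank1_def Q_selfadjoint)
    qed
    then show ?thesis by (simp add: ctrace_finite_rank)
  qed
  \<comment> \<open>The range of \<open>X n\<close> lies in the span of \<open>g n\<close>, as that
    of \<rho> lies in the span of \<open>c\<close>; so the objective captures the full
    trace.\<close>
  moreover have "complex_of_real (objective d (g n) (X n)) = ctrace (X n)" for n
  proof (rule objective_finite_rank[OF X_psd g(1)])
    show "X n x \<in> cspan (g n ` {..<d})" for x
      unfolding g(2) by (simp add: X_def range)
  qed
  ultimately have obj: "objective d (g n) (X n) = Re (\<Sum>k<d. cinner (Q n (c k)) (Q n (\<rho> (c k))))" for n
    by (metis Re_complex_of_real)
  have "(\<lambda>n. Re (\<Sum>k<d. cinner (Q n (c k)) (Q n (\<rho> (c k))))) \<longlonglongrightarrow>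
      Re (\<Sum>k<d. cinner (c k) (\<rho> (c k)))"
    by (intro tendsto_Re tendsto_sum tendsto_cinner Q_tendsto)
  moreover have "(\<Sum>k<d. cinner (c k) (\<rho> (c k))) = 1"
    using ctrace_finite_rank[of "{..<d}" c "\<lambda>k. \<rho> (c k)"] \<rho>(2) fr by simp
  ultimately show "(\<lambda>n. objective d (g n) (X n)) \<longlonglongrightarrow> 1" by (simp add: obj)
  show "\<forall>\<^sub>F n in sequentially. objective d (g n) (X n) \<le> \<mu> n"
    using \<mu>(2)[OF X_feasible] by simp
  have "\<mu> n \<le> 1" for n
    using \<mu>(1)[of n] feasible_bessel_le[OF _ orthosys_imp_bessel[OF g(1)]]
    by (auto simp: objective_def)
  then show "\<forall>\<^sub>F n in sequentially. \<mu> n \<le> 1" by simp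
qed simp

lemma weak_limit_marginal:
  assumes X: "\<And>k. X k \<in> feasible (r k)" and r: "filterlim r sequentially sequentially"
    and L: "weak_limit X L" "psd L" "L = finite_rank K z w"
    and f: "bessel I f" "1 \<le> (\<Sum>i\<in>I. Re (cinner (L (f i)) (f i)))"
  shows "ptrace1 T L = \<rho>2"
proof (rule ptrace_eqI[OF T a b L(2) is_ptrace1_finite_rank[OF T a L(3)] \<rho>2(1) _ _ f])
  show "Re (cinner (ptrace1 T L y) y) \<le> Re (cinner (\<rho>2 y) y)" for y
  proof (rule is_ptrace_weak_limit_le[OF feasibleD(1)[OF X] feasibleD(3)[OF X] L(1)
          is_ptrace1_finite_rank[OF T a L(3)] feasibleD(5)[OF X]])
    have "(\<lambda>k. P2 (r k) y) \<longlonglongrightarrow> y" by (rule filterlim_compose[OF P2_tendsto r])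
    then show "(\<lambda>k. Re (cinner (\<rho>2 (P2 (r k) y)) (P2 (r k) y))) \<longlonglongrightarrow> Re (cinner (\<rho>2 y) y)"
      by (intro tendsto_Re tendsto_cinner bounded_clinear_tendsto[OF psdD(1)[OF \<rho>2(1)]])
  qed
  show "(\<Sum>j\<in>G. Re (cinner (\<rho>2 (b j)) (b j))) \<le> 1" if "finite G" for G
    by (rule \<rho>2_bessel_le[OF orthosys_imp_bessel[OF orthosys_b that]])
qed

lemma feasible_flip:
  assumes "X \<in> feasible n"
  shows "X \<in> coupling_sdp.feasible (\<lambda>y x. T x y) b a \<rho>2 \<rho>1 n"
proof -
  show ?thesis
    using assms unfolding feasible_def coupling_sdp.feasible_def[OF flip] Q_flip
    by (simp add: ptrace2_eq_ptrace1_flip)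
qed

text \<open>Closeness of \<open>Q n\<close> to the identity is relative to the norm of the preimage
  \<open>x\<close>, while only \<open>y\<close> is known to be bounded. The condition
  \<open>\<epsilon> \<le> 1 / 2\<close> gives \<open>norm x \<le> norm y + norm x / 2\<close>, hence
  \<open>norm x \<le> 2\<close>, which is the source of the factor 2.\<close>

lemma compression_near_subspace:
  fixes d :: nat
  assumes c: "orthosys {..<d} c" and y: "y \<in> Q n ` cspan (c ` {..<d})" "norm y \<le> 1"
    and \<epsilon>: "(\<Sum>k<d. norm (Q n (c k) - c k)) \<le> \<epsilon>" "\<epsilon> \<le> 1 / 2"
  shows "norm (y - sys_proj {..<d} c y) \<le> 2 * \<epsilon>"
proof -
  obtain x where x: "x \<in> cspan (c ` {..<d})" "y = Q n x" using y by blast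
  have "x = (\<Sum>k<d. cinner x (c k) *\<^sub>C c k)"
    using sys_proj_id[OF c finite_lessThan x(1)] by (simp add: sys_proj_def)
  then have "y - x = (\<Sum>k<d. cinner x (c k) *\<^sub>C (Q n (c k) - c k))"
    unfolding x(2) complex_vector.scale_right_diff_distrib sum_subtractf
    by (metis (no_types, lifting) bounded_clinear_sum[OF Q_bounded_clinear]
        bounded_clinear_scaleC[OF Q_bounded_clinear] sum.cong)
  then have "norm (y - x) \<le> (\<Sum>k<d. norm (cinner x (c k) *\<^sub>C (Q n (c k) - c k)))"
    by (simp only: norm_sum)
  also have "\<dots> \<le> (\<Sum>k<d. norm x * norm (Q n (c k) - c k))"
  proof (rule sum_mono)
    fix k assume "k \<in> {..<d}"
    then have "norm (c k) \<le> 1" by (rule orthosys_norm_le[OF c])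
    then have "cmod (cinner x (c k)) \<le> norm x * 1"
      by (intro order_trans[OF Cauchy_Schwarz_cinner] mult_left_mono) auto
    then show "norm (cinner x (c k) *\<^sub>C (Q n (c k) - c k)) \<le> norm x * norm (Q n (c k) - c k)"
      by (simp add: mult_right_mono)
  qed
  also have "\<dots> \<le> norm x * \<epsilon>"
    unfolding sum_distrib_left[symmetric] by (intro mult_left_mono \<epsilon>) simp
  finally have yx: "norm (y - x) \<le> norm x * \<epsilon>" .
  also have "\<dots> \<le> norm x * (1 / 2)" by (intro mult_left_mono \<epsilon>) simp
  finally have "norm x \<le> 2" using y(2) norm_triangle_ineq2[of x y] by (simp add: norm_minus_commute)
  moreover have "0 \<le> \<epsilon>" by (rule order_trans[OF _ \<epsilon>(1)]) (simp add: sum_nonneg)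
  ultimately have "norm (y - x) \<le> 2 * \<epsilon>"
    using yx mult_right_mono[of "norm x" 2 \<epsilon>] by linarith
  moreover have "norm (y - sys_proj {..<d} c y) \<le> norm (y - x)"
    by (rule sys_proj_best_approximation[OF c _ x(1)]) simp
  ultimately show ?thesis by linarith
qed

lemma limit_imp_coupling:
  assumes c: "orthosys {..<d} c"
    and g: "\<And>n. orthosys {..<d} (g n)" "\<And>n. cspan (g n ` {..<d}) = Q n ` cspan (c ` {..<d})"
    and \<mu>: "\<And>n. \<exists>X\<in>feasible n. \<mu> n = objective d (g n) X" and lim: "\<mu> \<longlonglongrightarrow> 1"
  shows "\<exists>\<rho>. psd \<rho> \<and> trace_class \<rho> \<and> ctrace \<rho> = 1 \<and> ptrace1 T \<rho> = \<rho>2 \<and> ptrace2 T \<rho> = \<rho>1 \<and>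
    op_support \<rho> \<subseteq> cspan (c ` {..<d})"
proof -
  obtain X where X: "\<And>n. X n \<in> feasible n" "\<And>n. \<mu> n = objective d (g n) (X n)"
    using \<mu> by metis
  obtain r L where r: "strict_mono r" and L: "weak_limit (X \<circ> r) L" "psd L"
    by (rule weak_compactness[OF feasibleD(1)[OF X(1)] feasible_norm_le[OF X(1)] t_complete])
  have Xr: "(X \<circ> r) k \<in> feasible (r k)" for k by (simp add: X(1))
  have rlim: "filterlim r sequentially sequentially" by (rule filterlim_subseq[OF r])
  \<comment> \<open>Used twice: with \<open>c\<close> for the mass on the subspace, and with one
    further vector to exclude mass outside it.\<close>
  have L_le: "(\<Sum>i\<in>I. Re (cinner (L (f i)) (f i))) \<le> 1" if "bessel I f" for I :: "nat set" and f
    by (rule weak_limit_sum_le[OF L(1) feasible_bessel_le[OF Xr that] tendsto_const])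
  define \<epsilon> where "\<epsilon> n = (\<Sum>k<d. norm (Q n (c k) - c k))" for n
  have "\<epsilon> \<longlonglongrightarrow> (\<Sum>k<d. norm (c k - c k))"
    unfolding \<epsilon>_def by (intro tendsto_intros Q_tendsto)
  then have \<epsilon>: "\<epsilon> \<longlonglongrightarrow> 0" by simp
  \<comment> \<open>Each of the \<open>d\<close> vectors is within \<open>2 * \<epsilon> n\<close>
    of the subspace and contributes an error of twice that distance, which makes
    \<open>4 * d\<close>.\<close>
  have bound: "\<mu> n \<le> objective d c (X n) + real (4 * d) * \<epsilon> n" if n: "\<epsilon> n \<le> 1 / 2" for n
  proof -
    have "norm (g n l - sys_proj {..<d} c (g n l)) \<le> 2 * \<epsilon> n" if "l \<in> {..<d}" for l
    proof (rule compression_near_subspace[OF c])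
      show "g n l \<in> Q n ` cspan (c ` {..<d})"
        unfolding g(2)[symmetric] using that by (intro complex_vector.span_base) blast
      show "norm (g n l) \<le> 1" by (rule orthosys_norm_le[OF g(1) that])
    qed (use n in \<open>simp_all add: \<epsilon>_def\<close>)
    from psd_sum_on_approximate_subspace[OF feasibleD(1)[OF X(1)] feasible_norm_le[OF X(1)] g(1) _ c _ this,
        of n]
    show ?thesis by (simp add: X(2) objective_def mult.assoc)
  qed
  have "1 \<le> objective d c L"
  proof (rule tendsto_le[OF sequentially_bot])
    show "(\<lambda>k. \<mu> (r k)) \<longlonglongrightarrow> 1" by (rule filterlim_compose[OF lim rlim])
    have "(\<lambda>k. objective d c (X (r k))) \<longlonglongrightarrow> objective d c L"
      using L(1) unfolding objective_def weak_limit_def comp_def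
      by (intro tendsto_sum tendsto_Re) blast
    moreover have \<epsilon>r: "(\<lambda>k. \<epsilon> (r k)) \<longlonglongrightarrow> 0" by (rule filterlim_compose[OF \<epsilon> rlim])
    ultimately have "(\<lambda>k. objective d c (X (r k)) + real (4 * d) * \<epsilon> (r k)) \<longlonglongrightarrow>
        objective d c L + real (4 * d) * 0"
      by (intro tendsto_intros)
    then show "(\<lambda>k. objective d c (X (r k)) + real (4 * d) * \<epsilon> (r k)) \<longlonglongrightarrow> objective d c L"
      by simp
    have "\<forall>\<^sub>F k in sequentially. \<epsilon> (r k) < 1 / 2"
      using order_tendstoD(2)[OF \<epsilon>r, of "1 / 2"] by simp
    then show "\<forall>\<^sub>F k in sequentially. \<mu> (r k) \<le> objective d c (X (r k)) + real (4 * d) * \<epsilon> (r k)"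
      by eventually_elim (rule bound, simp)
  qed
  then have ge: "1 \<le> (\<Sum>k<d. Re (cinner (L (c k)) (c k)))" by (simp add: objective_def)
  have bc: "bessel {..<d} c" by (rule orthosys_imp_bessel[OF c]) simp
  \<comment> \<open>From here on \<open>L\<close> is known to have finite rank, and its trace and
    partial traces become accessible.\<close>
  have L_fr: "L = finite_rank {..<d} c (\<lambda>k. L (c k))"
    by (rule psd_supported_on_span[OF L(2) L_le c ge])
  have range: "L x \<in> cspan (c ` {..<d})" for x
    by (subst L_fr) (auto simp: finite_rank_def rank1_def
        intro!: complex_vector.span_sum complex_vector.span_scale intro: complex_vector.span_base)
  have "objective d c L = 1"
    using ge L_le[OF bc] by (simp add: objective_def)
  then have "ctrace L = 1"
    using objective_finite_rank[OF L(2) c range] by simp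
  moreover have "trace_class L" by (subst L_fr) (rule trace_class_finite_rank)
  moreover have "ptrace1 T L = \<rho>2"
    by (rule weak_limit_marginal[OF Xr rlim L L_fr bc ge])
  moreover have "ptrace2 T L = \<rho>1"
    unfolding ptrace2_eq_ptrace1_flip
    by (rule coupling_sdp.weak_limit_marginal[OF flip feasible_flip[OF Xr] rlim L L_fr bc ge])
  moreover have "op_support L \<subseteq> cspan (c ` {..<d})"
    unfolding op_support_def
    by (rule closure_minimal[OF _ closed_cspan_orthosys[OF c]]) (use range in auto)
  ultimately show ?thesis using L(2) by blast
qed

end

section \<open>Translation to the stated problem\<close>

lemma loewner_le_trunc_op_iff:
  fixes D R :: "'h::chilbert_space \<Rightarrow> 'h"
  assumes D: "psd D" and R: "psd R" and e: "countable_orthogonal_basis e"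
  shows "D \<preceq>\<^sub>L trunc_op e n R \<longleftrightarrow>
    (\<forall>y. Re (cinner (D y) y) \<le> Re (cinner (R (trunc_proj e n y)) (trunc_proj e n y)))"
proof -
  let ?P = "trunc_proj e n"
  have P: "bounded_clinear ?P" "\<And>x y. cinner (?P x) y = cinner x (?P y)"
    unfolding trunc_proj_eq_sys_proj[OF e] by (rule bounded_clinear_sys_proj sys_proj_selfadjoint)+
  note tr = psd_conjugate[OF R P]
  have form: "Re (cinner (trunc_op e n R y - D y) y) = Re (cinner (R (?P y)) (?P y)) - Re (cinner (D y) y)" for y
    by (simp add: trunc_op_def cinner_diff_left P(2))
  have "bounded_clinear (\<lambda>x. trunc_op e n R x - D x)"
    unfolding trunc_op_def by (rule bounded_clinear_diff_fun[OF psdD(1)[OF tr] psdD(1)[OF D]])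
  moreover have "selfadjoint (\<lambda>x. trunc_op e n R x - D x)"
    unfolding selfadjoint_def cinner_diff_left cinner_diff_right trunc_op_def
    by (simp only: psdD(2)[OF tr] psdD(2)[OF D] simp_thms)
  ultimately show ?thesis
    unfolding loewner_le_def psd_def form by simp
qed

theorem theorem4p5:
  fixes T :: "'a::chilbert_space \<Rightarrow> 'b::chilbert_space \<Rightarrow> 'c::chilbert_space"
    and e1 :: "nat \<Rightarrow> 'a" and e2 :: "nat \<Rightarrow> 'b"
    and \<rho>1 :: "'a \<Rightarrow> 'a" and \<rho>2 :: "'b \<Rightarrow> 'b"
    and \<X> :: "'c set"
  assumes "hilbert_tensor T"
    and "countable_orthogonal_basis e1" and "countable_orthogonal_basis e2"
    and "finite_dim_csubspace \<X>"
    and "psd \<rho>1" and "trace_class \<rho>1" and "ctrace \<rho>1 = 1"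
    and "psd \<rho>2" and "trace_class \<rho>2" and "ctrace \<rho>2 = 1"
  shows "(\<exists>\<rho>. psd \<rho> \<and> trace_class \<rho> \<and> ctrace \<rho> = 1 \<and>
            ptrace1 T \<rho> = \<rho>2 \<and> ptrace2 T \<rho> = \<rho>1 \<and> op_support \<rho> \<subseteq> \<X>)
    \<longleftrightarrow> (\<lambda>n. sdp_max T e1 e2 \<rho>1 \<rho>2 \<X> n) \<longlonglongrightarrow> 1"
proof -
  define a where "a i = sgn (e1 i)" for i
  define b where "b i = sgn (e2 i)" for i
  interpret coupling_sdp T a b \<rho>1 \<rho>2
    using assms countable_orthogonal_basis_complete_sys[OF assms(2)]
      countable_orthogonal_basis_complete_sys[OF assms(3)]
    by unfold_locales (simp_all add: a_def[abs_def] b_def[abs_def])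
  have P1_eq: "trunc_proj e1 n = P1 n" and P2_eq: "trunc_proj e2 n = P2 n" for n
    using trunc_proj_eq_sys_proj[OF assms(2)] trunc_proj_eq_sys_proj[OF assms(3)]
    by (simp_all add: a_def[abs_def] b_def[abs_def])
  have Q_eq: "trunc_tensor T e1 e2 n = Q n" for n
    unfolding trunc_tensor_def P1_eq P2_eq Q_def t_def by (rule tensor_op_sys_proj[OF T]) auto
  obtain d :: nat and c where c: "orthosys {..<d} c" and \<X>: "\<X> = cspan (c ` {..<d})"
    using finite_dim_csubspaceE[OF assms(4)] by blast
  have ptrace_psd: "psd (ptrace1 T X)" "psd (ptrace2 T X)" if "psd X" "Q n \<circ> X \<circ> Q n = X" for X n
    using is_ptrace_psd[OF that(1) Q_invariant_is_ptrace1[OF that]]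
      is_ptrace_psd[OF that(1) Q_invariant_is_ptrace2[OF that]] by auto
  have feasible_eq: "sdp_feasible T e1 e2 \<rho>1 \<rho>2 n = feasible n" for n
  proof -
    have inv: "(\<exists>Y. psd Y \<and> X = Q n \<circ> Y \<circ> Q n) \<longleftrightarrow> psd X \<and> Q n \<circ> X \<circ> Q n = X" for X
    proof
      assume "\<exists>Y. psd Y \<and> X = Q n \<circ> Y \<circ> Q n"
      then obtain Y where Y: "psd Y" "X = Q n \<circ> Y \<circ> Q n" by blast
      have "psd X" unfolding Y(2) by (rule psd_conjugate[OF Y(1) Q_bounded_clinear Q_selfadjoint])
      moreover have "Q n \<circ> X \<circ> Q n = X" by (auto simp: Y(2) Q_idem)
      ultimately show "psd X \<and> Q n \<circ> X \<circ> Q n = X" by blast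
    next
      assume "psd X \<and> Q n \<circ> X \<circ> Q n = X"
      \<comment> \<open>An invariant \<open>X\<close> is its own compression, so it serves as
        \<open>Y\<close>.\<close>
      then show "\<exists>Y. psd Y \<and> X = Q n \<circ> Y \<circ> Q n" by (intro exI[of _ X]) simp
    qed
    show ?thesis
      unfolding sdp_feasible_def feasible_def Q_eq inv
      using ptrace_psd[of _ n] loewner_le_trunc_op_iff[OF _ assms(5,2), of _ n]
        loewner_le_trunc_op_iff[OF _ assms(8,3), of _ n]
      unfolding P1_eq P2_eq by blast
  qed
  \<comment> \<open>The image of \<X> may have smaller dimension than \<X>; zero vectors in
    \<open>g\<close> keep the length \<open>d\<close> for all \<open>n\<close>.\<close>
  have "\<exists>g. orthosys {..<d} g \<and> cspan (g ` {..<d}) = Q n ` \<X>" for n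
    using gram_schmidt[of d "\<lambda>k. Q n (c k)"]
    by (simp add: \<X> image_cspan[OF Q_bounded_clinear] image_image)
  then obtain g where g: "\<And>n. orthosys {..<d} (g n)" "\<And>n. cspan (g n ` {..<d}) = Q n ` \<X>"
    by metis
  have objective_eq: "Re (ctrace (X \<circ> orth_proj (Q n ` \<X>))) = objective d (g n) X" if "X \<in> feasible n" for X n
  proof -
    note X = psdD(1)[OF feasibleD(1)[OF that]]
    have "X \<circ> orth_proj (Q n ` \<X>) = finite_rank {..<d} (\<lambda>k. X (g n k)) (g n)"
      unfolding g(2)[symmetric] orth_proj_span[OF g(1) finite_lessThan]
      by (auto simp: sys_proj_def finite_rank_def rank1_def bounded_clinear_sum[OF X]
          bounded_clinear_scaleC[OF X])
    then show ?thesis by (simp add: ctrace_finite_rank objective_def)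
  qed
  let ?\<mu> = "sdp_max T e1 e2 \<rho>1 \<rho>2 \<X>"
  \<comment> \<open>\<open>GREATEST\<close> yields the optimal value because the maximum is
    attained.\<close>
  have max: "\<exists>X\<in>feasible n. ?\<mu> n = objective d (g n) X \<and>
      (\<forall>Y\<in>feasible n. objective d (g n) Y \<le> objective d (g n) X)" for n
  proof -
    obtain X where X: "X \<in> feasible n" "\<And>Y. Y \<in> feasible n \<Longrightarrow> objective d (g n) Y \<le> objective d (g n) X"
      using objective_max_exists[OF g(1)] by blast
    have "?\<mu> n = objective d (g n) X"
      unfolding sdp_max_def feasible_eq Q_eq
    proof (rule Greatest_equality)
      show "\<exists>Y\<in>feasible n. objective d (g n) X = Re (ctrace (Y \<circ> orth_proj (Q n ` \<X>)))"
        using X(1) objective_eq by metis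
      show "m \<le> objective d (g n) X"
        if "\<exists>Y\<in>feasible n. m = Re (ctrace (Y \<circ> orth_proj (Q n ` \<X>)))" for m
        using that X(2) objective_eq by auto
    qed
    then show ?thesis using X by blast
  qed
  have max1: "\<exists>X\<in>feasible n. ?\<mu> n = objective d (g n) X" for n using max by blast
  have max2: "objective d (g n) Y \<le> ?\<mu> n" if "Y \<in> feasible n" for n Y
    using max[of n] that by auto
  note g' = g(1) g(2)[unfolded \<X>]
  show ?thesis
  proof
    assume "\<exists>\<rho>. psd \<rho> \<and> trace_class \<rho> \<and> ctrace \<rho> = 1 \<and>
        ptrace1 T \<rho> = \<rho>2 \<and> ptrace2 T \<rho> = \<rho>1 \<and> op_support \<rho> \<subseteq> \<X>"
    then obtain \<rho> where "psd \<rho>" "ctrace \<rho> = 1" "ptrace1 T \<rho> = \<rho>2" "ptrace2 T \<rho> = \<rho>1"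
      "op_support \<rho> \<subseteq> cspan (c ` {..<d})"
      unfolding \<X> by blast
    from coupling_imp_limit[where g = g and \<mu> = ?\<mu>, OF c g' max1 max2 this] show "?\<mu> \<longlonglongrightarrow> 1"
      by simp
  next
    assume "?\<mu> \<longlonglongrightarrow> 1"
    from limit_imp_coupling[where g = g, OF c g' max1 this]
    show "\<exists>\<rho>. psd \<rho> \<and> trace_class \<rho> \<and> ctrace \<rho> = 1 \<and>
        ptrace1 T \<rho> = \<rho>2 \<and> ptrace2 T \<rho> = \<rho>1 \<and> op_support \<rho> \<subseteq> \<X>"
      unfolding \<X> .
  qed
qed

end
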